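(* Let $K\ge1$ and $K_0\ge0$ be constants and let $\gamma=\sup_{F\in\mathcal S_H}\frac{|F_{zz}(0)|}{2}$. Suppose $f=h+\overline g\in\mathcal S_H^0(K,K_0)$ with $h(z)=z+\sum_{n=2}^\infty a_nz^n$ and $g(z)=\sum_{n=2}^\infty b_nz^n$. Then for every $p\in(1/\gamma,\infty)$, $$M_p(r,f)=O\left(\frac1{(1-r)^{\gamma-\frac1p}}\right),$$ and there exists a constant $C(K,K_0)$, depending only on $K$ and $K_0$, such that $$|a_n|\le C(K,K_0)\,n^{\gamma-1}\qquad\text{for }n\in\{2,3,\ldots\}.$$ In particular, when $K-1=K_0=0$, the exponent $\gamma-1$ in the last inequality can be replaced by $1$.
   Context: $\mathbb D=\{z\in\mathbb C:|z|<1\}$. $\mathcal S_H$ is the family of sense-preserving univalent (injective) harmonic mappings $f=h+\overline g$ in $\mathbb D$, with $h,g$ analytic in $\mathbb D$, normalized by $h(0)=g(0)=h'(0)-1=0$. (Sense-preserving: $J_f=|h'|^2-|g'|^2>0$ in $\mathbb D$.) $\mathcal S_H^0=\{f=h+\overline g\in\mathcal S_H: g'(0)=0\}$. Put $f_z=h'$, $f_{\overline z}=\overline{g'}$, $\Lambda_f=|f_z|+|f_{\overline z}|$; $f_{zz}=h''$. $\mathcal S_H^0(K,K_0)$ is the set of $f\in\mathcal S_H^0$ that are harmonic $(K,K_0)$-quasiregular, i.e. $\Lambda_f^2\le KJ_f+K_0$ in $\mathbb D$. It is known that $2\le\gamma<48.4$ (in particular $\gamma$ is finite). $M_p(r,f)=\left(\frac1{2\pi}\int_0^{2\pi}|f(re^{i\theta})|^p\,d\theta\right)^{1/p}$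 for $r\in[0,1)$. For nonnegative functions $\chi_1,\chi_2$ on $[0,1)$, $\chi_1(r)=O(\chi_2(r))$ means: there exist $C>0$ and $r_0\in(0,1)$ with $\chi_1(r)\le C\chi_2(r)$ for all $r\in(r_0,1)$. *)

theory Defs
  imports "HOL-Complex_Analysis.Complex_Analysis" "HOL-Library.Landau_Symbols"
begin

text \<open>
  A harmonic mapping \<open>f = h + cnj g\<close> of the unit disc is represented by the pair
  \<open>(h, g)\<close> of its analytic and co-analytic parts, which the normalization
  \<open>g 0 = 0\<close> determines uniquely on the disc.  In these terms \<open>f\<^sub>z = h'\<close>, the
  \<open>z\<close>-bar derivative of \<open>f\<close> is \<open>cnj g'\<close>, and \<open>f\<^sub>z\<^sub>z = h''\<close>.
\<close>

abbreviation unit_disc :: "complex set" where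
  "unit_disc \<equiv> ball 0 1"

definition harmonic_map :: "(complex \<Rightarrow> complex) \<Rightarrow> (complex \<Rightarrow> complex) \<Rightarrow> complex \<Rightarrow> complex" where
  "harmonic_map h g z = h z + cnj (g z)"

definition jacobian :: "(complex \<Rightarrow> complex) \<Rightarrow> (complex \<Rightarrow> complex) \<Rightarrow> complex \<Rightarrow> real" where
  "jacobian h g z = (cmod (deriv h z))\<^sup>2 - (cmod (deriv g z))\<^sup>2"

definition max_stretch :: "(complex \<Rightarrow> complex) \<Rightarrow> (complex \<Rightarrow> complex) \<Rightarrow> complex \<Rightarrow> real" where
  "max_stretch h g z = cmod (deriv h z) + cmod (cnj (deriv g z))"

definition S_H :: "((complex \<Rightarrow> complex) \<times> (complex \<Rightarrow> complex)) set" where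
  "S_H = {(h, g).
     h holomorphic_on unit_disc \<and> g holomorphic_on unit_disc \<and>
     (\<forall>z\<in>unit_disc. jacobian h g z > 0) \<and>
     inj_on (harmonic_map h g) unit_disc \<and>
     h 0 = 0 \<and> g 0 = 0 \<and> deriv h 0 = 1}"

definition S_H0 :: "((complex \<Rightarrow> complex) \<times> (complex \<Rightarrow> complex)) set" where
  "S_H0 = {(h, g) \<in> S_H. deriv g 0 = 0}"

definition quasiregular :: "real \<Rightarrow> real \<Rightarrow> (complex \<Rightarrow> complex) \<Rightarrow> (complex \<Rightarrow> complex) \<Rightarrow> bool" where
  "quasiregular K K0 h g \<longleftrightarrow>
     (\<forall>z\<in>unit_disc. (max_stretch h g z)\<^sup>2 \<le> K * jacobian h g z + K0)"

definition S_H0_qr :: "real \<Rightarrow> real \<Rightarrow> ((complex \<Rightarrow> complex) \<times> (complex \<Rightarrow> complex)) set" where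
  "S_H0_qr K K0 = {(h, g) \<in> S_H0. quasiregular K K0 h g}"

text \<open>
  The supremum is taken in the reals; it is a classical theorem that the set is
  bounded above, so this is the genuine least upper bound.
\<close>

definition gamma_H :: real where
  "gamma_H = (SUP (h, g)\<in>S_H. cmod (deriv (deriv h) 0) / 2)"

definition integral_mean :: "real \<Rightarrow> real \<Rightarrow> (complex \<Rightarrow> complex) \<Rightarrow> real" where
  "integral_mean p r f =
     (1 / (2 * pi) * integral {0..2 * pi} (\<lambda>t. cmod (f (of_real r * cis t)) powr p)) powr (1 / p)"

end

theory Submission
  imports Defs
begin

text \<open>
  Three things have to be controlled: the constant \<open>gamma_H\<close>, the growth of a map in terms of
  \<open>gamma_H\<close>, and the passage from growth to integral means, where quasiregularity enters.

  The supremum \<open>gamma_H\<close> means something only because second coefficients over \<open>S_H\<close> are bounded.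
  An affine change of the target reduces this to \<open>S_H0\<close>, where the Schwarz lemma gives
  \<open>|g'| \<le> |z| |h'|\<close>, so that on \<open>|z| \<le> 1/2\<close> the squared stretch is at most three times the Jacobian.
  A length-area argument on circles (\<open>length_area_three_points\<close>) then shows that of two points
  whose distances from a centre have a large ratio, the nearer one has its image at most twice as
  far from the image of the centre as the farther one.  Moving the centre a little turns this into a doubling property of
  \<open>max |f|\<close> on small discs.  In the opposite direction \<open>h'\<close> has no zeros and \<open>h' 0 = 1\<close>, so
  Harnack's inequality for \<open>log |h'|\<close> bounds \<open>max |f|\<close> on a smaller disc by a constant times the square
  root of its value on a larger one.  Together these bound \<open>max |f|\<close> on a fixed disc absolutely, and with it
  the coefficients.  The Koebe function gives \<open>gamma_H \<ge> 2\<close>.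

  Since \<open>S_H\<close> is invariant under disc automorphisms followed by renormalization, the bound for the
  second coefficient at \<open>0\<close> becomes a bound for \<open>h'' / h'\<close> at every point, and integration along
  radii gives \<open>|f z| \<le> B (1 - |z|) powr (- gamma_H)\<close>.

  For the means, work with \<open>Q = 1 + |f|^2\<close>, which has no zeros, and
  \<open>I s = \<integral> Q powr (p/2)\<close> over the circle of radius \<open>s\<close>.  The increment of \<open>I\<close> between two radii is at
  most \<open>p \<integral>\<integral> Q powr ((p-1)/2) L\<close>, where \<open>L\<close> is the stretch \<open>|h'| + |g'|\<close>.  The elementary inequality
  between means, with the weight \<open>1 - s\<close>, splits this into a multiple of
  \<open>\<integral> I s / (1 - s)\<close> and a multiple of \<open>\<integral>\<integral> Q powr (p/2 - 1) L^2 (1 - s)\<close>.  Quasiregularity replaces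
  \<open>L^2\<close> by the Jacobian up to a bounded error, the growth bound replaces \<open>1 - s\<close> by a negative power of \<open>Q\<close>,
  and since \<open>f\<close> is injective the area formula turns what remains into a radial integral over a
  disc of radius about \<open>(1 - r) powr (- gamma_H)\<close>.  The weight in the inequality is chosen so that
  the first part is half of the bound to be proved, so a supremum argument
  (\<open>circle_mean_bound\<close>) closes the estimate for every \<open>p\<close> with \<open>p * gamma_H > 1\<close>.  The constants
  depend only on \<open>K\<close>, \<open>K0\<close>, \<open>p\<close> and the growth exponent, and the case \<open>p = 1\<close> on the circle of
  radius \<open>1 - 1/n\<close> bounds the coefficient \<open>a n\<close>.

  If \<open>K = 1\<close> and \<open>K0 = 0\<close>, the map is conformal, Bieberbach's bound \<open>|a 2| \<le> 2\<close> takes the place of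
  \<open>gamma_H\<close>, and the same argument with growth exponent \<open>2\<close> gives coefficients of order \<open>n\<close>.
  Bieberbach's bound itself comes from the same area formula, applied to the square root transform.
\<close>

section \<open>Change of variables for injective plane maps\<close>

text \<open>
  The change of variables theorem concerns maps of \<open>real^2\<close>.  Lebesgue measure on
  \<open>real \<times> real\<close> and on \<open>complex\<close> is the image of the one on \<open>real^2\<close> under the coordinate maps,
  since boxes correspond to boxes.
\<close>
lemma lborel_distr_vec2_pair:
  "distr lborel borel (\<lambda>x::real^2. (vec_nth x 1, vec_nth x 2)) = lborel"
proof (rule sym, rule lborel_eqI)
  fix l u :: "real \<times> real" assume le: "\<And>b. b \<in> Basis \<Longrightarrow> l \<bullet> b \<le> u \<bullet> b"
  obtain l1 l2 u1 u2 where lu: "l = (l1, l2)" "u = (u1, u2)" by fastforce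
  have le12: "l1 \<le> u1" "l2 \<le> u2"
    using le[of "(1,0)"] le[of "(0,1)"] by (auto simp: lu Basis_prod_def)
  have [measurable]: "(\<lambda>x::real^2. (vec_nth x 1, vec_nth x 2)) \<in> borel_measurable borel"
    by (intro borel_measurable_continuous_onI continuous_intros)
  have "(\<lambda>x::real^2. (vec_nth x 1, vec_nth x 2)) -` box l u = box (vector [l1, l2]) (vector [u1, u2])"
    by (auto simp: lu mem_box_cart forall_2 mem_box[where 'a = "real \<times> real"] Basis_prod_def)
  moreover have "(\<Prod>b\<in>Basis. ((vector [u1, u2] :: real^2) - vector [l1, l2]) \<bullet> b) = (u1 - l1) * (u2 - l2)"
    by (simp add: Basis_vec_def cart_eq_inner_axis[symmetric] UNIV_2 axis_eq_axis insert_commute)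
  moreover have "(\<Prod>b\<in>Basis. (u - l) \<bullet> b) = (u1 - l1) * (u2 - l2)"
    by (simp add: lu Basis_prod_def)
  ultimately show "emeasure (distr lborel borel (\<lambda>x::real^2. (vec_nth x 1, vec_nth x 2))) (box l u) =
      (\<Prod>b\<in>Basis. (u - l) \<bullet> b)"
    using le12
    by (simp add: emeasure_distr emeasure_lborel_box_eq forall_2 Basis_vec_def
        cart_eq_inner_axis[symmetric] UNIV_2)
qed simp

lemma lborel_distr_vec2_complex:
  "distr lborel borel (\<lambda>x::real^2. Complex (vec_nth x 1) (vec_nth x 2)) = lborel"
proof (rule sym, rule lborel_eqI)
  fix l u :: complex assume le: "\<And>b. b \<in> Basis \<Longrightarrow> l \<bullet> b \<le> u \<bullet> b"
  have le12: "Re l \<le> Re u" "Im l \<le> Im u"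
    using le[of 1] le[of \<i>] by (auto simp: Basis_complex_def)
  have [measurable]: "(\<lambda>x::real^2. Complex (vec_nth x 1) (vec_nth x 2)) \<in> borel_measurable borel"
    unfolding complex_eq by (intro borel_measurable_continuous_onI continuous_intros)
  have "(\<lambda>x::real^2. Complex (vec_nth x 1) (vec_nth x 2)) -` box l u = box (vector [Re l, Im l]) (vector [Re u, Im u])"
    by (auto simp: in_box_complex_iff mem_box_cart forall_2)
  moreover have "(\<Prod>b\<in>Basis. (u - l) \<bullet> b) = (Re u - Re l) * (Im u - Im l)"
    by (simp add: Basis_complex_def)
  ultimately show "emeasure (distr lborel borel (\<lambda>x::real^2. Complex (vec_nth x 1) (vec_nth x 2))) (box l u) =
      (\<Prod>b\<in>Basis. (u - l) \<bullet> b)"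
    using le12
    by (simp add: emeasure_distr emeasure_lborel_box_eq forall_2 Basis_vec_def
        cart_eq_inner_axis[symmetric] UNIV_2 axis_eq_axis)
qed simp



text \<open>
  Measuring \<open>\<Phi> ` S\<close> inside an arbitrary Borel set \<open>Y\<close> makes the statement an equality of measures,
  from which integrals of all nonnegative functions follow.  Since \<open>S\<close> is open, invariance of domain
  makes \<open>\<Phi> ` S\<close> open, hence Borel; boundedness of the image gives the integrability that the
  change of variables theorem needs.
\<close>
lemma image_area_plane:
  fixes \<Phi> :: "real \<times> real \<Rightarrow> complex" and A B :: "real \<times> real \<Rightarrow> complex"
  assumes S: "open S"
    and der: "\<And>x. x \<in> S \<Longrightarrow>
      (\<Phi> has_derivative (\<lambda>v. of_real (fst v) * A x + of_real (snd v) * B x)) (at x)"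
    and inj: "inj_on \<Phi> S" and bdd: "bounded (\<Phi> ` S)"
    and contA: "continuous_on S A" and contB: "continuous_on S B"
    and Y: "Y \<in> sets borel"
  shows "(\<integral>\<^sup>+x. ennreal (indicator (S \<inter> \<Phi> -` Y) x * \<bar>Im (cnj (A x) * B x)\<bar>) \<partial>lborel)
     = emeasure lborel (\<Phi> ` S \<inter> Y)"
proof -
  define \<sigma> :: "real^2 \<Rightarrow> real \<times> real" where "\<sigma> x = (vec_nth x 1, vec_nth x 2)" for x
  define \<tau> :: "complex \<Rightarrow> real^2" where "\<tau> z = vector [Re z, Im z]" for z
  define \<kappa> :: "real^2 \<Rightarrow> complex" where "\<kappa> x = Complex (vec_nth x 1) (vec_nth x 2)" for x
  define D where "D x = \<bar>Im (cnj (A x) * B x)\<bar>" for x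
  define T where "T = S \<inter> \<Phi> -` Y"
  define U where "U = \<sigma> -` T"
  define \<Psi> where "\<Psi> = \<tau> \<circ> \<Phi> \<circ> \<sigma>"
  have [measurable]: "\<sigma> \<in> borel_measurable borel"
    unfolding \<sigma>_def by (intro borel_measurable_continuous_onI continuous_intros)
  have [measurable]: "\<kappa> \<in> borel_measurable borel"
    unfolding \<kappa>_def complex_eq by (intro borel_measurable_continuous_onI continuous_intros)
  have cont: "continuous_on S \<Phi>"
    using der by (meson continuous_at_imp_continuous_on has_derivative_continuous)
  have T [measurable]: "T \<in> sets borel"
  proof -
    have "(\<lambda>x. indicator S x *\<^sub>R \<Phi> x) \<in> borel_measurable borel"
      using S cont by (intro borel_measurable_continuous_on_indicator) auto
    from measurable_sets[OF this Y] have "S \<inter> (\<lambda>x. indicator S x *\<^sub>R \<Phi> x) -` Y \<in> sets borel"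
      using S by auto
    moreover have "S \<inter> (\<lambda>x. indicator S x *\<^sub>R \<Phi> x) -` Y = T"
      by (auto simp: T_def)
    ultimately show ?thesis by simp
  qed
  have op: "open (\<Phi> ` S)"
    using invariance_of_domain_gen[OF S cont inj] by simp
  have img: "\<Phi> ` T = \<Phi> ` S \<inter> Y" unfolding T_def by auto
  have imgB: "\<Phi> ` S \<inter> Y \<in> sets borel" using op Y by auto
  have \<tau>\<kappa>: "\<tau> (\<kappa> x) = x" for x
    by (simp add: \<tau>_def \<kappa>_def vec_eq_iff forall_2)
  have \<kappa>\<tau>: "\<kappa> (\<tau> z) = z" for z
    by (simp add: \<tau>_def \<kappa>_def complex_eq_iff)
  have \<tau>_lin: "bounded_linear \<tau>"
    by (rule linear_conv_bounded_linear[THEN iffD1], rule linearI)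
       (auto simp: \<tau>_def vec_eq_iff forall_2)
  have \<sigma>_lin: "bounded_linear \<sigma>"
    by (rule linear_conv_bounded_linear[THEN iffD1], rule linearI) (auto simp: \<sigma>_def)
  have \<sigma>_surj: "\<exists>x. \<sigma> x = y" for y
    by (rule exI[of _ "vector [fst y, snd y]"]) (simp add: \<sigma>_def)
  have Usets: "U \<in> sets lebesgue"
    unfolding U_def using measurable_sets[of \<sigma> borel borel T] by simp
  have \<Psi>U: "\<Psi> ` U = \<kappa> -` (\<Phi> ` S \<inter> Y)"
  proof -
    have "\<Psi> ` U = \<tau> ` (\<Phi> ` T)"
    proof -
      have "\<sigma> ` U = T" 
        unfolding U_def using \<sigma>_surj by (intro surj_image_vimage_eq) (metis surjI)
      then show ?thesis unfolding \<Psi>_def by (metis image_comp)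
    qed
    also have "\<dots> = \<kappa> -` (\<Phi> ` T)" 
    proof (intro set_eqI iffI)
      fix x assume "x \<in> \<kappa> -` (\<Phi> ` T)"
      then have "\<tau> (\<kappa> x) \<in> \<tau> ` (\<Phi> ` T)" by (intro imageI) simp
      then show "x \<in> \<tau> ` (\<Phi> ` T)" by (simp only: \<tau>\<kappa>)
    qed (auto simp: \<kappa>\<tau>)
    finally show ?thesis by (simp add: img)
  qed
  define \<Psi>' :: "real^2 \<Rightarrow> real^2 \<Rightarrow> real^2" where "\<Psi>' x v = \<tau> (of_real (vec_nth v 1) * A (\<sigma> x) + of_real (vec_nth v 2) * B (\<sigma> x))" for x v
  have der\<Psi>: "(\<Psi> has_derivative \<Psi>' x) (at x within U)" if "x \<in> U" for x
  proof -
    have "\<sigma> x \<in> S" using that by (simp add: U_def T_def)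
    then have 1: "(\<Phi> has_derivative (\<lambda>v. of_real (fst v) * A (\<sigma> x) + of_real (snd v) * B (\<sigma> x))) (at (\<sigma> x))"
      by (rule der)
    have 2: "(\<sigma> has_derivative \<sigma>) (at x)"
      using \<sigma>_lin by (rule bounded_linear_imp_has_derivative)
    have 3: "(\<tau> has_derivative \<tau>) (at y)" for y
      using \<tau>_lin by (rule bounded_linear_imp_has_derivative)
    have "(\<Psi> has_derivative \<Psi>' x) (at x)"
      using diff_chain_at[OF diff_chain_at[OF 2 1] 3]
      unfolding \<Psi>_def \<Psi>'_def comp_def by (simp add: \<sigma>_def)
    then show ?thesis by (rule has_derivative_at_withinI)
  qed
  have inj\<Psi>: "inj_on \<Psi> U"
  proof (rule inj_onI)
    fix x y assume xy: "x \<in> U" "y \<in> U" "\<Psi> x = \<Psi> y"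
    then have "\<kappa> (\<tau> (\<Phi> (\<sigma> x))) = \<kappa> (\<tau> (\<Phi> (\<sigma> y)))" by (simp add: \<Psi>_def)
    then have "\<Phi> (\<sigma> x) = \<Phi> (\<sigma> y)" by (simp only: \<kappa>\<tau>)
    then have "\<sigma> x = \<sigma> y" using inj xy by (auto simp: U_def T_def dest: inj_onD)
    then show "x = y" by (simp add: \<sigma>_def vec_eq_iff forall_2)
  qed
  have det: "\<bar>det (matrix (\<Psi>' x))\<bar> = D (\<sigma> x)" for x
    by (simp add: det_2 matrix_def \<Psi>'_def \<tau>_def D_def axis_def mult.commute)
  have "bounded (\<tau> ` (\<Phi> ` S))"
    using bounded_linear_image[OF bdd \<tau>_lin] .
  moreover have "\<Psi> ` U \<subseteq> \<tau> ` (\<Phi> ` S)"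
    by (auto simp: \<Psi>_def U_def T_def)
  ultimately have bU: "bounded (\<Psi> ` U)"
    by (rule bounded_subset)
  have sU: "\<Psi> ` U \<in> sets borel"
    unfolding \<Psi>U using measurable_sets[of \<kappa> borel borel "\<Phi> ` S \<inter> Y"] imgB by simp
  have lm: "\<Psi> ` U \<in> lmeasurable"
    using bU sU by (intro bounded_set_imp_lmeasurable) auto
  have "((\<lambda>x. \<bar>det (matrix (\<Psi>' x))\<bar>) has_integral measure lebesgue (\<Psi> ` U)) U"
    using has_measure_differentiable_image[OF Usets der\<Psi> inj\<Psi>, of "measure lebesgue (\<Psi> ` U)"] lm by simp
  then have hi: "((\<lambda>x. D (\<sigma> x)) has_integral measure lebesgue (\<Psi> ` U)) U"
    by (simp only: det)
  have D_nonneg: "0 \<le> D x" for x by (simp add: D_def)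
  have "(\<integral>\<^sup>+x. ennreal (indicator U x * D (\<sigma> x)) \<partial>lborel) = ennreal (measure lebesgue (\<Psi> ` U))"
    by (rule nn_integral_has_integral_lebesgue[OF _ hi]) (auto simp: D_nonneg)
  also have "\<dots> = emeasure lebesgue (\<Psi> ` U)"
    using fmeasurableD2[OF lm] by (intro emeasure_eq_ennreal_measure[symmetric]) (simp add: less_top)
  also have "\<dots> = emeasure lborel (\<Psi> ` U)"
    using sU by simp
  also have "\<dots> = emeasure lborel (\<kappa> -` (\<Phi> ` S \<inter> Y))" by (simp add: \<Psi>U)
  also have "\<dots> = emeasure (distr lborel borel \<kappa>) (\<Phi> ` S \<inter> Y)"
    using imgB by (simp add: emeasure_distr)
  also have "distr lborel borel \<kappa> = lborel"
    unfolding \<kappa>_def by (rule lborel_distr_vec2_complex)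
  finally have 1: "(\<integral>\<^sup>+x. ennreal (indicator U x * D (\<sigma> x)) \<partial>lborel) = emeasure lborel (\<Phi> ` S \<inter> Y)" .
  have "(\<lambda>x. indicator S x *\<^sub>R D x) \<in> borel_measurable borel"
    using S contA contB unfolding D_def
    by (intro borel_measurable_continuous_on_indicator continuous_intros) auto
  note [measurable] = this
  have "(\<lambda>x. indicator T x *\<^sub>R (indicator S x *\<^sub>R D x)) \<in> borel_measurable borel"
    by measurable
  moreover have "(\<lambda>x. indicator T x *\<^sub>R (indicator S x *\<^sub>R D x)) = (\<lambda>x. indicator T x * D x)"
    by (auto simp: T_def indicator_def)
  ultimately have mD [measurable]: "(\<lambda>x. indicator T x * D x) \<in> borel_measurable borel" by simp
  have "(\<integral>\<^sup>+x. ennreal (indicator T x * D x) \<partial>lborel)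
      = (\<integral>\<^sup>+x. ennreal (indicator T x * D x) \<partial>distr lborel borel \<sigma>)"
    unfolding \<sigma>_def by (simp add: lborel_distr_vec2_pair)
  also have "\<dots> = (\<integral>\<^sup>+x. ennreal (indicator T (\<sigma> x) * D (\<sigma> x)) \<partial>lborel)"
    by (subst nn_integral_distr) auto
  also have "\<dots> = (\<integral>\<^sup>+x. ennreal (indicator U x * D (\<sigma> x)) \<partial>lborel)"
    by (simp add: U_def indicator_def)
  finally show ?thesis using 1 by (simp add: T_def D_def)
qed

lemma nn_integral_change_of_variables_plane:
  fixes \<Phi> :: "real \<times> real \<Rightarrow> complex" and A B :: "real \<times> real \<Rightarrow> complex"
  assumes S: "open S"
    and der: "\<And>x. x \<in> S \<Longrightarrow>
      (\<Phi> has_derivative (\<lambda>v. of_real (fst v) * A x + of_real (snd v) * B x)) (at x)"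
    and inj: "inj_on \<Phi> S" and bdd: "bounded (\<Phi> ` S)"
    and contA: "continuous_on S A" and contB: "continuous_on S B"
    and w [measurable]: "w \<in> borel_measurable borel"
  shows "(\<integral>\<^sup>+x. ennreal (indicator S x * \<bar>Im (cnj (A x) * B x)\<bar>) * w (\<Phi> x) \<partial>lborel)
     = (\<integral>\<^sup>+y. indicator (\<Phi> ` S) y * w y \<partial>lborel)"
proof -
  define D where "D x = indicator S x *\<^sub>R \<bar>Im (cnj (A x) * B x)\<bar>" for x
  define F where "F x = indicator S x *\<^sub>R \<Phi> x" for x
  have cont: "continuous_on S \<Phi>"
    using der by (meson continuous_at_imp_continuous_on has_derivative_continuous)
  have [measurable]: "F \<in> borel_measurable borel"
    unfolding F_def[abs_def] using S cont by (intro borel_measurable_continuous_on_indicator) auto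
  have [measurable]: "D \<in> borel_measurable borel"
    unfolding D_def[abs_def] using S contA contB
    by (intro borel_measurable_continuous_on_indicator continuous_intros) auto
  have op: "open (\<Phi> ` S)"
    using invariance_of_domain_gen[OF S cont inj] by simp
  then have [measurable]: "\<Phi> ` S \<in> sets borel" by simp
  have "distr (density lborel (\<lambda>x. ennreal (D x))) borel F = density lborel (indicator (\<Phi> ` S))"
    (is "?L = ?R")
  proof (rule measure_eqI)
    fix Y assume "Y \<in> sets ?L"
    then have Y [measurable]: "Y \<in> sets borel" by simp
    have "emeasure ?L Y = (\<integral>\<^sup>+x. ennreal (D x) * indicator (F -` Y) x \<partial>lborel)"
      using measurable_sets[of F borel borel Y]
      by (simp add: emeasure_distr emeasure_density)
    also have "\<dots> = (\<integral>\<^sup>+x. ennreal (indicator (S \<inter> \<Phi> -` Y) x * \<bar>Im (cnj (A x) * B x)\<bar>) \<partial>lborel)"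
      by (rule nn_integral_cong) (auto simp: D_def F_def indicator_def)
    also have "\<dots> = emeasure lborel (\<Phi> ` S \<inter> Y)"
      by (rule image_area_plane[OF S der inj bdd contA contB Y])
    also have "\<dots> = emeasure ?R Y"
      by (simp add: emeasure_density flip: indicator_inter_arith)
    finally show "emeasure ?L Y = emeasure ?R Y" .
  qed simp
  then have "(\<integral>\<^sup>+y. w y \<partial>?L) = (\<integral>\<^sup>+y. w y \<partial>?R)" by simp
  then have "(\<integral>\<^sup>+x. ennreal (D x) * w (F x) \<partial>lborel) = (\<integral>\<^sup>+y. indicator (\<Phi> ` S) y * w y \<partial>lborel)"
    by (simp add: nn_integral_distr nn_integral_density)
  moreover have "ennreal (D x) * w (F x) = ennreal (indicator S x * \<bar>Im (cnj (A x) * B x)\<bar>) * w (\<Phi> x)" for x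
    by (auto simp: D_def F_def indicator_def)
  ultimately show ?thesis by simp
qed

section \<open>Area in polar coordinates\<close>

text \<open>
  Polar coordinates are used as a single map on \<open>real \<times> real\<close>, so that
  integrals over annuli in the source become integrals over rectangles, where Fubini's theorem applies.
\<close>
abbreviation polar :: "complex \<Rightarrow> real \<times> real \<Rightarrow> complex" where
  "polar c x \<equiv> c + of_real (fst x) * cis (snd x)"

abbreviation annulus :: "complex \<Rightarrow> real \<Rightarrow> real \<Rightarrow> complex set" where
  "annulus c r1 r2 \<equiv> {z. r1 < cmod (z - c) \<and> cmod (z - c) < r2}"

abbreviation polar_box :: "real \<Rightarrow> real \<Rightarrow> (real \<times> real) set" where
  "polar_box r1 r2 \<equiv> {r1<..<r2} \<times> {0<..<2 * pi}"

lemma open_annulus: "open (annulus c r1 r2)"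
  by (intro open_Collect_conj open_Collect_less continuous_intros)

lemma polar_in_annulus:
  assumes "0 \<le> r1" "x \<in> {r1<..<r2} \<times> UNIV" shows "polar c x \<in> annulus c r1 r2"
  using assms by (auto simp: norm_mult)

lemma inj_on_polar:
  assumes "0 \<le> r1" shows "inj_on (polar c) (polar_box r1 r2)"
proof (rule inj_onI)
  fix x y assume xy: "x \<in> polar_box r1 r2" "y \<in> polar_box r1 r2" "polar c x = polar c y"
  have pos: "fst x > 0" "fst y > 0" using xy assms by (auto simp: mem_Times_iff)
  have eq: "of_real (fst x) * cis (snd x) = of_real (fst y) * cis (snd y)" using xy(3) by simp
  then have "cmod (of_real (fst x) * cis (snd x)) = cmod (of_real (fst y) * cis (snd y))" by simp
  then have r: "fst x = fst y" using pos by (simp add: norm_mult)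
  then have c: "cis (snd x) = cis (snd y)" using eq pos by simp
  have "snd x = Arg2pi (cis (snd x))" "snd y = Arg2pi (cis (snd y))"
    using xy by (auto simp: mem_Times_iff cis_conv_exp Arg2pi_exp)
  with r c show "x = y" by (simp add: prod_eq_iff)
qed

lemma has_derivative_polar:
  "(polar c has_derivative
     (\<lambda>v. of_real (fst v) * cis (snd x) + of_real (snd v) * (\<i> * of_real (fst x) * cis (snd x)))) (at x)"
proof -
  have "((\<lambda>x. \<i> * of_real (snd x)) has_derivative (\<lambda>v. \<i> * of_real (snd v))) (at x)"
    by (auto intro!: derivative_eq_intros)
  from has_derivative_compose[OF this DERIV_exp[unfolded has_field_derivative_def]]
  have e: "((\<lambda>x. exp (\<i> * of_real (snd x))) has_derivative
      (\<lambda>v. exp (\<i> * of_real (snd x)) * (\<i> * of_real (snd v)))) (at x)" by simp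
  have "((\<lambda>x. c + of_real (fst x) * exp (\<i> * of_real (snd x))) has_derivative
     (\<lambda>v. of_real (fst v) * cis (snd x) + of_real (snd v) * (\<i> * of_real (fst x) * cis (snd x)))) (at x)"
    by (auto intro!: derivative_eq_intros e simp: cis_conv_exp algebra_simps)
  then show ?thesis by (simp add: cis_conv_exp)
qed

lemma has_derivative_harmonic_polar:
  assumes U: "open U" and h: "h holomorphic_on U" and g: "g holomorphic_on U" and x: "polar c x \<in> U"
  shows "((\<lambda>x. harmonic_map h g (polar c x)) has_derivative
     (\<lambda>v. of_real (fst v) * (deriv h (polar c x) * cis (snd x) + cnj (deriv g (polar c x) * cis (snd x)))
        + of_real (snd v) * (\<i> * of_real (fst x) *
            (deriv h (polar c x) * cis (snd x) - cnj (deriv g (polar c x) * cis (snd x)))))) (at x)"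
proof -
  have dh: "(h has_derivative (*) (deriv h (polar c x))) (at (polar c x))"
    using holomorphic_derivI[OF h U x] by (simp add: has_field_derivative_def)
  have dg: "(g has_derivative (*) (deriv g (polar c x))) (at (polar c x))"
    using holomorphic_derivI[OF g U x] by (simp add: has_field_derivative_def)
  have 1: "((\<lambda>x. h (polar c x)) has_derivative (\<lambda>v. deriv h (polar c x) *
      (of_real (fst v) * cis (snd x) + of_real (snd v) * (\<i> * of_real (fst x) * cis (snd x))))) (at x)"
    using has_derivative_compose[OF has_derivative_polar dh] by simp
  have 2: "((\<lambda>x. g (polar c x)) has_derivative (\<lambda>v. deriv g (polar c x) *
      (of_real (fst v) * cis (snd x) + of_real (snd v) * (\<i> * of_real (fst x) * cis (snd x))))) (at x)"
    using has_derivative_compose[OF has_derivative_polar dg] by simp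
  show ?thesis
    unfolding harmonic_map_def
    by (rule has_derivative_eq_rhs[OF has_derivative_add[OF 1 has_derivative_cnj[OF 2]]])
       (auto simp: fun_eq_iff algebra_simps)
qed

text \<open>
  The left side is the determinant of the partial derivatives in radius and angle of \<open>h + cnj g\<close>,
  where \<open>a\<close> and \<open>b\<close> stand for the derivatives of \<open>h\<close> and \<open>g\<close>.
\<close>
lemma polar_jacobian:
  "Im (cnj (a * cis t + cnj (b * cis t)) * (\<i> * of_real s * (a * cis t - cnj (b * cis t))))
     = s * ((cmod a)\<^sup>2 - (cmod b)\<^sup>2)"
proof -
  define u v where "u = a * cis t" and "v = b * cis t"
  have uv: "(cmod u)\<^sup>2 = (cmod a)\<^sup>2" "(cmod v)\<^sup>2 = (cmod b)\<^sup>2" by (simp_all add: u_def v_def norm_mult)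
  have "Im (cnj (u + cnj v) * (\<i> * of_real s * (u - cnj v))) = s * ((cmod u)\<^sup>2 - (cmod v)\<^sup>2)"
    unfolding cmod_power2 by (simp add: algebra_simps power2_eq_square)
  then show ?thesis unfolding uv unfolding u_def v_def .
qed

text \<open>
  The angles \<open>0\<close> and \<open>2 * pi\<close> are left out, so that polar coordinates are injective on an open set;
  the image is that of a slit annulus.
\<close>
lemma nn_integral_polar_harmonic:
  assumes h: "h holomorphic_on annulus c r1 r2" and g: "g holomorphic_on annulus c r1 r2"
    and inj: "inj_on (harmonic_map h g) (annulus c r1 r2)" and r1: "0 \<le> r1"
    and bdd: "bounded (harmonic_map h g ` annulus c r1 r2)"
    and w: "w \<in> borel_measurable borel"
  shows "(\<integral>\<^sup>+x. ennreal (indicator (polar_box r1 r2) x * (fst x * \<bar>jacobian h g (polar c x)\<bar>))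
             * w (harmonic_map h g (polar c x)) \<partial>lborel)
       = (\<integral>\<^sup>+y. indicator (harmonic_map h g ` polar c ` polar_box r1 r2) y * w y \<partial>lborel)"
proof -
  define \<Phi> where "\<Phi> x = harmonic_map h g (polar c x)" for x
  define A where "A x = deriv h (polar c x) * cis (snd x) + cnj (deriv g (polar c x) * cis (snd x))" for x
  define B where "B x = \<i> * of_real (fst x) *
            (deriv h (polar c x) * cis (snd x) - cnj (deriv g (polar c x) * cis (snd x)))" for x :: "real \<times> real"
  let ?S = "polar_box r1 r2"
  have S: "open ?S" by (intro open_Times) auto
  have sub: "polar c ` ?S \<subseteq> annulus c r1 r2"
    using polar_in_annulus[OF r1] by blast
  have pin: "polar c x \<in> annulus c r1 r2" if "x \<in> ?S" for x using sub that by blast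
  have cont_pol: "continuous_on T (polar c)" for T
    by (intro continuous_intros)
  have chp: "continuous_on ?S (\<lambda>x. deriv h (polar c x))"
    using sub holomorphic_on_imp_continuous_on[OF holomorphic_deriv[OF h open_annulus]]
    by (intro continuous_on_compose2[OF _ cont_pol]) auto
  have cgp: "continuous_on ?S (\<lambda>x. deriv g (polar c x))"
    using sub holomorphic_on_imp_continuous_on[OF holomorphic_deriv[OF g open_annulus]]
    by (intro continuous_on_compose2[OF _ cont_pol]) auto
  have "(\<integral>\<^sup>+x. ennreal (indicator ?S x * \<bar>Im (cnj (A x) * B x)\<bar>) * w (\<Phi> x) \<partial>lborel)
     = (\<integral>\<^sup>+y. indicator (\<Phi> ` ?S) y * w y \<partial>lborel)"
  proof (rule nn_integral_change_of_variables_plane[OF S _ _ _ _ _ w])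
    show "(\<Phi> has_derivative (\<lambda>v. of_real (fst v) * A x + of_real (snd v) * B x)) (at x)" if "x \<in> ?S" for x
      unfolding \<Phi>_def A_def B_def
      by (rule has_derivative_harmonic_polar[OF open_annulus h g pin[OF that]])
    show "inj_on \<Phi> ?S"
      unfolding \<Phi>_def using comp_inj_on[OF inj_on_polar[OF r1] inj_on_subset[OF inj sub]]
      by (simp add: comp_def)
    show "bounded (\<Phi> ` ?S)"
      by (rule bounded_subset[OF bdd]) (use pin in \<open>auto simp: \<Phi>_def\<close>)
    show "continuous_on ?S A" "continuous_on ?S B"
      unfolding A_def B_def by (intro continuous_intros chp cgp)+
  qed
  moreover have "(\<lambda>x. indicator ?S x * \<bar>Im (cnj (A x) * B x)\<bar>) = (\<lambda>x. indicator ?S x * (fst x * \<bar>jacobian h g (polar c x)\<bar>))"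
  proof
    fix x
    have "Im (cnj (A x) * B x) = fst x * jacobian h g (polar c x)"
      unfolding A_def B_def jacobian_def by (rule polar_jacobian)
    then show "indicator ?S x * \<bar>Im (cnj (A x) * B x)\<bar> = indicator ?S x * (fst x * \<bar>jacobian h g (polar c x)\<bar>)"
      using r1 by (auto simp only: abs_mult indicator_def) auto
  qed
  moreover have "\<Phi> ` ?S = harmonic_map h g ` polar c ` ?S"
    by (auto simp: \<Phi>_def image_image)
  ultimately have "(\<integral>\<^sup>+x. ennreal (indicator ?S x * (fst x * \<bar>jacobian h g (polar c x)\<bar>)) * w (\<Phi> x) \<partial>lborel)
     = (\<integral>\<^sup>+y. indicator (harmonic_map h g ` polar c ` ?S) y * w y \<partial>lborel)"
    by (simp only: fun_eq_iff)
  then show ?thesis by (simp only: \<Phi>_def)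
qed

lemma nn_integral_Ioo_derivative:
  fixes F f :: "real \<Rightarrow> real"
  assumes "a \<le> b" "\<And>t. t \<in> {a..b} \<Longrightarrow> (F has_real_derivative f t) (at t within {a..b})"
    and "\<And>t. t \<in> {a..b} \<Longrightarrow> 0 \<le> f t"
  shows "(\<integral>\<^sup>+t. ennreal (indicator {a<..<b} t * f t) \<partial>lborel) = ennreal (F b - F a)"
proof -
  have "(f has_integral (F b - F a)) {a..b}"
    using assms by (intro fundamental_theorem_of_calculus)
      (auto simp: has_real_derivative_iff_has_vector_derivative)
  then have "(f has_integral (F b - F a)) {a<..<b}"
    by (simp add: has_integral_Icc_iff_Ioo)
  then show ?thesis
    using assms(3) by (intro nn_integral_has_integral_lebesgue) auto
qed

text \<open>
  The bound in this form can be integrated once more over a parameter without any discussion of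
  integrability.
\<close>
lemma increment_le_nn_integral:
  fixes v B :: "real \<Rightarrow> real"
  assumes ab: "a \<le> b" and v: "\<And>t. t \<in> {a..b} \<Longrightarrow> (v has_vector_derivative v' t) (at t within {a..b})"
    and bnd: "\<And>t. t \<in> {a..b} \<Longrightarrow> \<bar>v' t\<bar> \<le> B t" and B: "continuous_on {a..b} B"
  shows "ennreal \<bar>v b - v a\<bar> \<le> (\<integral>\<^sup>+t. ennreal (indicator {a<..<b} t * B t) \<partial>lborel)"
proof -
  have vi: "(v' has_integral (v b - v a)) {a..b}"
    using assms by (intro fundamental_theorem_of_calculus) auto
  have Bi: "(B has_integral integral {a..b} B) {a..b}"
    using B by (simp add: integrable_continuous_real integrable_integral)
  have "norm (integral {a..b} v') \<le> integral {a..b} B"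
    using vi Bi bnd by (intro integral_norm_bound_integral) auto
  then have le: "\<bar>v b - v a\<bar> \<le> integral {a..b} B"
    using vi by (simp add: integral_unique)
  have "(B has_integral integral {a..b} B) {a<..<b}"
    using Bi by (simp add: has_integral_Icc_iff_Ioo)
  then have "(\<integral>\<^sup>+t. ennreal (indicator {a<..<b} t * B t) \<partial>lborel) = ennreal (integral {a..b} B)"
  proof (intro nn_integral_has_integral_lebesgue)
    show "0 \<le> B t" if "t \<in> {a<..<b}" for t
      using bnd[of t] that by auto
  qed
  with le show ?thesis by (simp add: ennreal_leI)
qed

lemma measurable_fst_snd_real [measurable]:
  "(fst :: real \<times> real \<Rightarrow> real) \<in> borel_measurable borel"
  "(snd :: real \<times> real \<Rightarrow> real) \<in> borel_measurable borel"
  by (intro borel_measurable_continuous_onI continuous_intros)+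

lemma measurable_indicator_fst_snd:
  fixes A :: "real set"
  assumes "A \<in> sets borel"
  shows "(\<lambda>x::real \<times> real. indicator A (fst x) :: real) \<in> borel_measurable borel"
    and "(\<lambda>x::real \<times> real. indicator A (snd x) :: real) \<in> borel_measurable borel"
  using measurable_compose[OF measurable_fst_snd_real(1) borel_measurable_indicator[OF assms]]
    measurable_compose[OF measurable_fst_snd_real(2) borel_measurable_indicator[OF assms]] by simp_all

lemma nn_integral_lborel_pair:
  fixes F :: "real \<times> real \<Rightarrow> ennreal"
  assumes "F \<in> borel_measurable borel"
  shows "(\<integral>\<^sup>+x. F x \<partial>lborel) = (\<integral>\<^sup>+s. \<integral>\<^sup>+t. F (s, t) \<partial>lborel \<partial>lborel)"
    and "(\<integral>\<^sup>+x. F x \<partial>lborel) = (\<integral>\<^sup>+t. \<integral>\<^sup>+s. F (s, t) \<partial>lborel \<partial>lborel)"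
proof -
  have m: "F \<in> borel_measurable (lborel \<Otimes>\<^sub>M lborel)"
    using assms by (simp add: lborel_prod)
  show "(\<integral>\<^sup>+x. F x \<partial>lborel) = (\<integral>\<^sup>+s. \<integral>\<^sup>+t. F (s, t) \<partial>lborel \<partial>lborel)"
    using lborel.nn_integral_fst[OF m] by (simp add: lborel_prod)
  show "(\<integral>\<^sup>+x. F x \<partial>lborel) = (\<integral>\<^sup>+t. \<integral>\<^sup>+s. F (s, t) \<partial>lborel \<partial>lborel)"
    using lborel_pair.nn_integral_snd[OF m] by (simp add: lborel_prod)
qed

text \<open>
  The polar formula for the identity map covers the ball up to the slit on the positive real axis,
  which is a null set; the radial integral has an elementary primitive unless \<open>e = -1\<close>.
\<close>
lemma nn_integral_ball_radial_powr_le: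
  assumes e: "e \<noteq> -1" and R: "R > 0"
  shows "(\<integral>\<^sup>+y. indicator (ball (0::complex) R) y * ennreal ((1 + (cmod y)\<^sup>2) powr e) \<partial>lborel)
     \<le> ennreal (pi * ((1 + R\<^sup>2) powr (e + 1) - 1) / (e + 1))"
proof -
  define w :: "complex \<Rightarrow> ennreal" where "w y = ennreal ((1 + (cmod y)\<^sup>2) powr e)" for y
  define k where "k = e + 1"
  have m1: "(\<lambda>x::real \<times> real. ennreal (indicator {0<..<R} (fst x) * (fst x * (1 + (fst x)\<^sup>2) powr e)
                        * indicator {0<..<2*pi} (snd x))) \<in> borel_measurable borel"
  proof -
    have "(\<lambda>s. indicator {0<..<R} s * (s * (1 + s\<^sup>2) powr e)) \<in> borel_measurable borel" by measurable
    from measurable_compose[OF measurable_fst_snd_real(1) this]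
      measurable_indicator_fst_snd(2)[of "{0<..<2*pi}"]
    show ?thesis by (intro measurable_compose[OF _ measurable_ennreal] borel_measurable_times) auto
  qed
  have ek: "k - 1 = e" by (simp add: k_def)
  have k: "k \<noteq> 0" using e by (simp add: k_def)
  have id: "harmonic_map (\<lambda>z. z) (\<lambda>_. 0) = (\<lambda>z. z)" by (simp add: harmonic_map_def fun_eq_iff)
  have J: "jacobian (\<lambda>z. z) (\<lambda>_. 0) z = 1" for z by (simp add: jacobian_def)
  have [measurable]: "w \<in> borel_measurable borel" unfolding w_def by measurable
  have bdd: "bounded (annulus 0 0 R)"
    by (rule bounded_subset[of "ball 0 R"]) auto
  have 1: "(\<integral>\<^sup>+x. ennreal (indicator (polar_box 0 R) x * fst x) * w (polar 0 x) \<partial>lborel)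
       = (\<integral>\<^sup>+y. indicator (polar 0 ` polar_box 0 R) y * w y \<partial>lborel)"
    using nn_integral_polar_harmonic[of "\<lambda>z. z" 0 0 R "\<lambda>_. 0" w] bdd
    by (simp add: id J)
  have "AE y in lborel. Im y \<noteq> 0"
    using AE_lborel_inner_neq[of \<i> 0] by (simp add: Basis_complex_def)
  then have "AE y in lborel. indicator (ball 0 R) y * w y \<le> indicator (polar 0 ` polar_box 0 R) y * w y"
  proof eventually_elim
    case (elim y)
    have "y \<in> polar 0 ` polar_box 0 R" if y: "y \<in> ball 0 R"
    proof (rule image_eqI[of _ _ "(cmod y, Arg2pi y)"])
      show "y = polar 0 (cmod y, Arg2pi y)"
        using Arg2pi_eq[of y] by (simp add: cis_conv_exp)
      have "Arg2pi y \<noteq> 0" using elim Arg2pi_eq_0[of y] by (auto simp: complex_is_Real_iff)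
      then show "(cmod y, Arg2pi y) \<in> polar_box 0 R"
        using elim y Arg2pi_ge_0[of y] Arg2pi_lt_2pi[of y] by auto
    qed
    then show ?case by (auto simp: indicator_def)
  qed
  then have "(\<integral>\<^sup>+y. indicator (ball 0 R) y * w y \<partial>lborel)
     \<le> (\<integral>\<^sup>+y. indicator (polar 0 ` polar_box 0 R) y * w y \<partial>lborel)"
    by (rule nn_integral_mono_AE)
  also have "\<dots> = (\<integral>\<^sup>+x. ennreal (indicator (polar_box 0 R) x * fst x) * w (polar 0 x) \<partial>lborel)"
    by (rule 1[symmetric])
  also have "\<dots> = (\<integral>\<^sup>+x. ennreal (indicator {0<..<R} (fst x) * (fst x * (1 + (fst x)\<^sup>2) powr e)
                        * indicator {0<..<2*pi} (snd x)) \<partial>lborel)"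
    by (intro nn_integral_cong)
       (auto simp: w_def indicator_def norm_mult ennreal_mult' [symmetric])
  also have "\<dots> = (\<integral>\<^sup>+s. \<integral>\<^sup>+t. ennreal (indicator {0<..<R} s * (s * (1 + s\<^sup>2) powr e)
                        * indicator {0<..<2*pi} t) \<partial>lborel \<partial>lborel)"
    by (subst nn_integral_lborel_pair(1)) (simp_all add: m1)
  also have "\<dots> = (\<integral>\<^sup>+s. ennreal (2 * pi) * ennreal (indicator {0<..<R} s * (s * (1 + s\<^sup>2) powr e)) \<partial>lborel)"
  proof (rule nn_integral_cong)
    fix s :: real
    have "0 \<le> indicator {0<..<R} s * (s * (1 + s\<^sup>2) powr e)" by (auto simp: indicator_def)
    then have "(\<integral>\<^sup>+t. ennreal (indicator {0<..<R} s * (s * (1 + s\<^sup>2) powr e) * indicator {0<..<2*pi} t) \<partial>lborel)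
      = (\<integral>\<^sup>+t. ennreal (indicator {0<..<R} s * (s * (1 + s\<^sup>2) powr e)) * indicator {0<..<2*pi} t \<partial>lborel)"
      by (intro nn_integral_cong) (simp add: ennreal_mult' ennreal_indicator)
    also have "\<dots> = ennreal (indicator {0<..<R} s * (s * (1 + s\<^sup>2) powr e)) * ennreal (2 * pi)"
      by (subst nn_integral_cmult_indicator) auto
    finally show "(\<integral>\<^sup>+t. ennreal (indicator {0<..<R} s * (s * (1 + s\<^sup>2) powr e) * indicator {0<..<2*pi} t) \<partial>lborel)
      = ennreal (2 * pi) * ennreal (indicator {0<..<R} s * (s * (1 + s\<^sup>2) powr e))"
      by (simp add: mult.commute)
  qed
  also have "\<dots> = ennreal (2 * pi) * (\<integral>\<^sup>+s. ennreal (indicator {0<..<R} s * (s * (1 + s\<^sup>2) powr e)) \<partial>lborel)"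
    by (rule nn_integral_cmult) measurable
  also have "(\<integral>\<^sup>+s. ennreal (indicator {0<..<R} s * (s * (1 + s\<^sup>2) powr e)) \<partial>lborel)
      = ennreal ((1 + R\<^sup>2) powr k / (2 * k) - (1 + 0\<^sup>2) powr k / (2 * k))"
  proof (rule nn_integral_Ioo_derivative)
    fix t :: real
    have pos: "1 + t\<^sup>2 > 0" by (simp add: add_pos_nonneg)
    show "((\<lambda>t. (1 + t\<^sup>2) powr k / (2 * k)) has_real_derivative t * (1 + t\<^sup>2) powr e)
            (at t within {0..R})"
    proof -
      have "((\<lambda>t. (1 + t\<^sup>2) powr k) has_real_derivative k * (1 + t\<^sup>2) powr (k - 1) * (2 * t)) (at t within {0..R})"
        using pos by (auto intro!: derivative_eq_intros)
      from DERIV_cdivide[OF this, of "2 * k"] show ?thesis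
        using k ek by (simp add: mult.commute)
    qed
  qed (use R in auto)
  also have "ennreal (2 * pi) * \<dots> = ennreal (2 * pi * ((1 + R\<^sup>2) powr k / (2 * k) - (1 + 0\<^sup>2) powr k / (2 * k)))"
    by (simp add: ennreal_mult')
  also have "2 * pi * ((1 + R\<^sup>2) powr k / (2 * k) - (1 + 0\<^sup>2) powr k / (2 * k))
     = pi * ((1 + R\<^sup>2) powr k - 1) / k"
    using k by (simp add: field_simps)
  finally show ?thesis by (simp only: w_def k_def)
qed

text \<open>
  Because \<open>f\<close> is injective, the Jacobian integrated against a function of \<open>f\<close> is an integral
  over the image, no matter how \<open>f\<close> distributes its values.  All area estimates below are
  instances: \<open>e = -2\<close> for the spherical area, \<open>e = 0\<close> for the plain area, and the exponents
  \<open>e > -1\<close> that occur in the integral means.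
\<close>
lemma harmonic_weighted_area_le:
  assumes h: "h holomorphic_on annulus c r1 r2" and g: "g holomorphic_on annulus c r1 r2"
    and inj: "inj_on (harmonic_map h g) (annulus c r1 r2)" and r1: "0 \<le> r1"
    and R: "R > 0" and img: "harmonic_map h g ` annulus c r1 r2 \<subseteq> ball 0 R"
    and e: "e \<noteq> -1"
  shows "(\<integral>\<^sup>+x. ennreal (indicator (polar_box r1 r2) x * (fst x * \<bar>jacobian h g (polar c x)\<bar>
             * (1 + (cmod (harmonic_map h g (polar c x)))\<^sup>2) powr e)) \<partial>lborel)
       \<le> ennreal (pi * ((1 + R\<^sup>2) powr (e + 1) - 1) / (e + 1))"
proof -
  define w :: "complex \<Rightarrow> ennreal" where "w y = ennreal ((1 + (cmod y)\<^sup>2) powr e)" for y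
  have w: "w \<in> borel_measurable borel" unfolding w_def by measurable
  have bdd: "bounded (harmonic_map h g ` annulus c r1 r2)"
    using img bounded_ball bounded_subset by blast
  have "(\<integral>\<^sup>+x. ennreal (indicator (polar_box r1 r2) x * (fst x * \<bar>jacobian h g (polar c x)\<bar>
             * (1 + (cmod (harmonic_map h g (polar c x)))\<^sup>2) powr e)) \<partial>lborel)
     = (\<integral>\<^sup>+x. ennreal (indicator (polar_box r1 r2) x * (fst x * \<bar>jacobian h g (polar c x)\<bar>))
             * w (harmonic_map h g (polar c x)) \<partial>lborel)"
    using r1 by (intro nn_integral_cong) (auto simp: w_def indicator_def ennreal_mult'[symmetric])
  also have "\<dots> = (\<integral>\<^sup>+y. indicator (harmonic_map h g ` polar c ` polar_box r1 r2) y * w y \<partial>lborel)"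
    by (rule nn_integral_polar_harmonic[OF h g inj r1 bdd w])
  also have "\<dots> \<le> (\<integral>\<^sup>+y. indicator (ball 0 R) y * w y \<partial>lborel)"
  proof (rule nn_integral_mono)
    fix y
    let ?I = "harmonic_map h g ` polar c ` polar_box r1 r2"
    have sub: "?I \<subseteq> ball 0 R"
      using img polar_in_annulus[OF r1] by blast
    show "indicator ?I y * w y \<le> indicator (ball 0 R) y * w y"
    proof (cases "y \<in> ?I")
      case True
      then have "y \<in> ball 0 R" using sub by blast
      with True show ?thesis by (simp only: indicator_simps order_refl)
    next
      case False
      then show ?thesis by (simp only: indicator_simps mult_zero_left zero_le not_False_eq_True simp_thms)
    qed
  qed
  also have "\<dots> \<le> ennreal (pi * ((1 + R\<^sup>2) powr (e + 1) - 1) / (e + 1))"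
    unfolding w_def by (rule nn_integral_ball_radial_powr_le[OF e R])
  finally show ?thesis .
qed

section \<open>The length-area comparison\<close>

lemma max_stretch_nonneg: "0 \<le> max_stretch h g z"
  by (simp add: max_stretch_def)

lemma jacobian_pos_holomorphic_nonzero:
  "jacobian h g z > 0 \<Longrightarrow> deriv h z \<noteq> 0 \<and> cmod (deriv g z) < cmod (deriv h z)"
  by (auto simp: jacobian_def intro: power2_less_imp_less)

lemma continuous_on_harmonic_map:
  "h holomorphic_on U \<Longrightarrow> g holomorphic_on U \<Longrightarrow> continuous_on U (harmonic_map h g)"
  unfolding harmonic_map_def
  by (intro continuous_intros holomorphic_on_imp_continuous_on)

lemma has_vector_derivative_harmonic_circle:
  assumes U: "open U" and h: "h holomorphic_on U" and g: "g holomorphic_on U"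
    and x: "c + of_real s * cis t \<in> U"
  shows "((\<lambda>t. harmonic_map h g (c + of_real s * cis t)) has_vector_derivative
     \<i> * of_real s * (deriv h (c + of_real s * cis t) * cis t - cnj (deriv g (c + of_real s * cis t) * cis t)))
     (at t within S)"
proof -
  have "((\<lambda>t. (s, t)) has_derivative (\<lambda>v. (0, v))) (at t)"
    by (auto intro!: derivative_eq_intros)
  from has_derivative_compose[OF this has_derivative_harmonic_polar[OF U h g, of c "(s, t)"]] x
  have "((\<lambda>t. harmonic_map h g (c + of_real s * cis t)) has_vector_derivative
     \<i> * of_real s * (deriv h (c + of_real s * cis t) * cis t - cnj (deriv g (c + of_real s * cis t) * cis t)))
     (at t)"
    unfolding has_vector_derivative_def by (simp add: scaleR_conv_of_real)
  then show ?thesis by (rule has_vector_derivative_at_within)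
qed

lemma has_vector_derivative_harmonic_radius:
  assumes U: "open U" and h: "h holomorphic_on U" and g: "g holomorphic_on U"
    and x: "c + of_real s * cis t \<in> U"
  shows "((\<lambda>s. harmonic_map h g (c + of_real s * cis t)) has_vector_derivative
     (deriv h (c + of_real s * cis t) * cis t + cnj (deriv g (c + of_real s * cis t) * cis t)))
     (at s within S)"
proof -
  have "((\<lambda>s. (s, t)) has_derivative (\<lambda>v. (v, 0))) (at s)"
    by (auto intro!: derivative_eq_intros)
  from has_derivative_compose[OF this has_derivative_harmonic_polar[OF U h g, of c "(s, t)"]] x
  have "((\<lambda>s. harmonic_map h g (c + of_real s * cis t)) has_vector_derivative
     (deriv h (c + of_real s * cis t) * cis t + cnj (deriv g (c + of_real s * cis t) * cis t)))
     (at s)"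
    unfolding has_vector_derivative_def by (simp add: scaleR_conv_of_real)
  then show ?thesis by (rule has_vector_derivative_at_within)
qed

lemma cmod_square_has_derivative:
  assumes "(F has_vector_derivative F') (at t within S)"
  shows "((\<lambda>t. (cmod (F t))\<^sup>2) has_real_derivative 2 * (F t \<bullet> F')) (at t within S)"
  using has_derivative_inner[OF assms[unfolded has_vector_derivative_def] assms[unfolded has_vector_derivative_def]]
  unfolding power2_norm_eq_inner has_field_derivative_def
  by (rule has_derivative_eq_rhs) (auto simp: fun_eq_iff inner_commute)

lemma measurable_polar_box:
  assumes "continuous_on (polar_box r1 r2) F"
  shows "(\<lambda>x. ennreal (indicator (polar_box r1 r2) x * F x)) \<in> borel_measurable borel"
proof -
  have "open (polar_box r1 r2)" by (intro open_Times) auto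
  then have "(\<lambda>x. indicator (polar_box r1 r2) x *\<^sub>R F x) \<in> borel_measurable borel"
    using assms by (intro borel_measurable_continuous_on_indicator) auto
  then show ?thesis by simp
qed

lemma continuous_on_polar_compose:
  assumes "continuous_on U F" "\<And>x. x \<in> S \<Longrightarrow> polar c x \<in> U"
  shows "continuous_on S (\<lambda>x. F (polar c x))"
  using assms by (intro continuous_on_compose2[OF assms(1)] continuous_intros) auto

lemma sphere_cis:
  assumes "cmod (x - c) = t" obtains \<theta> where "\<theta> \<in> {0..2*pi}" "x = c + of_real t * cis \<theta>"
proof
  show "Arg2pi (x - c) \<in> {0..2*pi}" using Arg2pi_ge_0 Arg2pi_lt_2pi by (auto simp: less_imp_le)
  show "x = c + of_real t * cis (Arg2pi (x - c))"
    using Arg2pi_eq[of "x - c"] assms by (simp add: cis_conv_exp)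
qed

text \<open>
  A substitute for the maximum principle: an injective continuous map of the plane is open, so
  \<open>|f - a|\<close> cannot attain its maximum over a closed disc in the interior.
\<close>
lemma injective_map_large_on_circle:
  fixes f :: "complex \<Rightarrow> complex"
  assumes cont: "continuous_on U f" and inj: "inj_on f U" and sub: "cball c t \<subseteq> U"
    and z: "z \<in> cball c t"
  obtains \<theta> where "\<theta> \<in> {0..2*pi}" "cmod (f z - a) \<le> cmod (f (c + of_real t * cis \<theta>) - a)"
proof -
  have "continuous_on (cball c t) (\<lambda>z. cmod (f z - a))"
    by (intro continuous_on_norm continuous_on_diff continuous_on_const continuous_on_subset[OF cont sub])
  moreover have "cball c t \<noteq> {}" using z by blast
  ultimately obtain x where x: "x \<in> cball c t" "\<And>y. y \<in> cball c t \<Longrightarrow> cmod (f y - a) \<le> cmod (f x - a)"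
    using continuous_attains_sup[OF compact_cball] by blast
  have "x \<notin> ball c t"
  proof
    assume xb: "x \<in> ball c t"
    have "ball c t \<subseteq> U" using sub by auto
    then have "open (f ` ball c t)"
      using cont inj by (intro invariance_of_domain) (blast intro: continuous_on_subset inj_on_subset)+
    then obtain e where e: "e > 0" "cball (f x) e \<subseteq> f ` ball c t"
      using xb by (meson imageI open_contains_cball)
    define u where "u = (if f x = a then 1 else sgn (f x - a))"
    have u: "cmod u = 1" by (simp add: u_def norm_sgn)
    have "f x + of_real e * u \<in> cball (f x) e" using e u by (simp add: dist_norm norm_mult)
    then obtain y where y: "y \<in> ball c t" "f y = f x + of_real e * u" using e by auto
    have "f x - a = of_real (cmod (f x - a)) * u"
      by (simp add: u_def sgn_div_norm scaleR_conv_of_real)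
    then have "f y - a = of_real (cmod (f x - a) + e) * u" using y by (simp add: algebra_simps)
    then have "cmod (f y - a) = cmod (f x - a) + e" using u e by (simp add: norm_mult del: of_real_add)
    then show False using x(2)[of y] y e by auto
  qed
  then have "cmod (x - c) = t" using x by (simp add: dist_norm norm_minus_commute)
  then obtain \<theta> where "\<theta> \<in> {0..2*pi}" "x = c + of_real t * cis \<theta>" by (rule sphere_cis)
  with x(2)[OF z] that show thesis by auto
qed

text \<open>
  If \<open>|f - f c|\<close> exceeded \<open>|f p - f c|\<close> on the whole circle, the image of the open disc would be
  both open and closed relative to the disc of radius \<open>|f p - f c|\<close> about \<open>f c\<close>, hence would contain
  it and the value \<open>f p\<close>, which is taken outside the circle already.
\<close>
lemma injective_map_small_on_circle:
  fixes f :: "complex \<Rightarrow> complex"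
  assumes cont: "continuous_on U f" and inj: "inj_on f U" and sub: "cball c t \<subseteq> U"
    and t: "t > 0" and p: "p \<in> U" "p \<notin> cball c t"
  obtains \<theta> where "\<theta> \<in> {0..2*pi}" "cmod (f (c + of_real t * cis \<theta>) - f c) \<le> cmod (f p - f c)"
proof (rule ccontr)
  assume "\<not> thesis"
  then have out: "\<not> cmod (f (c + of_real t * cis \<theta>) - f c) \<le> cmod (f p - f c)"
    if "\<theta> \<in> {0..2*pi}" for \<theta> using that \<open>\<And>\<theta>. \<theta> \<in> {0..2*pi} \<Longrightarrow> _ \<Longrightarrow> thesis\<close> by blast
  let ?S = "cball (f c) (cmod (f p - f c))"
  let ?V = "f ` ball c t" and ?W = "f ` cball c t"
  have bU: "ball c t \<subseteq> U" using sub by auto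
  have "open ?V"
    using cont inj bU by (intro invariance_of_domain) (blast intro: continuous_on_subset inj_on_subset)+
  moreover have "compact ?W"
    using cont sub by (intro compact_continuous_image) (auto intro: continuous_on_subset)
  then have "open (- ?W)" by (simp add: compact_imp_closed open_Compl)
  moreover have "?S \<inter> ?W \<subseteq> ?V"
  proof
    fix w assume w: "w \<in> ?S \<inter> ?W"
    then obtain x where x: "x \<in> cball c t" "w = f x" by auto
    have "x \<in> ball c t"
    proof (rule ccontr)
      assume "x \<notin> ball c t"
      then have "cmod (x - c) = t" using x by (simp add: dist_norm norm_minus_commute)
      then obtain \<theta> where "\<theta> \<in> {0..2*pi}" "x = c + of_real t * cis \<theta>" by (rule sphere_cis)
      with out[of \<theta>] w x show False by (auto simp: dist_norm norm_minus_commute)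
    qed
    then show "w \<in> ?V" using x by auto
  qed
  then have "?S \<subseteq> ?V \<union> - ?W" by auto
  moreover have "?V \<inter> - ?W \<inter> ?S = {}" by auto
  moreover have "connected ?S" by simp
  ultimately have "?V \<inter> ?S = {} \<or> - ?W \<inter> ?S = {}" by (intro connectedD)
  moreover have "f c \<in> ?V \<inter> ?S" using t by auto
  ultimately have "?S \<subseteq> ?W" by auto
  moreover have "f p \<in> ?S" by (simp add: dist_norm norm_minus_commute)
  ultimately obtain q where "q \<in> cball c t" "f q = f p" by auto
  then show False using inj p sub by (metis inj_onD subsetD)
qed

text \<open>
  Every circle between the radii \<open>r\<close> and \<open>R\<close> carries a point with \<open>|f| \<ge> 1\<close> and a point with
  \<open>|f| \<le> 1/2\<close>, so the image of each circle has at least a fixed length in the spherical metric.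
  By quasiconformality the squared lengths, integrated against \<open>ds / s\<close>, are bounded by the spherical
  area of the image, which is at most that of the sphere.  Hence \<open>ln (R / r)\<close> is bounded; the number
  \<open>700\<close> is what the constants of the proof give.
\<close>
lemma length_area_normalized:
  assumes U: "open U" and h: "h holomorphic_on U" and g: "g holomorphic_on U"
    and inj: "inj_on (harmonic_map h g) U"
    and r: "0 < r" "r < R" and sub: "cball c R \<subseteq> U"
    and qc: "\<And>z. z \<in> annulus c r R \<Longrightarrow> (max_stretch h g z)\<^sup>2 \<le> 3 * jacobian h g z"
    and c0: "harmonic_map h g c = 0"
    and z1: "z1 \<in> cball c r" "1 \<le> cmod (harmonic_map h g z1)"
    and p: "p \<in> U" "R \<le> cmod (p - c)" "cmod (harmonic_map h g p) \<le> 1 / 2"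
  shows "ln (R / r) < 700"
proof -
  define f where "f = harmonic_map h g"
  define W where "W z = jacobian h g z * (1 + (cmod (f z))\<^sup>2) powr (-2)" for z
  have contf: "continuous_on U f" unfolding f_def by (rule continuous_on_harmonic_map[OF h g])
  have conth: "continuous_on U (deriv h)" "continuous_on U (deriv g)"
    using holomorphic_deriv[OF h U] holomorphic_deriv[OF g U] by (auto intro: holomorphic_on_imp_continuous_on)
  have pos: "1 + (cmod (f z))\<^sup>2 > 0" for z by (simp add: add_pos_nonneg)
  have contW: "continuous_on U W"
    unfolding W_def jacobian_def using pos
    by (intro continuous_intros conth contf) (auto simp: less_imp_neq[symmetric])
  have annU: "annulus c r R \<subseteq> U" using sub by (auto simp: dist_norm norm_minus_commute)
  have Wnn: "0 \<le> W z" if "z \<in> annulus c r R" for z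
    using order_trans[OF zero_le_power2 qc[OF that]] by (simp add: W_def)
  have inner: "ennreal (7 / 1500 / s) \<le> (\<integral>\<^sup>+t. ennreal (indicator {0<..<2*pi} t * (s * W (c + of_real s * cis t))) \<partial>lborel)"
    if s: "s \<in> {r<..<R}" for s
  proof -
    have s0: "s > 0" using s r by simp
    have ann: "c + of_real s * cis t \<in> annulus c r R" for t
      using s s0 by (simp add: norm_mult)
    then have inU: "c + of_real s * cis t \<in> U" for t using annU by blast
    have cb: "cball c s \<subseteq> U" using sub s by auto
    have zc: "z1 \<in> cball c s" using z1 s by auto
    have pc: "p \<notin> cball c s" using p s by (auto simp: dist_norm norm_minus_commute)
    obtain t1 where t1: "t1 \<in> {0..2*pi}" "1 \<le> cmod (f (c + of_real s * cis t1))"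
      using injective_map_large_on_circle[OF contf inj[folded f_def] cb zc, of 0] z1(2)
      unfolding f_def by (metis diff_zero order_trans)
    obtain t0 where t0: "t0 \<in> {0..2*pi}" "cmod (f (c + of_real s * cis t0)) \<le> 1 / 2"
      using injective_map_small_on_circle[OF contf inj[folded f_def] cb s0 p(1) pc] p(3) c0
      unfolding f_def by (metis diff_zero order_trans)
    define F where "F t = f (c + of_real s * cis t)" for t
    define F' where "F' t = \<i> * of_real s * (deriv h (c + of_real s * cis t) * cis t
        - cnj (deriv g (c + of_real s * cis t) * cis t))" for t
    \<comment> \<open>the function 1 - 1/(1 + |F|^2) increases by at least 3/10 between the two points, and its derivative is controlled by the spherical length; the factor 1/(30 s) makes the bound B equal to s * W plus a term that is constant on the circle\<close>
    define v where "v t = (1 - 1 / (1 + (cmod (F t))\<^sup>2)) / (30 * s)" for t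
    define v' where "v' t = 2 * (F t \<bullet> F' t) / (1 + (cmod (F t))\<^sup>2)\<^sup>2 / (30 * s)" for t
    define B where "B t = 1 / (1200 * s) + s * W (c + of_real s * cis t)" for t
    have FF: "(F has_vector_derivative F' t) (at t within S)" for t S
      unfolding F_def F'_def f_def by (rule has_vector_derivative_harmonic_circle[OF U h g inU])
    have Fpos: "1 + (cmod (F t))\<^sup>2 > 0" for t unfolding F_def by (rule pos)
    have vv: "(v has_vector_derivative v' t) (at t within S)" for t S
    proof -
      define N where "N t = 1 + (cmod (F t))\<^sup>2" for t
      have NN: "(N has_real_derivative 2 * (F t \<bullet> F' t)) (at t within S)"
        unfolding N_def using DERIV_add[OF DERIV_const cmod_square_has_derivative[OF FF]] by simp
      have N: "N t > 0" using Fpos unfolding N_def .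
      have "((\<lambda>t. (1 - 1 / N t) / (30 * s)) has_real_derivative 2 * (F t \<bullet> F' t) / (N t)\<^sup>2 / (30 * s)) (at t within S)"
        using N s0 by (auto intro!: derivative_eq_intros NN simp: power2_eq_square)
      then have "(v has_real_derivative v' t) (at t within S)"
        unfolding v_def[abs_def] v'_def N_def .
      then show ?thesis by (simp add: has_real_derivative_iff_has_vector_derivative)
    qed
    have bnd: "\<bar>v' t\<bar> \<le> B t" for t
    proof -
      define Q where "Q = 1 + (cmod (F t))\<^sup>2"
      define L where "L = max_stretch h g (c + of_real s * cis t)"
      have Q: "Q > 0" using Fpos unfolding Q_def .
      have F'L: "cmod (F' t) \<le> s * L"
      proof -
        have "cmod (F' t) \<le> s * (cmod (deriv h (c + of_real s * cis t) * cis t)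
            + cmod (cnj (deriv g (c + of_real s * cis t) * cis t)))"
          unfolding F'_def norm_mult[of "\<i> * of_real s"]
          using s0 by (intro mult_mono norm_triangle_ineq4) (auto simp: norm_mult)
        then show ?thesis by (simp add: L_def max_stretch_def norm_mult)
      qed
      have "\<bar>F t \<bullet> F' t\<bar> \<le> cmod (F t) * cmod (F' t)" by (rule Cauchy_Schwarz_ineq2)
      also have "\<dots> \<le> cmod (F t) * (s * L)" by (intro mult_left_mono F'L) auto
      finally have "2 * \<bar>F t \<bullet> F' t\<bar> \<le> 2 * cmod (F t) * (s * L)" by simp
      also have "\<dots> \<le> Q * (s * L)"
        unfolding Q_def using s0 sum_squares_bound[of "cmod (F t)" 1] max_stretch_nonneg
        by (intro mult_right_mono) (auto simp: L_def)
      finally have 1: "2 * \<bar>F t \<bullet> F' t\<bar> \<le> Q * (s * L)" .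
      have "\<bar>v' t\<bar> = 2 * \<bar>F t \<bullet> F' t\<bar> / Q\<^sup>2 / (30 * s)"
        using Q s0 by (simp add: v'_def Q_def[symmetric] abs_mult)
      also have "\<dots> \<le> Q * (s * L) / Q\<^sup>2 / (30 * s)"
        using 1 Q s0 by (intro divide_right_mono) auto
      also have "\<dots> = (s * L / Q) / (30 * s)" using Q by (simp add: power2_eq_square)
      also have "\<dots> \<le> (1 / 40 + 10 * (s * L / Q)\<^sup>2) / (30 * s)"
      proof (intro divide_right_mono)
        \<comment> \<open>the constant 1/40 is small enough for its integral over the circle to stay below the increment of v\<close>
        have "0 \<le> 10 * (s * L / Q - 1 / 20)\<^sup>2" by simp
        then show "s * L / Q \<le> 1 / 40 + 10 * (s * L / Q)\<^sup>2"
          by (simp add: power2_eq_square algebra_simps)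
      qed (use s0 in simp)
      also have "\<dots> = 1 / (1200 * s) + s * (L\<^sup>2 / 3) / Q\<^sup>2"
        using s0 Q by (simp add: field_simps power2_eq_square)
      also have "\<dots> \<le> 1 / (1200 * s) + s * jacobian h g (c + of_real s * cis t) / Q\<^sup>2"
        using qc[OF ann[of t]] s0 Q
        by (intro add_left_mono divide_right_mono mult_left_mono) (auto simp: L_def mult.commute)
      also have "\<dots> = B t"
      proof -
        have "Q powr (-2) = 1 / Q\<^sup>2" using Q by (simp add: powr_minus_divide)
        then have "W (c + of_real s * cis t) = jacobian h g (c + of_real s * cis t) / Q\<^sup>2"
          unfolding W_def Q_def F_def by simp
        then show ?thesis by (simp add: B_def)
      qed
      finally show ?thesis .
    qed
    have cW: "continuous_on S (\<lambda>t. W (c + of_real s * cis t))" for S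
    proof (rule continuous_on_compose2[OF contW])
      show "continuous_on S (\<lambda>t. c + of_real s * cis t)" by (intro continuous_intros)
    qed (use inU in auto)
    have cB: "continuous_on S B" for S
      unfolding B_def by (intro continuous_on_add continuous_on_mult continuous_on_const cW)
    have B0: "0 \<le> B t" for t using bnd[of t] by linarith
    define a b where "a = min t0 t1" and "b = max t0 t1"
    have ab: "a \<le> b" "0 \<le> a" "b \<le> 2 * pi" using t0 t1 by (auto simp: a_def b_def)
    have vt1: "v t1 \<ge> (1 / 2) / (30 * s)"
    proof -
      have "1\<^sup>2 \<le> (cmod (F t1))\<^sup>2" using t1 unfolding F_def by (intro power_mono) auto
      then have "1 / (1 + (cmod (F t1))\<^sup>2) \<le> 1 / 2" by (intro divide_left_mono) auto
      then show ?thesis unfolding v_def using s0 by (intro divide_right_mono) auto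
    qed
    have vt0: "v t0 \<le> (1 / 5) / (30 * s)"
    proof -
      have "(cmod (F t0))\<^sup>2 \<le> (1 / 2)\<^sup>2" using t0 unfolding F_def by (intro power_mono) auto
      then have "1 + (cmod (F t0))\<^sup>2 \<le> 5 / 4" by (simp add: power2_eq_square)
      then have "1 / (5 / 4) \<le> 1 / (1 + (cmod (F t0))\<^sup>2)" using Fpos[of t0] by (intro divide_left_mono) auto
      then show ?thesis unfolding v_def using s0 by (intro divide_right_mono) auto
    qed
    have "(3 / 10) / (30 * s) \<le> v t1 - v t0"
      using vt1 vt0 s0 by (simp add: field_simps)
    then have "(1 / 100) / s \<le> \<bar>v b - v a\<bar>"
      by (auto simp: a_def b_def min_def max_def)
    then have "ennreal ((1 / 100) / s) \<le> ennreal \<bar>v b - v a\<bar>" by (rule ennreal_leI)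
    also have "\<dots> \<le> (\<integral>\<^sup>+t. ennreal (indicator {a<..<b} t * B t) \<partial>lborel)"
      by (rule increment_le_nn_integral[OF ab(1) vv bnd cB])
    also have "\<dots> \<le> (\<integral>\<^sup>+t. ennreal (indicator {0<..<2*pi} t * B t) \<partial>lborel)"
      using ab B0 by (intro nn_integral_mono ennreal_leI mult_right_mono) (auto simp: indicator_def)
    also have "\<dots> = (\<integral>\<^sup>+t. ennreal (1 / (1200 * s)) * indicator {0<..<2*pi} t
          + ennreal (indicator {0<..<2*pi} t * (s * W (c + of_real s * cis t))) \<partial>lborel)"
      using s0 Wnn[OF ann] by (intro nn_integral_cong) (auto simp: B_def indicator_def ennreal_plus)
    also have "\<dots> = (\<integral>\<^sup>+t. ennreal (1 / (1200 * s)) * indicator {0<..<2*pi} t \<partial>lborel)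
          + (\<integral>\<^sup>+t. ennreal (indicator {0<..<2*pi} t * (s * W (c + of_real s * cis t))) \<partial>lborel)"
    proof (rule nn_integral_add)
      have "(\<lambda>t. indicator {0<..<2*pi} t *\<^sub>R (s * W (c + of_real s * cis t))) \<in> borel_measurable borel"
        by (intro borel_measurable_continuous_on_indicator continuous_on_mult continuous_on_const cW) simp
      then show "(\<lambda>t. ennreal (indicator {0<..<2*pi} t * (s * W (c + of_real s * cis t)))) \<in> borel_measurable lborel"
        by simp
    qed auto
    also have "(\<integral>\<^sup>+t. ennreal (1 / (1200 * s)) * indicator {0<..<2*pi} t \<partial>lborel) = ennreal (2 * pi / (1200 * s))"
      using s0 by (subst nn_integral_cmult_indicator) (auto simp: ennreal_mult'[symmetric])
    also have "\<dots> \<le> ennreal ((16 / 3000) / s)"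
      using s0 pi_less_4 pi_approx by (intro ennreal_leI) (auto simp: field_simps)
    finally have le: "ennreal ((1 / 100) / s) \<le> ennreal ((16 / 3000) / s)
        + (\<integral>\<^sup>+t. ennreal (indicator {0<..<2*pi} t * (s * W (c + of_real s * cis t))) \<partial>lborel)" (is "_ \<le> _ + ?X")
      by (simp add: add_right_mono)
    have "ennreal ((1 / 100) / s) = ennreal ((16 / 3000) / s) + ennreal (7 / 1500 / s)"
      using s0 by (subst ennreal_plus[symmetric]) (auto simp: field_simps)
    then show ?thesis using le by (simp add: ennreal_add_left_cancel_le)
  qed
  have "compact (f ` cball c R)"
    using contf sub by (intro compact_continuous_image) (auto intro: continuous_on_subset)
  then obtain R' where R': "R' > 0" "f ` cball c R \<subseteq> ball 0 R'"
    using compact_imp_bounded bounded_subset_ballD by meson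
  have "f ` annulus c r R \<subseteq> ball 0 R'"
    using R'(2) by (force simp: dist_norm norm_minus_commute)
  then have "(\<integral>\<^sup>+x. ennreal (indicator (polar_box r R) x * (fst x * \<bar>jacobian h g (polar c x)\<bar>
             * (1 + (cmod (harmonic_map h g (polar c x)))\<^sup>2) powr (-2))) \<partial>lborel)
       \<le> ennreal (pi * ((1 + R'\<^sup>2) powr (-2 + 1) - 1) / (-2 + 1))"
    using h g inj annU r R'
    by (intro harmonic_weighted_area_le) (auto intro: holomorphic_on_subset inj_on_subset simp: f_def)
  also have "\<dots> \<le> ennreal pi"
  proof (rule ennreal_leI)
    have "0 < (1 + R'\<^sup>2) powr (-1)" by (simp add: add_pos_nonneg)
    then show "pi * ((1 + R'\<^sup>2) powr (-2 + 1) - 1) / (-2 + 1) \<le> pi"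
      by (simp add: algebra_simps)
  qed
  also have "(\<integral>\<^sup>+x. ennreal (indicator (polar_box r R) x * (fst x * \<bar>jacobian h g (polar c x)\<bar>
             * (1 + (cmod (harmonic_map h g (polar c x)))\<^sup>2) powr (-2))) \<partial>lborel)
      = (\<integral>\<^sup>+x. ennreal (indicator (polar_box r R) x * (fst x * W (polar c x))) \<partial>lborel)"
  proof (rule nn_integral_cong)
    fix x :: "real \<times> real"
    have "jacobian h g (polar c x) \<ge> 0" if "x \<in> polar_box r R"
    proof -
      have "polar c x \<in> annulus c r R" using that r by (intro polar_in_annulus) auto
      from order_trans[OF zero_le_power2 qc[OF this]] show ?thesis by simp
    qed
    then show "ennreal (indicator (polar_box r R) x * (fst x * \<bar>jacobian h g (polar c x)\<bar>
             * (1 + (cmod (harmonic_map h g (polar c x)))\<^sup>2) powr (-2)))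
        = ennreal (indicator (polar_box r R) x * (fst x * W (polar c x)))"
      by (cases "x \<in> polar_box r R") (simp_all add: W_def f_def mult.assoc)
  qed
  also have "\<dots> = (\<integral>\<^sup>+s. \<integral>\<^sup>+t. ennreal (indicator (polar_box r R) (s, t) * (s * W (c + of_real s * cis t))) \<partial>lborel \<partial>lborel)"
  proof (subst nn_integral_lborel_pair(1))
    have pin: "polar c x \<in> U" if "x \<in> polar_box r R" for x
      using polar_in_annulus[of r x R c] that r annU by auto
    show "(\<lambda>x. ennreal (indicator (polar_box r R) x * (fst x * W (polar c x)))) \<in> borel_measurable borel"
      by (intro measurable_polar_box continuous_intros continuous_on_polar_compose[OF contW] pin)
  qed simp
  finally have area: "(\<integral>\<^sup>+s. \<integral>\<^sup>+t. ennreal (indicator (polar_box r R) (s, t) * (s * W (c + of_real s * cis t))) \<partial>lborel \<partial>lborel) \<le> ennreal pi" .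
  have "ennreal (7 / 1500 * ln R - 7 / 1500 * ln r) = (\<integral>\<^sup>+s. ennreal (indicator {r<..<R} s * (7 / 1500 / s)) \<partial>lborel)"
    using r by (intro nn_integral_Ioo_derivative[symmetric]) (auto intro!: derivative_eq_intros)
  also have "\<dots> \<le> (\<integral>\<^sup>+s. \<integral>\<^sup>+t. ennreal (indicator (polar_box r R) (s, t) * (s * W (c + of_real s * cis t))) \<partial>lborel \<partial>lborel)"
  proof (rule nn_integral_mono)
    fix s :: real
    show "ennreal (indicator {r<..<R} s * (7 / 1500 / s))
       \<le> (\<integral>\<^sup>+t. ennreal (indicator (polar_box r R) (s, t) * (s * W (c + of_real s * cis t))) \<partial>lborel)"
    proof (cases "s \<in> {r<..<R}")
      case True
      then have "indicator (polar_box r R) (s, t) = (indicator {0<..<2*pi} t :: real)" for t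
        by (auto simp: indicator_def)
      then show ?thesis using inner[OF True] True by simp
    qed simp
  qed
  also note area
  finally have "7 / 1500 * ln R - 7 / 1500 * ln r \<le> pi" by (simp add: ennreal_le_iff)
  then have "7 / 1500 * ln (R / r) \<le> pi" using r by (simp add: ln_div algebra_simps)
  then show ?thesis using pi_approx by simp
qed

text \<open>
  A crude form of quasisymmetry at the centre \<open>c\<close>: a point much nearer to \<open>c\<close> than \<open>p\<close> cannot be
  moved much farther from \<open>f c\<close> than \<open>f p\<close> is.  It follows by scaling from the normalized case.
\<close>
lemma length_area_three_points:
  assumes U: "open U" and h: "h holomorphic_on U" and g: "g holomorphic_on U"
    and inj: "inj_on (harmonic_map h g) U"
    and r: "0 < r" "r < R" "ln (R / r) \<ge> 700" and sub: "cball c R \<subseteq> U"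
    and qc: "\<And>z. z \<in> annulus c r R \<Longrightarrow> (max_stretch h g z)\<^sup>2 \<le> 3 * jacobian h g z"
    and z1: "z1 \<in> cball c r"
    and p: "p \<in> U" "R \<le> cmod (p - c)"
  shows "cmod (harmonic_map h g z1 - harmonic_map h g c) \<le> 2 * cmod (harmonic_map h g p - harmonic_map h g c)"
proof (rule ccontr)
  assume neg: "\<not> ?thesis"
  define f where "f = harmonic_map h g"
  define M where "M = cmod (f z1 - f c)"
  have M: "M > 2 * cmod (f p - f c)" using neg by (simp add: M_def f_def)
  then have M0: "M > 0" using norm_ge_zero[of "f p - f c"] by linarith
  define h1 where "h1 z = (h z - h c) / of_real M" for z
  define g1 where "g1 z = (g z - g c) / of_real M" for z
  have f1: "harmonic_map h1 g1 z = (f z - f c) / of_real M" for z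
    by (simp add: harmonic_map_def h1_def g1_def f_def add_divide_distrib diff_divide_distrib)
  have hol: "h1 holomorphic_on U" "g1 holomorphic_on U"
    unfolding h1_def[abs_def] g1_def[abs_def] using M0 by (auto intro!: holomorphic_intros h g)
  have d1: "deriv h1 z = deriv h z / of_real M" if "z \<in> U" for z
    unfolding h1_def[abs_def] using M0 holomorphic_derivI[OF h U that]
    by (intro DERIV_imp_deriv) (auto intro!: derivative_eq_intros)
  have d2: "deriv g1 z = deriv g z / of_real M" if "z \<in> U" for z
    unfolding g1_def[abs_def] using M0 holomorphic_derivI[OF g U that]
    by (intro DERIV_imp_deriv) (auto intro!: derivative_eq_intros)
  have "ln (R / r) < 700"
  proof (rule length_area_normalized[OF U hol _ r(1,2) sub])
    show "inj_on (harmonic_map h1 g1) U"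
      using inj M0 by (auto simp: inj_on_def f1 f_def)
    show "(max_stretch h1 g1 z)\<^sup>2 \<le> 3 * jacobian h1 g1 z" if "z \<in> annulus c r R" for z
    proof -
      have zU: "z \<in> U" using that sub by (auto simp: dist_norm norm_minus_commute)
      have eqs: "max_stretch h1 g1 z = max_stretch h g z / M" "jacobian h1 g1 z = jacobian h g z / M\<^sup>2"
        using M0 by (simp_all add: max_stretch_def jacobian_def d1 d2 zU norm_divide field_simps)
      show ?thesis
        unfolding eqs using divide_right_mono[OF qc[OF that], of "M\<^sup>2"] by (simp add: power_divide)
    qed
    show "harmonic_map h1 g1 c = 0" by (simp add: f1)
    show "z1 \<in> cball c r" "p \<in> U" "R \<le> cmod (p - c)" by fact+
    show "1 \<le> cmod (harmonic_map h1 g1 z1)" using M0 by (simp add: f1 norm_divide M_def)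
    show "cmod (harmonic_map h1 g1 p) \<le> 1 / 2" using M M0 by (simp add: f1 norm_divide field_simps)
  qed
  then show False using r by simp
qed

section \<open>Fourier coefficients on circles and Harnack's inequality\<close>

lemma circle_fourier_holomorphic:
  fixes h :: "complex \<Rightarrow> complex" and r :: real
  assumes h: "h holomorphic_on ball c R" and r: "0 < r" "r < R"
  shows "((\<lambda>t. h (c + of_real r * cis t) * cis (- (real n * t))) has_integral
      2 * pi * r ^ n * ((deriv ^^ n) h c / fact n)) {0..2*pi}"
proof -
  have sub: "cball c r \<subseteq> ball c R" using r by auto
  have "((\<lambda>u. h u / (u - c) ^ (Suc n)) has_contour_integral ((2 * pi * \<i>) / (fact n) * (deriv ^^ n) h c))
           (circlepath c r)"
    using r sub holomorphic_on_imp_continuous_on[OF h] h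
    by (intro Cauchy_has_contour_integral_higher_derivative_circlepath)
       (auto intro: continuous_on_subset holomorphic_on_subset)
  then have "((\<lambda>t. h (c + r * cis t) / (c + r * cis t - c) ^ (Suc n) * r * \<i> * cis t)
      has_integral ((2 * pi * \<i>) / (fact n) * (deriv ^^ n) h c)) {0..2*pi}"
    unfolding circlepath_def by (subst (asm) has_contour_integral_part_circlepath_iff) simp_all
  then have "((\<lambda>t. (r ^ n / \<i>) * (h (c + r * cis t) / (c + r * cis t - c) ^ (Suc n) * r * \<i> * cis t))
      has_integral (r ^ n / \<i>) * ((2 * pi * \<i>) / (fact n) * (deriv ^^ n) h c)) {0..2*pi}"
    by (rule has_integral_mult_right)
  moreover have "(r ^ n / \<i>) * (h (c + r * cis t) / (c + r * cis t - c) ^ (Suc n) * r * \<i> * cis t)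
      = h (c + of_real r * cis t) * cis (- (real n * t))" for t
  proof -
    have "cis (- (real n * t)) = inverse (cis t ^ n)" by (simp add: Complex.DeMoivre flip: cis_inverse)
    then show ?thesis using r by (simp add: field_simps power_mult_distrib)
  qed
  ultimately show ?thesis by (simp add: mult_ac)
qed

lemma circle_fourier_holomorphic_negative:
  fixes g :: "complex \<Rightarrow> complex" and r :: real
  assumes g: "g holomorphic_on ball c R" and r: "0 < r" "r < R" and n: "n \<ge> 1"
  shows "((\<lambda>t. g (c + of_real r * cis t) * cis (real n * t)) has_integral 0) {0..2*pi}"
proof -
  have sub: "cball c r \<subseteq> ball c R" using r by auto
  have "((\<lambda>u. g u * (u - c) ^ (n - 1)) has_contour_integral 0) (circlepath c r)"
    using sub r by (intro Cauchy_theorem_convex_simple[of _ "ball c R"] holomorphic_intros g) auto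
  then have "((\<lambda>t. g (c + r * cis t) * (c + r * cis t - c) ^ (n - 1) * r * \<i> * cis t)
      has_integral 0) {0..2*pi}"
    unfolding circlepath_def by (subst (asm) has_contour_integral_part_circlepath_iff) simp_all
  then have "((\<lambda>t. (1 / (\<i> * r ^ n)) * (g (c + r * cis t) * (c + r * cis t - c) ^ (n - 1) * r * \<i> * cis t))
      has_integral (1 / (\<i> * r ^ n)) * 0) {0..2*pi}"
    by (rule has_integral_mult_right)
  moreover have "(1 / (\<i> * r ^ n)) * (g (c + r * cis t) * (c + r * cis t - c) ^ (n - 1) * r * \<i> * cis t)
      = g (c + of_real r * cis t) * cis (real n * t)" for t
  proof -
    obtain m where m: "n = Suc m" using n by (cases n) auto
    have "cis (real n * t) = cis t ^ n" by (simp add: Complex.DeMoivre)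
    then show ?thesis using r by (simp add: m field_simps power_mult_distrib)
  qed
  ultimately show ?thesis by simp
qed

text \<open>
  On a circle about \<open>c\<close> the conjugate of \<open>g\<close> contains only the constant and the negative frequencies,
  so the coefficients of \<open>h\<close> with positive index can be read off from \<open>f\<close> alone.
\<close>
lemma circle_fourier_harmonic:
  fixes h g :: "complex \<Rightarrow> complex" and r :: real
  assumes h: "h holomorphic_on ball c R" and g: "g holomorphic_on ball c R"
    and r: "0 < r" "r < R" and n: "n \<ge> 1"
  shows "((\<lambda>t. harmonic_map h g (c + of_real r * cis t) * cis (- (real n * t))) has_integral
      2 * pi * r ^ n * ((deriv ^^ n) h c / fact n)) {0..2*pi}"
proof -
  have "((\<lambda>t. cnj (g (c + of_real r * cis t) * cis (real n * t))) has_integral cnj 0) {0..2*pi}"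
    using has_integral_linear[OF circle_fourier_holomorphic_negative[OF g r n] bounded_linear_cnj]
    by (simp add: o_def)
  from has_integral_add[OF circle_fourier_holomorphic[OF h r, of n] this]
  show ?thesis by (simp add: harmonic_map_def algebra_simps cis_cnj)
qed

lemma harmonic_coefficient_le_mean:
  fixes h g :: "complex \<Rightarrow> complex" and r :: real
  assumes h: "h holomorphic_on ball c R" and g: "g holomorphic_on ball c R"
    and r: "0 < r" "r < R" and n: "n \<ge> 1"
  shows "2 * pi * r ^ n * cmod ((deriv ^^ n) h c / fact n)
      \<le> integral {0..2*pi} (\<lambda>t. cmod (harmonic_map h g (c + of_real r * cis t)))"
proof -
  note I = circle_fourier_harmonic[OF h g r n]
  have cont: "continuous_on {0..2*pi} (\<lambda>t. harmonic_map h g (c + of_real r * cis t))"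
    by (rule continuous_on_compose2[OF continuous_on_harmonic_map[OF h g]])
       (use r in \<open>auto intro!: continuous_intros simp: dist_norm norm_mult\<close>)
  have "cmod (2 * pi * r ^ n * ((deriv ^^ n) h c / fact n))
      \<le> integral {0..2*pi} (\<lambda>t. cmod (harmonic_map h g (c + of_real r * cis t)))"
    unfolding integral_unique[OF I, symmetric]
    using I cont
    by (intro integral_norm_bound_integral integrable_continuous_real continuous_intros)
       (auto simp: norm_mult has_integral_integrable)
  then show ?thesis using r by (simp add: norm_mult norm_power norm_divide)
qed

lemma harmonic_coefficient_bound:
  fixes h g :: "complex \<Rightarrow> complex" and r :: real
  assumes h: "h holomorphic_on ball c R" and g: "g holomorphic_on ball c R"
    and r: "0 < r" "r < R" and n: "n \<ge> 1"
    and B: "\<And>z. cmod (z - c) = r \<Longrightarrow> cmod (harmonic_map h g z) \<le> B"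
  shows "cmod ((deriv ^^ n) h c / fact n) * r ^ n \<le> B"
proof -
  have "2 * pi * r ^ n * cmod ((deriv ^^ n) h c / fact n)
      \<le> integral {0..2*pi} (\<lambda>t. cmod (harmonic_map h g (c + of_real r * cis t)))"
    by (rule harmonic_coefficient_le_mean[OF h g r n])
  also have "\<dots> \<le> integral {0..2*pi} (\<lambda>t. B)"
  proof (rule integral_le)
    show "(\<lambda>t. cmod (harmonic_map h g (c + of_real r * cis t))) integrable_on {0..2*pi}"
      by (intro integrable_continuous_real continuous_on_norm
          continuous_on_compose2[OF continuous_on_harmonic_map[OF h g]])
         (use r in \<open>auto intro!: continuous_intros simp: dist_norm norm_mult\<close>)
  qed (use r in \<open>auto intro!: B simp: norm_mult\<close>)
  finally show ?thesis by (simp add: mult_ac)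
qed

text \<open>
  This is Harnack's inequality for the positive harmonic function \<open>- log |\<phi>|\<close>, with the constant \<open>1/2\<close> on
  the disc of radius \<open>1/3\<close>.  With a logarithm \<open>L\<close> of \<open>\<phi>\<close>, whose values lie in the left half-plane,
  it is the Schwarz lemma after a Cayley transform sending \<open>L 0\<close> to \<open>0\<close>.
\<close>
lemma harnack_nonvanishing:
  assumes \<phi>: "\<phi> holomorphic_on ball 0 1" and nz: "\<And>z. z \<in> ball 0 1 \<Longrightarrow> \<phi> z \<noteq> 0"
    and lt: "\<And>z. z \<in> ball 0 1 \<Longrightarrow> cmod (\<phi> z) < 1" and z: "cmod z \<le> 1 / 3"
  shows "(cmod (\<phi> z))\<^sup>2 \<le> cmod (\<phi> 0)"
proof -
  obtain L where L: "L holomorphic_on ball 0 1" "\<And>z. z \<in> ball 0 1 \<Longrightarrow> exp (L z) = \<phi> z"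
    using holomorphic_logarithm_exists[OF convex_ball open_ball \<phi> nz, of 0] by auto
  have Re: "Re (L z) < 0" if "z \<in> ball 0 1" for z
    using lt[OF that] L(2)[OF that] by (metis norm_exp_eq_Re exp_less_one_iff)
  define T where "T z = (L z - L 0) / (L z + cnj (L 0))" for z
  have den: "L z + cnj (L 0) \<noteq> 0" if "z \<in> ball 0 1" for z
    using Re[OF that] Re[of 0] by (auto simp: complex_eq_iff)
  have sq: "(cmod (L z - L 0))\<^sup>2 = (cmod (L z + cnj (L 0)))\<^sup>2 - 4 * Re (L z) * Re (L 0)" for z
    unfolding cmod_power2 by (simp add: power2_eq_square algebra_simps)
  have "cmod (T w) \<le> cmod w" if "cmod w < 1" for w
  proof (rule Schwarz_Lemma(1))
    show "T holomorphic_on ball 0 1"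
      unfolding T_def[abs_def] by (intro holomorphic_intros L den)
    show "T 0 = 0" by (simp add: T_def)
    show "cmod (T z) < 1" if "cmod z < 1" for z
    proof -
      have zb: "z \<in> ball 0 1" using that by simp
      have "Re (L z) * Re (L 0) > 0" using Re[OF zb] Re[of 0] by (simp add: mult_neg_neg)
      then have "(cmod (L z - L 0))\<^sup>2 < (cmod (L z + cnj (L 0)))\<^sup>2" by (simp add: sq mult.commute)
      then have "cmod (L z - L 0) < cmod (L z + cnj (L 0))" by (rule power2_less_imp_less) simp
      then show ?thesis using den[OF zb] by (simp add: T_def norm_divide)
    qed
  qed (fact that)
  then have Tz: "cmod (T z) \<le> 1 / 3" using z order_trans[of "cmod (T z)" "cmod z" "1 / 3"] by simp
  have zb: "z \<in> ball 0 1" using z by simp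
  define x x0 where "x = - Re (L z)" and "x0 = - Re (L 0)"
  have xp: "x > 0" "x0 > 0" using Re[OF zb] Re[of 0] by (auto simp: x_def x0_def)
  have "cmod (L z - L 0) \<le> 1 / 3 * cmod (L z + cnj (L 0))"
    using Tz den[OF zb] by (simp add: T_def norm_divide field_simps)
  then have "(cmod (L z - L 0))\<^sup>2 \<le> (1 / 3 * cmod (L z + cnj (L 0)))\<^sup>2" by (rule power_mono) simp
  then have "9 * (cmod (L z - L 0))\<^sup>2 \<le> (cmod (L z + cnj (L 0)))\<^sup>2" by (simp add: power_mult_distrib power_divide)
  then have "9 * (x0 - x)\<^sup>2 \<le> (x0 + x)\<^sup>2"
    unfolding cmod_power2 x_def x0_def
    using zero_le_power2[of "Im (L z) - Im (L 0)"] by (simp add: power2_eq_square algebra_simps)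
  then have "(3 * (x0 - x))\<^sup>2 \<le> (x0 + x)\<^sup>2" by (simp only: power_mult_distrib) simp
  then have "3 * (x0 - x) \<le> x0 + x" by (rule power2_le_imp_le) (use xp in simp)
  then have "x0 \<le> 2 * x" by simp
  then have "exp (- (2 * x)) \<le> exp (- x0)" by simp
  moreover have "(cmod (\<phi> z))\<^sup>2 = exp (- (2 * x))"
    by (simp add: x_def L(2)[OF zb, symmetric] flip: exp_double)
  moreover have "cmod (\<phi> 0) = exp (- x0)" using L(2)[of 0] by (simp add: x0_def flip: norm_exp_eq_Re)
  ultimately show ?thesis by simp
qed

section \<open>Boundedness of second coefficients\<close>

lemma S_H_D:
  assumes "(h, g) \<in> S_H"
  shows "h holomorphic_on unit_disc" "g holomorphic_on unit_disc"
    "\<And>z. z \<in> unit_disc \<Longrightarrow> jacobian h g z > 0" "inj_on (harmonic_map h g) unit_disc"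
    "h 0 = 0" "g 0 = 0" "deriv h 0 = 1"
  using assms by (auto simp: S_H_def)

text \<open>
  The Schwarz lemma for the dilatation \<open>g' / h'\<close>, which maps the disc into itself and vanishes at \<open>0\<close>.
\<close>
lemma S_H0_dilatation:
  assumes "(h, g) \<in> S_H0" and z: "z \<in> unit_disc"
  shows "cmod (deriv g z) \<le> cmod z * cmod (deriv h z)"
proof -
  have S: "(h, g) \<in> S_H" and g0: "deriv g 0 = 0" using assms by (auto simp: S_H0_def)
  note D = S_H_D[OF S]
  have nz: "deriv h w \<noteq> 0 \<and> cmod (deriv g w) < cmod (deriv h w)" if "w \<in> unit_disc" for w
    by (rule jacobian_pos_holomorphic_nonzero[OF D(3)[OF that]])
  have "cmod (deriv g z / deriv h z) \<le> cmod z"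
  proof (rule Schwarz_Lemma(1)[of "\<lambda>z. deriv g z / deriv h z"])
    show "(\<lambda>z. deriv g z / deriv h z) holomorphic_on unit_disc"
      using nz by (intro holomorphic_intros holomorphic_deriv D) auto
    show "deriv g 0 / deriv h 0 = 0" by (simp add: g0)
    show "cmod (deriv g w / deriv h w) < 1" if "cmod w < 1" for w
      using nz[of w] that by (simp add: norm_divide)
    show "cmod z < 1" using z by simp
  qed
  then show ?thesis using nz[OF z] by (simp add: norm_divide field_simps)
qed

lemma S_H0_quasiconformal_half:
  assumes "(h, g) \<in> S_H0" and z: "cmod z \<le> 1 / 2"
  shows "(max_stretch h g z)\<^sup>2 \<le> 3 * jacobian h g z"
proof -
  define a b where "a = cmod (deriv h z)" and "b = cmod (deriv g z)"
  have "b \<le> cmod z * a" unfolding a_def b_def by (rule S_H0_dilatation[OF assms(1)]) (use z in simp)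
  also have "\<dots> \<le> 1 / 2 * a" using z by (intro mult_right_mono) (auto simp: a_def)
  finally have "2 * b \<le> a" by simp
  moreover have "0 \<le> a" "0 \<le> b" by (auto simp: a_def b_def)
  ultimately have "0 \<le> (a + b) * (2 * (a - 2 * b))" by simp
  then have "(a + b)\<^sup>2 \<le> 3 * (a\<^sup>2 - b\<^sup>2)" by (simp add: power2_eq_square algebra_simps)
  then show ?thesis by (simp add: max_stretch_def jacobian_def a_def b_def)
qed

text \<open>
  Let \<open>d = exp (-700)\<close>.  The point \<open>z\<close> is compared with the centre \<open>c = (1 - d) z\<close> and with \<open>p = - c\<close>, both of which lie in
  the smaller disc, where \<open>|f| \<le> B\<close>.  The distances of \<open>z\<close> and \<open>p\<close> from \<open>c\<close> are \<open>d |z|\<close> and at least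
  \<open>|z|\<close>, a ratio \<open>exp 700\<close> as the length-area comparison requires.
\<close>
lemma S_H0_growth_step:
  assumes S: "(h, g) \<in> S_H0" and \<rho>: "0 < \<rho>" "\<rho> < 1 / 4"
    and B: "\<And>z. cmod z \<le> (1 - exp (-700)) * \<rho> \<Longrightarrow> cmod (harmonic_map h g z) \<le> B"
    and z: "cmod z \<le> \<rho>"
  shows "cmod (harmonic_map h g z) \<le> 5 * B"
proof (cases "z = 0")
  case True
  have B0: "cmod (harmonic_map h g 0) \<le> B" using \<rho> by (intro B) simp
  moreover have "0 \<le> B" using order_trans[OF norm_ge_zero B0] .
  ultimately show ?thesis using True by simp
next
  case False
  have S': "(h, g) \<in> S_H" using S by (simp add: S_H0_def)
  note D = S_H_D[OF S']
  define d :: real where "d = exp (-700)"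
  have d: "0 < d" "d < 1 / 2"
  proof -
    have "2 < exp (700 :: real)" using exp_ge_add_one_self[of "700 :: real"] by linarith
    then show "d < 1 / 2" by (simp add: d_def exp_minus field_simps)
  qed (simp add: d_def)
  define c where "c = of_real (1 - d) * z"
  define p where "p = - c"
  have nc: "cmod c = (1 - d) * cmod z" using d by (simp add: c_def norm_mult del: of_real_diff)
  have ncl: "cmod c \<le> (1 - exp (-700)) * \<rho>" using nc z d by (simp add: d_def[symmetric] mult_left_mono)
  have zc: "cmod (z - c) = d * cmod z"
  proof -
    have "z - c = of_real d * z" by (simp add: c_def algebra_simps)
    then show ?thesis using d by (simp add: norm_mult)
  qed
  have pc: "cmod (p - c) = 2 * (1 - d) * cmod z"
  proof -
    have "p - c = - (2 * c)" by (simp add: p_def)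
    then show ?thesis by (simp only: norm_minus_cancel norm_mult nc) simp
  qed
  have half: "cmod w \<le> 1 / 2" if "cmod (w - c) \<le> cmod z" for w
  proof -
    have "cmod w \<le> cmod c + cmod (w - c)" using norm_triangle_ineq[of c "w - c"] by simp
    also have "\<dots> \<le> cmod z + cmod z"
      using that nc d by (intro add_mono) (auto intro: mult_left_le_one_le)
    also have "\<dots> \<le> 1 / 2" using z \<rho> by simp
    finally show ?thesis .
  qed
  have "cmod (harmonic_map h g z - harmonic_map h g c) \<le> 2 * cmod (harmonic_map h g p - harmonic_map h g c)"
  proof (rule length_area_three_points[where U = unit_disc and r = "d * cmod z" and R = "cmod z"])
    show "ln (cmod z / (d * cmod z)) \<ge> 700" using False by (simp add: d_def ln_div)
    show "cball c (cmod z) \<subseteq> unit_disc" using half by (force simp: dist_norm norm_minus_commute)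
    show "(max_stretch h g w)\<^sup>2 \<le> 3 * jacobian h g w" if "w \<in> annulus c (d * cmod z) (cmod z)" for w
      using that half by (intro S_H0_quasiconformal_half[OF S]) auto
    show "z \<in> cball c (d * cmod z)" using zc by (simp add: dist_norm norm_minus_commute)
    show "p \<in> unit_disc" using nc d z \<rho> ncl
    proof -
      have "cmod c \<le> 1 / 2" using half[of c] by simp
      then show ?thesis by (simp add: p_def)
    qed
    show "cmod z \<le> cmod (p - c)" unfolding pc using d mult_right_mono[of 1 "2 * (1 - d)" "cmod z"] by simp
  qed (use D d False in auto)
  then have "cmod (harmonic_map h g z) \<le> cmod (harmonic_map h g c) + 2 * cmod (harmonic_map h g p - harmonic_map h g c)"
    using norm_triangle_ineq2[of "harmonic_map h g z" "harmonic_map h g c"] by linarith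
  also have "\<dots> \<le> cmod (harmonic_map h g c) + 2 * (cmod (harmonic_map h g p) + cmod (harmonic_map h g c))"
    by (intro add_left_mono mult_left_mono norm_triangle_ineq4) auto
  also have "\<dots> \<le> B + 2 * (B + B)"
    using B[OF ncl] B[of p] ncl by (intro add_mono mult_left_mono) (auto simp: p_def)
  finally show ?thesis by simp
qed

lemma S_H0_growth_iterate:
  assumes S: "(h, g) \<in> S_H0" and \<rho>: "0 < \<rho>" "\<rho> < 1 / 4"
    and B: "\<And>z. cmod z \<le> (1 - exp (-700)) ^ n * \<rho> \<Longrightarrow> cmod (harmonic_map h g z) \<le> B"
    and z: "cmod z \<le> \<rho>"
  shows "cmod (harmonic_map h g z) \<le> 5 ^ n * B"
  using B z
proof (induction n arbitrary: z B)
  case 0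
  then show ?case by simp
next
  case (Suc n)
  define q :: real where "q = 1 - exp (-700)"
  have q: "0 < q" "q < 1" by (auto simp: q_def)
  have qn: "0 < q ^ n * \<rho>" using q \<rho> by simp
  have "q ^ n * \<rho> \<le> 1 * \<rho>" using q \<rho> by (intro mult_right_mono power_le_one) auto
  then have qn': "q ^ n * \<rho> < 1 / 4" using \<rho> by linarith
  have "cmod (harmonic_map h g w) \<le> 5 * B" if "cmod w \<le> q ^ n * \<rho>" for w
  proof (rule S_H0_growth_step[OF S qn qn'])
    show "cmod (harmonic_map h g w) \<le> B" if "cmod w \<le> (1 - exp (-700)) * (q ^ n * \<rho>)" for w
      using that by (intro Suc.prems) (simp add: q_def mult.assoc)
  qed (fact that)
  then have "cmod (harmonic_map h g z) \<le> 5 ^ n * (5 * B)"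
    by (intro Suc.IH) (auto simp: q_def Suc.prems)
  then show ?case by simp
qed

text \<open>
  Let \<open>M\<close> be the maximum of \<open>|f|\<close> on \<open>|z| \<le> 1/8\<close>.  Cauchy's estimate gives \<open>|h'| \<le> 16 M\<close> on
  \<open>|z| \<le> 1/16\<close>, and since \<open>h'\<close> has no zeros and \<open>h' 0 = 1\<close>, Harnack's inequality improves this to the order
  of \<open>sqrt M\<close> near \<open>0\<close>.  The growth steps carry the resulting bound for \<open>f\<close> back to the disc of
  radius \<open>1/8\<close> at the cost of a factor \<open>D\<close>, so that \<open>M\<close> is at most a constant times \<open>D * sqrt M\<close>.
\<close>
lemma S_H0_second_coefficients_bounded:
  "\<exists>B. \<forall>h g. (h, g) \<in> S_H0 \<longrightarrow>
     cmod ((deriv ^^ 2) h 0 / 2) \<le> B \<and> cmod ((deriv ^^ 2) g 0 / 2) \<le> B"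
proof -
  have "\<exists>n. (1 - exp (-700) :: real) ^ n < 1 / 8" by (rule real_arch_pow_inv) auto
  then obtain n where n: "(1 - exp (-700) :: real) ^ n < 1 / 8" by blast
  define D :: real where "D = 5 ^ n"
  have "cmod ((deriv ^^ 2) h 0 / 2) \<le> 2 * D\<^sup>2 \<and> cmod ((deriv ^^ 2) g 0 / 2) \<le> 2 * D\<^sup>2"
    if S: "(h, g) \<in> S_H0" for h g
  proof -
    have S': "(h, g) \<in> S_H" using S by (simp add: S_H0_def)
    note D = S_H_D[OF S']
    define f where "f = harmonic_map h g"
    have sub: "cball 0 (1/8) \<subseteq> unit_disc" by auto
    have contf: "continuous_on unit_disc f" unfolding f_def by (rule continuous_on_harmonic_map[OF D(1,2)])
    have "continuous_on (cball 0 (1/8)) (\<lambda>z. cmod (f z))"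
      by (intro continuous_on_norm continuous_on_subset[OF contf sub])
    moreover have "cball (0::complex) (1/8) \<noteq> {}" by simp
    ultimately obtain x where x: "x \<in> cball 0 (1/8)" "\<And>y. y \<in> cball 0 (1/8) \<Longrightarrow> cmod (f y) \<le> cmod (f x)"
      using continuous_attains_sup[OF compact_cball] by blast
    define M where "M = cmod (f x)"
    have fM: "cmod (f z) \<le> M" if "cmod z \<le> 1 / 8" for z using x(2)[of z] that by (simp add: M_def)
    have M: "M > 0"
    proof -
      have "f (1/8) \<noteq> f 0" using D(4) inj_onD[OF D(4), of "1/8" 0] by (auto simp: f_def)
      then have "f (1/8) \<noteq> 0" by (simp add: f_def harmonic_map_def D)
      then show ?thesis using fM[of "1/8"] by (auto intro: less_le_trans[of 0 "cmod (f (1/8))"])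
    qed
    have h16: "cmod (deriv h w) \<le> 16 * M" if "cmod w \<le> 1 / 16" for w
    proof -
      have sb: "ball w (1/2) \<subseteq> unit_disc"
      proof
        fix v assume "v \<in> ball w (1/2)"
        then have "cmod (v - w) < 1 / 2" by (simp add: dist_norm norm_minus_commute)
        then show "v \<in> unit_disc" using that norm_triangle_ineq[of w "v - w"] by simp
      qed
      have "cmod ((deriv ^^ 1) h w / fact 1) * (1/16) ^ 1 \<le> M"
      proof (rule harmonic_coefficient_bound[where g = g and R = "1/2"])
        show "cmod (harmonic_map h g z) \<le> M" if "cmod (z - w) = 1 / 16" for z
          using fM[of z] that \<open>cmod w \<le> 1 / 16\<close> norm_triangle_ineq[of w "z - w"] by (simp add: f_def)
      qed (use D sb in \<open>auto intro: holomorphic_on_subset\<close>)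
      then show ?thesis by simp
    qed
    \<comment> \<open>\<open>32 * M\<close> instead of \<open>16 * M\<close>, because Harnack needs a strict bound; the radius 1/3 becomes 1/48\<close>
    define \<phi> where "\<phi> z = deriv h (z / 16) / of_real (32 * M)" for z
    have nz: "deriv h z \<noteq> 0 \<and> cmod (deriv g z) < cmod (deriv h z)" if "cmod z < 1" for z
      using jacobian_pos_holomorphic_nonzero[OF D(3)] that by simp
    have h48: "(cmod (deriv h w))\<^sup>2 \<le> 32 * M" if "cmod w \<le> 1 / 48" for w
    proof -
      have "(cmod (\<phi> (16 * w)))\<^sup>2 \<le> cmod (\<phi> 0)"
      proof (rule harnack_nonvanishing)
        have "(\<lambda>z. deriv h (z / 16)) holomorphic_on ball 0 1"
        proof -
          have "(deriv h \<circ> (\<lambda>z. z / 16)) holomorphic_on ball 0 1"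
            by (rule holomorphic_on_compose_gen[OF _ holomorphic_deriv[OF D(1) open_ball]])
               (auto intro!: holomorphic_intros)
          then show ?thesis by (simp add: o_def)
        qed
        then show "\<phi> holomorphic_on ball 0 1"
          unfolding \<phi>_def[abs_def] using M by (auto intro!: holomorphic_intros)
        show "\<phi> z \<noteq> 0" if "z \<in> ball 0 1" for z
          using nz[of "z / 16"] that M by (simp add: \<phi>_def norm_divide)
        show "cmod (\<phi> z) < 1" if "z \<in> ball 0 1" for z
          using h16[of "z / 16"] that M by (simp add: \<phi>_def norm_divide norm_mult)
        show "cmod (16 * w) \<le> 1 / 3" using that by (simp add: norm_mult)
      qed
      then show ?thesis using M D(7)
        by (simp add: \<phi>_def norm_divide norm_mult power_divide power_mult_distrib field_simps power2_eq_square)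
    qed
    define s where "s = sqrt (32 * M)"
    have hs: "cmod (deriv h w) \<le> s" if "cmod w \<le> 1 / 48" for w
      unfolding s_def by (rule real_le_rsqrt[OF h48[OF that]])
    have small: "cmod (harmonic_map h g w) \<le> s / 32" if w: "cmod w \<le> (1 - exp (-700)) ^ n * (1 / 8)" for w
    proof -
      have "(1 - exp (-700) :: real) ^ n * (1 / 8) \<le> 1 / 8 * (1 / 8)" using n by (intro mult_right_mono) auto
      then have w64: "cmod w \<le> 1 / 64" using w by linarith
      have s0: "0 \<le> s" using M by (simp add: s_def)
      have wd: "w \<in> cball 0 (1/64)" using w64 by simp
      have sub: "z \<in> unit_disc" if "z \<in> cball 0 (1/64)" for z :: complex using that by simp
      have "cmod (h w - h 0) \<le> s * cmod (w - 0)"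
      proof (rule field_differentiable_bound[OF convex_cball[of 0 "1/64"], of h "deriv h"])
        show "(h has_field_derivative deriv h z) (at z within cball 0 (1/64))" if "z \<in> cball 0 (1/64)" for z
          by (rule has_field_derivative_at_within[OF holomorphic_derivI[OF D(1) open_ball sub[OF that]]])
        show "cmod (deriv h z) \<le> s" if "z \<in> cball 0 (1/64)" for z
          using hs[of z] that by simp
      qed (use wd in simp_all)
      then have 1: "cmod (h w) \<le> s * (1 / 64)" using mult_left_mono[OF w64 s0] D(5,6) by simp
      have "cmod (g w - g 0) \<le> s * cmod (w - 0)"
      proof (rule field_differentiable_bound[OF convex_cball[of 0 "1/64"], of g "deriv g"])
        show "(g has_field_derivative deriv g z) (at z within cball 0 (1/64))" if "z \<in> cball 0 (1/64)" for z
          by (rule has_field_derivative_at_within[OF holomorphic_derivI[OF D(2) open_ball sub[OF that]]])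
        show "cmod (deriv g z) \<le> s" if "z \<in> cball 0 (1/64)" for z
          using nz[of z] hs[of z] that by simp
      qed (use wd in simp_all)
      then have 2: "cmod (g w) \<le> s * (1 / 64)" using mult_left_mono[OF w64 s0] D(5,6) by simp
      have "cmod (harmonic_map h g w) \<le> cmod (h w) + cmod (cnj (g w))"
        unfolding harmonic_map_def by (rule norm_triangle_ineq)
      then show ?thesis using 1 2 by simp
    qed
    have "M \<le> 5 ^ n * (s / 32)"
      unfolding M_def f_def
      by (rule S_H0_growth_iterate[OF S _ _ small, of "1/8"]) (use x in auto)
    then have "M\<^sup>2 \<le> (D * (s / 32))\<^sup>2" using M by (intro power_mono) (auto simp: D_def)
    also have "\<dots> = D\<^sup>2 * M / 32" using M by (simp add: s_def power_mult_distrib power_divide)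
    finally have "M * M \<le> D\<^sup>2 / 32 * M" by (simp add: power2_eq_square)
    then have MD: "M \<le> D\<^sup>2 / 32" using M by (rule mult_right_le_imp_le)
    have "cmod ((deriv ^^ 2) h 0 / fact 2) * (1/8) ^ 2 \<le> M"
      by (rule harmonic_coefficient_bound[where g = g and R = 1]) (use D fM in \<open>auto simp: f_def\<close>)
    then have 1: "cmod ((deriv ^^ 2) h 0 / 2) \<le> 2 * D\<^sup>2" using MD by (simp add: power2_eq_square)
    have sym: "cmod (harmonic_map g h z) = cmod (f z)" for z
    proof -
      have "harmonic_map g h z = cnj (f z)" by (simp add: harmonic_map_def f_def)
      then show ?thesis by simp
    qed
    have "cmod ((deriv ^^ 2) g 0 / fact 2) * (1/8) ^ 2 \<le> M"
      by (rule harmonic_coefficient_bound[where g = h and R = 1]) (use D fM in \<open>auto simp: sym\<close>)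
    then have 2: "cmod ((deriv ^^ 2) g 0 / 2) \<le> 2 * D\<^sup>2" using MD by (simp add: power2_eq_square)
    show ?thesis using 1 2 by blast
  qed
  then show ?thesis by blast
qed

lemma S_H_I:
  assumes "h holomorphic_on unit_disc" "g holomorphic_on unit_disc"
    "\<And>z. z \<in> unit_disc \<Longrightarrow> 0 < jacobian h g z" "inj_on (harmonic_map h g) unit_disc"
    "h 0 = 0" "g 0 = 0" "deriv h 0 = 1"
  shows "(h, g) \<in> S_H"
  using assms by (auto simp: S_H_def)

lemma S_H0_I:
  assumes "h holomorphic_on unit_disc" "g holomorphic_on unit_disc"
    "\<And>z. z \<in> unit_disc \<Longrightarrow> 0 < jacobian h g z" "inj_on (harmonic_map h g) unit_disc"
    "h 0 = 0" "g 0 = 0" "deriv h 0 = 1" "deriv g 0 = 0"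
  shows "(h, g) \<in> S_H0"
  using assms S_H_I by (auto simp: S_H0_def)

text \<open>
  Subtracting a multiple of \<open>cnj f\<close> from \<open>f\<close> is an invertible real-linear map of the target; the multiple
  \<open>cnj (g' 0)\<close> removes the first coefficient of \<open>g\<close>.
\<close>
lemma S_H_affine_normalization:
  assumes S: "(h, g) \<in> S_H"
  obtains h0 g0 where "(h0, g0) \<in> S_H0"
    "(deriv ^^ 2) h 0 = (deriv ^^ 2) h0 0 + cnj (deriv g 0) * (deriv ^^ 2) g0 0" "cmod (deriv g 0) < 1"
proof -
  note D = S_H_D[OF S]
  define b where "b = deriv g 0"
  have b1: "cmod b < 1" using jacobian_pos_holomorphic_nonzero[OF D(3)[of 0]] D(7) by (simp add: b_def)
  define q where "q = 1 - (cmod b)\<^sup>2"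
  have q: "q > 0" using b1 power_strict_mono[of "cmod b" 1 2] by (simp add: q_def)
  have bb: "b * cnj b = of_real (1 - q)"
    by (simp add: q_def complex_norm_square[symmetric])
  define h0 where "h0 z = (h z - cnj b * g z) / of_real q" for z
  define g0 where "g0 z = (g z - b * h z) / of_real q" for z
  have hol: "h0 holomorphic_on unit_disc" "g0 holomorphic_on unit_disc"
    unfolding h0_def[abs_def] g0_def[abs_def] using q by (auto intro!: holomorphic_intros D)
  have dh: "(h has_field_derivative deriv h z) (at z)" "(g has_field_derivative deriv g z) (at z)"
    if "z \<in> unit_disc" for z
    using D(1,2) that by (auto intro: holomorphic_derivI)
  have d0: "deriv h0 z = (deriv h z - cnj b * deriv g z) / of_real q"
    "deriv g0 z = (deriv g z - b * deriv h z) / of_real q" if "z \<in> unit_disc" for z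
    unfolding h0_def[abs_def] g0_def[abs_def] using q dh[OF that]
    by (auto intro!: DERIV_imp_deriv derivative_eq_intros)
  have f0: "harmonic_map h0 g0 z = (harmonic_map h g z - cnj b * cnj (harmonic_map h g z)) / of_real q" for z
    using q by (simp add: harmonic_map_def h0_def g0_def field_simps)
  have "(h0, g0) \<in> S_H0"
  proof (rule S_H0_I)
    show "h0 holomorphic_on unit_disc" "g0 holomorphic_on unit_disc" by (fact hol)+
    show "inj_on (harmonic_map h0 g0) unit_disc"
    proof (rule inj_onI)
      fix x y assume xy: "x \<in> unit_disc" "y \<in> unit_disc" "harmonic_map h0 g0 x = harmonic_map h0 g0 y"
      define d where "d = harmonic_map h g x - harmonic_map h g y"
      have "d = cnj b * cnj d" using xy(3) q by (simp add: f0 d_def field_simps)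
      then have "cmod d = cmod b * cmod d" by (metis complex_mod_cnj norm_mult)
      then have "d = 0" using b1 by auto
      then show "x = y" using D(4) xy by (auto simp: d_def dest: inj_onD)
    qed
    show "h0 0 = 0" "g0 0 = 0" by (simp_all add: h0_def g0_def D)
    show "deriv h0 0 = 1" using d0[of 0] q bb D by (simp add: b_def[symmetric] mult.commute)
    show "deriv g0 0 = 0" using d0[of 0] D by (simp add: b_def[symmetric])
    show "0 < jacobian h0 g0 z" if z: "z \<in> unit_disc" for z
    proof -
      define u v where "u = deriv h z" and "v = deriv g z"
      have "(cmod (u - cnj b * v))\<^sup>2 - (cmod (v - b * u))\<^sup>2 = q * ((cmod u)\<^sup>2 - (cmod v)\<^sup>2)"
        unfolding q_def cmod_power2 by (simp add: power2_eq_square algebra_simps)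
      then have "jacobian h0 g0 z = jacobian h g z / q"
        using q by (simp add: jacobian_def d0[OF z] norm_divide power_divide u_def[symmetric] v_def[symmetric]
            diff_divide_distrib[symmetric] power2_eq_square[of q])
      then show ?thesis using D(3)[OF z] q by simp
    qed
  qed
  moreover have "(deriv ^^ 2) h 0 = (deriv ^^ 2) h0 0 + cnj b * (deriv ^^ 2) g0 0"
  proof -
    have "h z = h0 z + cnj b * g0 z" for z
    proof -
      have "h0 z + cnj b * g0 z = (h z - (b * cnj b) * h z) / of_real q"
        using q by (simp add: h0_def g0_def field_simps)
      also have "\<dots> = h z" using q by (simp add: bb algebra_simps)
      finally show ?thesis by simp
    qed
    then have "h = (\<lambda>z. h0 z + cnj b * g0 z)" by auto
    then have "(deriv ^^ 2) h 0 = (deriv ^^ 2) (\<lambda>z. h0 z + cnj b * g0 z) 0" by simp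
    also have "\<dots> = (deriv ^^ 2) h0 0 + (deriv ^^ 2) (\<lambda>z. cnj b * g0 z) 0"
      by (rule higher_deriv_add[of _ unit_disc]) (auto intro!: holomorphic_intros hol)
    also have "(deriv ^^ 2) (\<lambda>z. cnj b * g0 z) 0 = cnj b * (deriv ^^ 2) g0 0"
      by (rule higher_deriv_cmult[OF hol(2)]) auto
    finally show ?thesis .
  qed
  ultimately show thesis using that b1 by (auto simp: b_def)
qed

lemma S_H_second_coefficient_bdd_above:
  "bdd_above ((\<lambda>(h, g). cmod (deriv (deriv h) 0) / 2) ` S_H)"
proof -
  obtain B where B: "\<And>h g. (h, g) \<in> S_H0 \<Longrightarrow>
     cmod ((deriv ^^ 2) h 0 / 2) \<le> B \<and> cmod ((deriv ^^ 2) g 0 / 2) \<le> B"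
    using S_H0_second_coefficients_bounded by blast
  have "cmod (deriv (deriv h) 0) / 2 \<le> B + B" if S: "(h, g) \<in> S_H" for h g
  proof -
    obtain h0 g0 where S0: "(h0, g0) \<in> S_H0"
      and eq: "(deriv ^^ 2) h 0 = (deriv ^^ 2) h0 0 + cnj (deriv g 0) * (deriv ^^ 2) g0 0"
      and b: "cmod (deriv g 0) < 1"
      using S_H_affine_normalization[OF S] .
    have "cmod (deriv (deriv h) 0) = cmod ((deriv ^^ 2) h 0)" by (simp add: numeral_2_eq_2)
    also have "\<dots> \<le> cmod ((deriv ^^ 2) h0 0) + cmod (cnj (deriv g 0) * (deriv ^^ 2) g0 0)"
      unfolding eq by (rule norm_triangle_ineq)
    also have "cmod (cnj (deriv g 0) * (deriv ^^ 2) g0 0) \<le> 1 * cmod ((deriv ^^ 2) g0 0)"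
      unfolding norm_mult using b by (intro mult_right_mono) auto
    finally show ?thesis using B[OF S0] by (simp add: norm_divide)
  qed
  then show ?thesis by (intro bdd_aboveI[of _ "B + B"]) auto
qed

lemma second_derivative_le_gamma_H:
  assumes "(h, g) \<in> S_H" shows "cmod (deriv (deriv h) 0) \<le> 2 * gamma_H"
  using cSUP_upper[OF assms S_H_second_coefficient_bdd_above] by (simp add: gamma_H_def)

text \<open>
  The Koebe function \<open>z / (1 - z)^2\<close> belongs to \<open>S_H\<close> and has second coefficient \<open>2\<close>.
\<close>
lemma gamma_H_ge_2: "2 \<le> gamma_H"
proof -
  define k :: "complex \<Rightarrow> complex" where "k z = z / (1 - z)\<^sup>2" for z
  have dk: "(k has_field_derivative (1 + z) / (1 - z) ^ 3) (at z)" if "z \<noteq> 1" for z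
  proof -
    have nz: "(1 - z)\<^sup>2 \<noteq> 0" using that by simp
    have "((\<lambda>z. (1 - z)\<^sup>2) has_field_derivative (- 2 * (1 - z))) (at z)"
      by (auto intro!: derivative_eq_intros)
    from DERIV_divide[OF DERIV_ident this nz]
    have "(k has_field_derivative ((1 - z)\<^sup>2 + z * (2 * (1 - z))) / ((1 - z)\<^sup>2 * (1 - z)\<^sup>2)) (at z)"
      unfolding k_def[abs_def] by (simp only: mult_1_left mult_minus_left mult_minus_right diff_minus_eq_add)
    moreover have "((1 - z)\<^sup>2 + z * (2 * (1 - z))) / ((1 - z)\<^sup>2 * (1 - z)\<^sup>2) = (1 + z) / (1 - z) ^ 3"
    proof -
      have "(1 - z)\<^sup>2 + z * (2 * (1 - z)) = (1 - z) * (1 + z)" by (simp add: power2_eq_square algebra_simps)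
      then show ?thesis using that by (simp add: power2_eq_square power3_eq_cube)
    qed
    ultimately show ?thesis by simp
  qed
  have ne: "z \<noteq> 1" if "z \<in> unit_disc" for z :: complex using that by auto
  have derk: "deriv k z = (1 + z) / (1 - z) ^ 3" if "z \<in> unit_disc" for z
    using dk[OF ne[OF that]] by (rule DERIV_imp_deriv)
  have "(k, \<lambda>_. 0) \<in> S_H"
  proof (rule S_H_I)
    show "k holomorphic_on unit_disc"
      unfolding k_def[abs_def]
    proof (intro holomorphic_on_divide holomorphic_on_power holomorphic_on_diff holomorphic_on_ident holomorphic_on_const)
      show "(1 - z)\<^sup>2 \<noteq> 0" if "z \<in> unit_disc" for z using ne[OF that] by simp
    qed
    show "0 < jacobian k (\<lambda>_. 0) z" if "z \<in> unit_disc" for z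
    proof -
      have "1 + z \<noteq> 0"
      proof
        assume "1 + z = 0"
        then have "z = -1" by (simp add: eq_neg_iff_add_eq_0 add.commute)
        with that show False by simp
      qed
      then show ?thesis using derk[of z] ne[of z] that by (simp add: jacobian_def)
    qed
    show "inj_on (harmonic_map k (\<lambda>_. 0)) unit_disc"
    proof (rule inj_onI)
      fix x y assume xy: "x \<in> unit_disc" "y \<in> unit_disc" "harmonic_map k (\<lambda>_. 0) x = harmonic_map k (\<lambda>_. 0) y"
      then have "x * (1 - y)\<^sup>2 = y * (1 - x)\<^sup>2"
        using ne[OF xy(1)] ne[OF xy(2)] by (simp add: harmonic_map_def k_def field_simps)
      then have "(x - y) * (1 - x * y) = 0" by (simp add: power2_eq_square algebra_simps)
      moreover have "x * y \<noteq> 1"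
      proof
        assume "x * y = 1"
        then have "cmod x * cmod y = 1" by (metis norm_mult norm_one)
        moreover have "cmod x * cmod y \<le> 1 * cmod y" using xy by (intro mult_right_mono) auto
        ultimately show False using xy by simp
      qed
      ultimately show "x = y" by auto
    qed
    show "(\<lambda>_. 0) holomorphic_on unit_disc" "(0::complex) = 0" by auto
    show "k 0 = 0" by (simp add: k_def)
    show "deriv k 0 = 1" using derk[of 0] by simp
  qed
  from second_derivative_le_gamma_H[OF this]
  have "cmod (deriv (deriv k) 0) \<le> 2 * gamma_H" .
  moreover have "deriv (deriv k) 0 = 4"
  proof -
    have "\<forall>\<^sub>F z in nhds 0. z \<in> unit_disc" by (rule eventually_nhds_in_open) auto
    then have "\<forall>\<^sub>F z in nhds 0. deriv k z = (1 + z) / (1 - z) ^ 3"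
      by eventually_elim (rule derk)
    then have "deriv (deriv k) 0 = deriv (\<lambda>z. (1 + z) / (1 - z) ^ 3) 0" by (intro deriv_cong_ev) auto
    also have "\<dots> = 4"
      by (rule DERIV_imp_deriv) (auto intro!: derivative_eq_intros)
    finally show ?thesis .
  qed
  ultimately show ?thesis by simp
qed

section \<open>Koebe transforms and growth\<close>

lemma disc_automorphism_denominator:
  assumes "cmod a < 1" "cmod z < 1" shows "1 + cnj a * z \<noteq> 0"
proof
  assume "1 + cnj a * z = 0"
  then have "cnj a * z = -1" by (simp add: eq_neg_iff_add_eq_0 add.commute)
  then have "cmod a * cmod z = 1" by (metis complex_mod_cnj norm_minus_cancel norm_mult norm_one)
  moreover have "cmod a * cmod z < 1 * 1" using assms by (intro mult_strict_mono') auto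
  ultimately show False by simp
qed

lemma disc_automorphism_norm:
  assumes a: "cmod a < 1" and z: "cmod z < 1"
  shows "cmod ((z + a) / (1 + cnj a * z)) < 1"
proof -
  have "(cmod (1 + cnj a * z))\<^sup>2 - (cmod (z + a))\<^sup>2 = (1 - (cmod a)\<^sup>2) * (1 - (cmod z)\<^sup>2)"
    unfolding cmod_power2 by (simp add: power2_eq_square algebra_simps)
  moreover have "(cmod a)\<^sup>2 < 1" "(cmod z)\<^sup>2 < 1" using a z by (simp_all add: abs_square_less_1)
  ultimately have "(cmod (z + a))\<^sup>2 < (cmod (1 + cnj a * z))\<^sup>2"
    by (smt (verit) mult_pos_pos)
  then have "cmod (z + a) < cmod (1 + cnj a * z)" by (rule power2_less_imp_less) simp
  then show ?thesis using disc_automorphism_denominator[OF a z] by (simp add: norm_divide)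
qed

lemma disc_automorphism_inj:
  assumes a: "cmod a < 1"
  shows "inj_on (\<lambda>z. (z + a) / (1 + cnj a * z)) unit_disc"
proof (rule inj_onI)
  fix x y assume xy: "x \<in> unit_disc" "y \<in> unit_disc" "(x + a) / (1 + cnj a * x) = (y + a) / (1 + cnj a * y)"
  have d: "1 + cnj a * x \<noteq> 0" "1 + cnj a * y \<noteq> 0"
    using disc_automorphism_denominator[OF a] xy by auto
  then have "(x + a) * (1 + cnj a * y) = (y + a) * (1 + cnj a * x)" using xy(3) by (simp add: frac_eq_eq)
  then have "(x - y) * (1 - a * cnj a) = 0" by (simp add: algebra_simps)
  moreover have "a * cnj a \<noteq> 1"
  proof
    assume "a * cnj a = 1"
    then have "(cmod a)\<^sup>2 = 1" by (metis complex_norm_square of_real_eq_1_iff)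
    moreover have "(cmod a)\<^sup>2 < 1" using a by (simp add: abs_square_less_1)
    ultimately show False by simp
  qed
  ultimately show "x = y" by auto
qed

lemma disc_automorphism_has_derivative:
  assumes a: "cmod a < 1" and z: "cmod z < 1"
  shows "((\<lambda>z. (z + a) / (1 + cnj a * z)) has_field_derivative
      of_real (1 - (cmod a)\<^sup>2) / (1 + cnj a * z)\<^sup>2) (at z)"
proof -
  have d: "1 + cnj a * z \<noteq> 0" by (rule disc_automorphism_denominator[OF a z])
  have "((\<lambda>z. z + a) has_field_derivative 1) (at z)" "((\<lambda>z. 1 + cnj a * z) has_field_derivative cnj a) (at z)"
    by (auto intro!: derivative_eq_intros)
  from DERIV_divide[OF this d] show ?thesis
  proof (rule DERIV_cong)
    have "a * cnj a = of_real ((cmod a)\<^sup>2)" by (simp only: complex_norm_square)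
    then show "(1 * (1 + cnj a * z) - (z + a) * cnj a) / ((1 + cnj a * z) * (1 + cnj a * z))
        = of_real (1 - (cmod a)\<^sup>2) / (1 + cnj a * z)\<^sup>2"
      by (simp add: power2_eq_square algebra_simps)
  qed
qed

text \<open>
  Stated for a single holomorphic function, since it is needed for \<open>h\<close> and for \<open>g\<close>, with different
  normalizing constants \<open>l\<close>.
\<close>
lemma koebe_transform_derivatives:
  assumes h: "h holomorphic_on unit_disc" and a: "cmod a < 1"
    and H: "H = (\<lambda>z. (h ((z + a) / (1 + cnj a * z)) - h a) / l)" and l: "l \<noteq> 0"
  shows "H holomorphic_on unit_disc"
    and "\<And>z. cmod z < 1 \<Longrightarrow> deriv H z = deriv h ((z + a) / (1 + cnj a * z))
          * (of_real (1 - (cmod a)\<^sup>2) / (1 + cnj a * z)\<^sup>2) / l"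
    and "deriv (deriv H) 0 = of_real (1 - (cmod a)\<^sup>2) *
          (of_real (1 - (cmod a)\<^sup>2) * deriv (deriv h) a - 2 * cnj a * deriv h a) / l"
proof -
  let ?m = "\<lambda>z. (z + a) / (1 + cnj a * z)"
  let ?q = "of_real (1 - (cmod a)\<^sup>2) :: complex"
  have min: "?m z \<in> unit_disc" if "cmod z < 1" for z using disc_automorphism_norm[OF a that] by simp
  have dH: "(H has_field_derivative deriv h (?m z) * (?q / (1 + cnj a * z)\<^sup>2) / l) (at z)" if z: "cmod z < 1" for z
  proof -
    have "((\<lambda>z. h (?m z)) has_field_derivative deriv h (?m z) * (?q / (1 + cnj a * z)\<^sup>2)) (at z)"
      by (rule DERIV_chain2[OF holomorphic_derivI[OF h open_ball min[OF z]] disc_automorphism_has_derivative[OF a z]])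
    from DERIV_cdivide[OF DERIV_diff[OF this DERIV_const[of "h a"]], of l]
    show ?thesis unfolding H by simp
  qed
  show "H holomorphic_on unit_disc"
    unfolding holomorphic_on_open[OF open_ball] by (intro ballI exI, rule dH) simp
  show dH': "deriv H z = deriv h (?m z) * (?q / (1 + cnj a * z)\<^sup>2) / l" if "cmod z < 1" for z
    using dH[OF that] by (rule DERIV_imp_deriv)
  have "\<forall>\<^sub>F z in nhds 0. z \<in> unit_disc" by (rule eventually_nhds_in_open) auto
  then have "\<forall>\<^sub>F z in nhds 0. deriv H z = deriv h (?m z) * (?q / (1 + cnj a * z)\<^sup>2) / l"
    by eventually_elim (rule dH', simp)
  then have "deriv (deriv H) 0 = deriv (\<lambda>z. deriv h (?m z) * (?q / (1 + cnj a * z)\<^sup>2) / l) 0"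
    by (intro deriv_cong_ev) auto
  also have "\<dots> = ?q * (?q * deriv (deriv h) a - 2 * cnj a * deriv h a) / l"
  proof (rule DERIV_imp_deriv)
    have 1: "((\<lambda>z. deriv h (?m z)) has_field_derivative deriv (deriv h) a * ?q) (at 0)"
      using DERIV_chain2[OF holomorphic_derivI[OF holomorphic_deriv[OF h open_ball] open_ball min[of 0]]
          disc_automorphism_has_derivative[OF a, of 0]] by simp
    have 2: "((\<lambda>z. ?q / (1 + cnj a * z)\<^sup>2) has_field_derivative (- 2 * cnj a * ?q)) (at 0)"
    proof -
      have "((\<lambda>z. (1 + cnj a * z)\<^sup>2) has_field_derivative (2 * cnj a)) (at 0)"
        by (auto intro!: derivative_eq_intros)
      from DERIV_divide[OF DERIV_const[of ?q] this] show ?thesis by (simp add: mult_ac)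
    qed
    show "((\<lambda>z. deriv h (?m z) * (?q / (1 + cnj a * z)\<^sup>2) / l) has_field_derivative
        ?q * (?q * deriv (deriv h) a - 2 * cnj a * deriv h a) / l) (at 0)"
      by (rule DERIV_cong[OF DERIV_cdivide[OF DERIV_mult[OF 1 2]]]) (simp add: algebra_simps)
  qed
  finally show "deriv (deriv H) 0 = ?q * (?q * deriv (deriv h) a - 2 * cnj a * deriv h a) / l" .
qed

text \<open>
  The conjugate of \<open>l\<close> in the second component makes the whole map equal to \<open>f\<close> after the
  automorphism, minus \<open>f a\<close>, divided by \<open>l\<close>; injectivity is then obvious.
\<close>
lemma S_H_koebe_transform:
  assumes S: "(h, g) \<in> S_H" and a: "cmod a < 1"
    and l: "l = of_real (1 - (cmod a)\<^sup>2) * deriv h a"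
  shows "((\<lambda>z. (h ((z + a) / (1 + cnj a * z)) - h a) / l),
          (\<lambda>z. (g ((z + a) / (1 + cnj a * z)) - g a) / cnj l)) \<in> S_H"
proof -
  let ?m = "\<lambda>z. (z + a) / (1 + cnj a * z)"
  define H where "H = (\<lambda>z. (h (?m z) - h a) / l)"
  define G where "G = (\<lambda>z. (g (?m z) - g a) / cnj l)"
  note D = S_H_D[OF S]
  have nz: "deriv h w \<noteq> 0" if "w \<in> unit_disc" for w
    using jacobian_pos_holomorphic_nonzero[OF D(3)[OF that]] by blast
  have a2: "(cmod a)\<^sup>2 < 1" using a by (simp add: abs_square_less_1)
  have q0: "(of_real (1 - (cmod a)\<^sup>2) :: complex) \<noteq> 0"
    using a2 by (simp only: of_real_eq_0_iff)
  have l0: "l \<noteq> 0" unfolding l using q0 nz[of a] a by (simp del: of_real_diff)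
  have cl0: "cnj l \<noteq> 0" using l0 by simp
  have min: "?m z \<in> unit_disc" if "z \<in> unit_disc" for z using disc_automorphism_norm[OF a] that by simp
  note DH = koebe_transform_derivatives[OF D(1) a H_def l0]
  note DG = koebe_transform_derivatives[OF D(2) a G_def cl0]
  have f: "harmonic_map H G z = (harmonic_map h g (?m z) - harmonic_map h g a) / l" for z
    by (simp add: H_def G_def harmonic_map_def add_divide_distrib diff_divide_distrib)
  have "(H, G) \<in> S_H"
  proof (rule S_H_I)
    show "H holomorphic_on unit_disc" "G holomorphic_on unit_disc" by (fact DH(1) DG(1))+
    show "0 < jacobian H G z" if z: "z \<in> unit_disc" for z
    proof -
      define c where "c = of_real (1 - (cmod a)\<^sup>2) / (1 + cnj a * z)\<^sup>2"
      have c0: "c \<noteq> 0" using q0 disc_automorphism_denominator[OF a, of z] z by (simp add: c_def del: of_real_diff)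
      have "jacobian H G z = jacobian h g (?m z) * ((cmod c)\<^sup>2 / (cmod l)\<^sup>2)"
        using z by (simp add: jacobian_def DH(2) DG(2) c_def[symmetric] norm_mult norm_divide
            power_mult_distrib power_divide left_diff_distrib diff_divide_distrib del: of_real_diff)
      then show ?thesis using D(3)[OF min[OF z]] c0 l0 by simp
    qed
    show "inj_on (harmonic_map H G) unit_disc"
    proof (rule inj_onI)
      fix x y assume xy: "x \<in> unit_disc" "y \<in> unit_disc" "harmonic_map H G x = harmonic_map H G y"
      then have "harmonic_map h g (?m x) = harmonic_map h g (?m y)" using l0 by (simp add: f)
      then have "?m x = ?m y" using D(4) min xy by (meson inj_onD)
      then show "x = y" using disc_automorphism_inj[OF a] xy by (meson inj_onD)
    qed
    show "H 0 = 0" "G 0 = 0" by (simp_all add: H_def G_def)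
    show "deriv H 0 = 1" using DH(2)[of 0] l0 unfolding l by simp
  qed
  then show ?thesis by (simp add: H_def G_def)
qed

text \<open>
  The left side is the second derivative at \<open>0\<close> of the Koebe transform with base point \<open>a\<close>.
\<close>
lemma S_H_pre_schwarzian_bound:
  assumes S: "(h, g) \<in> S_H" and a: "cmod a < 1"
  shows "cmod (of_real (1 - (cmod a)\<^sup>2) * (deriv (deriv h) a / deriv h a) - 2 * cnj a) \<le> 2 * gamma_H"
proof -
  define l where "l = of_real (1 - (cmod a)\<^sup>2) * deriv h a"
  note D = S_H_D[OF S]
  have nz: "deriv h a \<noteq> 0"
    using jacobian_pos_holomorphic_nonzero[OF D(3)] a by simp
  have a2: "(cmod a)\<^sup>2 < 1" using a by (simp add: abs_square_less_1)
  then have q0: "(of_real (1 - (cmod a)\<^sup>2) :: complex) \<noteq> 0" by (simp only: of_real_eq_0_iff)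
  have l0: "l \<noteq> 0" using nz q0 by (simp add: l_def del: of_real_diff)
  have "deriv (deriv (\<lambda>z. (h ((z + a) / (1 + cnj a * z)) - h a) / l)) 0
      = of_real (1 - (cmod a)\<^sup>2) * (of_real (1 - (cmod a)\<^sup>2) * deriv (deriv h) a - 2 * cnj a * deriv h a) / l"
    by (rule koebe_transform_derivatives(3)[OF D(1) a refl l0])
  also have "\<dots> = of_real (1 - (cmod a)\<^sup>2) * (deriv (deriv h) a / deriv h a) - 2 * cnj a"
    using nz q0 by (simp add: l_def field_simps del: of_real_diff)
  finally show ?thesis
    using second_derivative_le_gamma_H[OF S_H_koebe_transform[OF S a l_def]] by simp
qed

text \<open>
  On a ray the hypothesis bounds the derivative of \<open>log |h'|\<close> by \<open>(2 \<alpha> + 2 s) / (1 - s^2)\<close>, whose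
  primitive is explicit.  The exponent \<open>\<alpha>\<close> is kept general because it is \<open>gamma_H\<close> for harmonic maps
  and \<open>2\<close> for conformal ones.
\<close>
lemma derivative_growth:
  assumes h: "h holomorphic_on unit_disc" and nz: "\<And>z. z \<in> unit_disc \<Longrightarrow> deriv h z \<noteq> 0"
    and h0: "deriv h 0 = 1" and \<alpha>: "0 \<le> \<alpha>"
    and bnd: "\<And>a. cmod a < 1 \<Longrightarrow>
      cmod (of_real (1 - (cmod a)\<^sup>2) * (deriv (deriv h) a / deriv h a) - 2 * cnj a) \<le> 2 * \<alpha>"
    and z: "cmod z < 1"
  shows "cmod (deriv h z) \<le> 2 powr \<alpha> * (1 - cmod z) powr (- \<alpha> - 1)"
proof -
  note h' = holomorphic_deriv[OF h open_ball]
  obtain L where L: "L holomorphic_on unit_disc" "\<And>z. z \<in> unit_disc \<Longrightarrow> exp (L z) = deriv h z"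
    using holomorphic_logarithm_exists[OF convex_ball open_ball h' nz, of 0] by auto
  have dL: "deriv L w = deriv (deriv h) w / deriv h w" if w: "w \<in> unit_disc" for w
  proof -
    have "((\<lambda>w. exp (L w)) has_field_derivative exp (L w) * deriv L w) (at w)"
      by (rule DERIV_chain2[OF DERIV_exp holomorphic_derivI[OF L(1) open_ball w]])
    moreover have "\<forall>\<^sub>F w in nhds w. w \<in> unit_disc" using w by (intro eventually_nhds_in_open) auto
    then have ev: "\<forall>\<^sub>F w in nhds w. exp (L w) = deriv h w" by eventually_elim (rule L(2))
    ultimately have "(deriv h has_field_derivative exp (L w) * deriv L w) (at w)"
      using DERIV_cong_ev[OF refl ev refl] by simp
    then have "deriv (deriv h) w = exp (L w) * deriv L w" by (rule DERIV_imp_deriv)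
    then show ?thesis using L(2)[OF w] nz[OF w] by simp
  qed
  have ReL: "cmod (deriv h w) = exp (Re (L w))" if "w \<in> unit_disc" for w
    using L(2)[OF that] by (metis norm_exp_eq_Re)
  define r where "r = cmod z"
  obtain u where u: "cmod u = 1" "z = of_real r * u"
  proof (cases "z = 0")
    case True then show thesis using that[of 1] by (simp add: r_def)
  next
    case False then show thesis using that[of "z / of_real (cmod z)"]
      by (simp add: r_def norm_divide)
  qed
  have r: "0 \<le> r" "r < 1" using z by (auto simp: r_def)
  have ru: "of_real s * u \<in> unit_disc" "cmod (of_real s * u) = s" if "0 \<le> s" "s < 1" for s
    using that u by (auto simp: norm_mult)
  define RL where "RL s = Re (L (of_real s * u))" for s
  \<comment> \<open>the primitive of the bound for the derivative of log |h'|, minus log |h'| itself\<close>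
  define \<psi> where "\<psi> s = \<alpha> * (ln (1 + s) - ln (1 - s)) - ln (1 - s\<^sup>2) - RL s" for s
  have "\<psi> 0 \<le> \<psi> r"
  proof (rule DERIV_nonneg_imp_nondecreasing[OF r(1)])
    fix s assume s: "0 \<le> s" "s \<le> r"
    then have s1: "s < 1" using r by simp
    let ?w = "of_real s * u"
    have s2: "s\<^sup>2 < 1" using s s1 by (simp add: abs_square_less_1)
    have dRe: "(RL has_real_derivative Re (deriv L ?w * u)) (at s)"
    proof -
      have 1: "(L has_field_derivative deriv L ?w) (at ?w)"
        by (rule holomorphic_derivI[OF L(1) open_ball ru(1)]) (use s s1 in auto)
      have 2: "((\<lambda>s. of_real s * u) has_vector_derivative u) (at s)"
        by (auto intro!: derivative_eq_intros simp: has_vector_derivative_def scaleR_conv_of_real)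
      have "((L \<circ> (\<lambda>s. of_real s * u)) has_vector_derivative u * deriv L ?w) (at s)"
        by (rule field_vector_diff_chain_at[OF 2 1])
      then have "((\<lambda>s. Re ((L \<circ> (\<lambda>s. of_real s * u)) s)) has_vector_derivative Re (u * deriv L ?w)) (at s)"
        by (rule bounded_linear.has_vector_derivative[OF bounded_linear_Re])
      then show ?thesis
        unfolding RL_def[abs_def] o_def has_real_derivative_iff_has_vector_derivative by (simp only: mult.commute)
    qed
    have "(\<psi> has_real_derivative (\<alpha> * (1 / (1 + s) + 1 / (1 - s)) + 2 * s / (1 - s\<^sup>2) - Re (deriv L ?w * u))) (at s)"
      unfolding \<psi>_def[abs_def] using s s1 s2
      by (auto intro!: derivative_eq_intros dRe)
    moreover have "0 \<le> \<alpha> * (1 / (1 + s) + 1 / (1 - s)) + 2 * s / (1 - s\<^sup>2) - Re (deriv L ?w * u)"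
    proof -
      have cu: "cnj u * u = 1" using u(1) by (metis complex_norm_square mult.commute of_real_1 one_power2)
      have "cmod ((of_real (1 - s\<^sup>2) * deriv L ?w - 2 * cnj ?w) * u) \<le> 2 * \<alpha>"
        using bnd[of ?w] dL[OF ru(1)[OF s(1) s1]] ru[OF s(1) s1] u(1) s1 by (simp add: norm_mult)
      moreover have "(of_real (1 - s\<^sup>2) * deriv L ?w - 2 * cnj ?w) * u
          = of_real (1 - s\<^sup>2) * (deriv L ?w * u) - of_real (2 * s)"
        using cu by (simp add: algebra_simps)
      ultimately have "cmod (of_real (1 - s\<^sup>2) * (deriv L ?w * u) - of_real (2 * s)) \<le> 2 * \<alpha>" by simp
      then have "Re (of_real (1 - s\<^sup>2) * (deriv L ?w * u) - of_real (2 * s)) \<le> 2 * \<alpha>"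
        using complex_Re_le_cmod order_trans by blast
      then have "(1 - s\<^sup>2) * Re (deriv L ?w * u) \<le> 2 * \<alpha> + 2 * s" by simp
      then have "Re (deriv L ?w * u) \<le> (2 * \<alpha> + 2 * s) / (1 - s\<^sup>2)"
        using s2 by (simp add: pos_le_divide_eq mult.commute)
      also have "\<dots> = \<alpha> * (1 / (1 + s) + 1 / (1 - s)) + 2 * s / (1 - s\<^sup>2)"
      proof -
        have "1 / (1 + s) + 1 / (1 - s) = 2 / (1 - s\<^sup>2)"
          using s s1 s2 by (simp add: add_frac_eq power2_eq_square algebra_simps)
        then show ?thesis by (simp add: add_divide_distrib)
      qed
      finally show ?thesis by simp
    qed
    ultimately show "\<exists>y. (\<psi> has_real_derivative y) (at s) \<and> 0 \<le> y" by blast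
  qed
  moreover have "\<psi> 0 = 0"
  proof -
    have "exp (Re (L 0)) = 1" using ReL[of 0] h0 by simp
    then show ?thesis by (simp add: \<psi>_def RL_def)
  qed
  ultimately have "Re (L z) \<le> \<alpha> * (ln (1 + r) - ln (1 - r)) - ln (1 - r\<^sup>2)"
    by (simp add: \<psi>_def RL_def u(2))
  also have "ln (1 - r\<^sup>2) = ln (1 + r) + ln (1 - r)"
  proof -
    have "1 - r\<^sup>2 = (1 + r) * (1 - r)" by (simp add: power2_eq_square algebra_simps)
    then show ?thesis using r by (simp add: ln_mult)
  qed
  also have "\<alpha> * (ln (1 + r) - ln (1 - r)) - (ln (1 + r) + ln (1 - r)) \<le> \<alpha> * ln 2 - (\<alpha> + 1) * ln (1 - r)"
  proof -
    have "\<alpha> * ln (1 + r) \<le> \<alpha> * ln 2" using \<alpha> r by (intro mult_left_mono) auto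
    moreover have "0 \<le> ln (1 + r)" using r by simp
    ultimately show ?thesis by (simp add: algebra_simps)
  qed
  finally have "exp (Re (L z)) \<le> exp (\<alpha> * ln 2 + (- \<alpha> - 1) * ln (1 - r))" by (simp add: algebra_simps)
  also have "\<dots> = 2 powr \<alpha> * (1 - r) powr (- \<alpha> - 1)"
    using r by (simp add: exp_add powr_def mult.commute)
  finally show ?thesis using ReL[of z] z by (simp add: r_def)
qed

lemma harmonic_growth:
  assumes S: "(h, g) \<in> S_H" and \<alpha>: "0 < \<alpha>"
    and bnd: "\<And>a. cmod a < 1 \<Longrightarrow>
      cmod (of_real (1 - (cmod a)\<^sup>2) * (deriv (deriv h) a / deriv h a) - 2 * cnj a) \<le> 2 * \<alpha>"
    and z: "cmod z < 1"
  shows "cmod (harmonic_map h g z) \<le> 2 * 2 powr \<alpha> / \<alpha> * (1 - cmod z) powr (- \<alpha>)"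
proof -
  note D = S_H_D[OF S]
  have nz: "deriv h w \<noteq> 0 \<and> cmod (deriv g w) < cmod (deriv h w)" if "w \<in> unit_disc" for w
    by (rule jacobian_pos_holomorphic_nonzero[OF D(3)[OF that]])
  define r where "r = cmod z"
  show ?thesis
  proof (cases "z = 0")
    case True
    then show ?thesis using \<alpha> D by (simp add: harmonic_map_def)
  next
    case False
    define t where "t = Arg2pi z"
    have zt: "z = of_real r * cis t" unfolding r_def t_def by (metis Arg2pi_eq cis_conv_exp)
    have r: "0 < r" "r < 1" using False z by (auto simp: r_def)
    define F where "F s = harmonic_map h g (0 + of_real s * cis t)" for s
    define F' where "F' s = deriv h (0 + of_real s * cis t) * cis t + cnj (deriv g (0 + of_real s * cis t) * cis t)" for s
    define \<phi> where "\<phi> s = 2 * 2 powr \<alpha> / \<alpha> * (1 - s) powr (- \<alpha>)" for s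
    have inD: "0 + of_real s * cis t \<in> unit_disc" if "0 \<le> s" "s < 1" for s
      using that by (simp add: norm_mult)
    have FF: "(F has_vector_derivative F' s) (at s within T)" if "0 \<le> s" "s < 1" for s T
      unfolding F_def F'_def
      by (rule has_vector_derivative_harmonic_radius[OF open_ball D(1,2) inD[OF that]])
    have phi: "(\<phi> has_vector_derivative 2 * 2 powr \<alpha> * (1 - s) powr (- \<alpha> - 1)) (at s within T)"
      if "0 \<le> s" "s < 1" for s T
    proof -
      have "((\<lambda>s. (1 - s) powr (- \<alpha>)) has_real_derivative (- \<alpha>) * (1 - s) powr (- \<alpha> - 1) * (- 1)) (at s within T)"
        using that by (auto intro!: derivative_eq_intros)
      from DERIV_cmult[OF this, of "2 * 2 powr \<alpha> / \<alpha>"]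
      show ?thesis unfolding \<phi>_def[abs_def] using \<alpha>
        by (simp add: has_real_derivative_iff_has_vector_derivative mult.assoc)
    qed
    have "norm (F r - F 0) \<le> \<phi> r - \<phi> 0"
    proof (rule differentiable_bound_general[OF r(1)])
      show "continuous_on {0..r} F"
        by (rule continuous_on_vector_derivative[where f' = F']) (use FF r in auto)
      show "continuous_on {0..r} \<phi>"
        by (rule continuous_on_vector_derivative[where f' = "\<lambda>s. 2 * 2 powr \<alpha> * (1 - s) powr (- \<alpha> - 1)"])
          (use phi r in auto)
      show "(F has_vector_derivative F' s) (at s)" if "0 < s" "s < r" for s
        by (rule FF) (use that r in auto)
      show "(\<phi> has_vector_derivative 2 * 2 powr \<alpha> * (1 - s) powr (- \<alpha> - 1)) (at s)" if "0 < s" "s < r" for s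
        by (rule phi) (use that r in auto)
      show "norm (F' s) \<le> 2 * 2 powr \<alpha> * (1 - s) powr (- \<alpha> - 1)" if "0 < s" "s < r" for s
      proof -
        let ?w = "0 + of_real s * cis t"
        have w: "?w \<in> unit_disc" "cmod ?w = s" using inD[of s] that r by (auto simp: norm_mult)
        have "norm (F' s) \<le> cmod (deriv h ?w * cis t) + cmod (cnj (deriv g ?w * cis t))"
          unfolding F'_def by (rule norm_triangle_ineq)
        also have "\<dots> = cmod (deriv h ?w) + cmod (deriv g ?w)" by (simp add: norm_mult)
        also have "\<dots> \<le> 2 * cmod (deriv h ?w)" using nz[OF w(1)] by simp
        also have "\<dots> \<le> 2 * (2 powr \<alpha> * (1 - cmod ?w) powr (- \<alpha> - 1))"
          by (intro mult_left_mono derivative_growth[OF D(1) _ D(7) _ bnd]) (use nz w \<alpha> that r in auto)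
        finally show ?thesis using w(2) by simp
      qed
    qed
    moreover have "F r = harmonic_map h g z" "F 0 = 0"
      using zt D by (simp_all add: F_def harmonic_map_def)
    moreover have "\<phi> 0 \<ge> 0" using \<alpha> by (simp add: \<phi>_def)
    ultimately show ?thesis by (simp add: \<phi>_def r_def)
  qed
qed

section \<open>Integral means\<close>

lemma nn_integral_Ioo_continuous:
  fixes F :: "real \<Rightarrow> real"
  assumes F: "continuous_on {a..b} F" and nn: "\<And>t. t \<in> {a..b} \<Longrightarrow> 0 \<le> F t"
  shows "(\<integral>\<^sup>+t. ennreal (indicator {a<..<b} t * F t) \<partial>lborel) = ennreal (integral {a..b} F)"
proof -
  have "(F has_integral integral {a..b} F) {a<..<b}"
    using F by (simp add: integrable_continuous_real integrable_integral flip: has_integral_Icc_iff_Ioo)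
  then show ?thesis using nn by (intro nn_integral_has_integral_lebesgue) auto
qed

lemma growth_square_bound:
  fixes F B \<sigma> \<alpha> :: real
  assumes "F \<le> B * \<sigma> powr (- \<alpha>)" "0 \<le> F" "1 \<le> B" "0 < \<sigma>" "\<sigma> \<le> 1" "0 < \<alpha>"
  shows "1 + F\<^sup>2 \<le> 2 * B\<^sup>2 * \<sigma> powr (- 2 * \<alpha>)"
proof -
  have 1: "1 \<le> \<sigma> powr (- \<alpha>)"
    using assms powr_mono'[of "-\<alpha>" 0 \<sigma>] by simp
  have sq: "(\<sigma> powr (- \<alpha>))\<^sup>2 = \<sigma> powr (- 2 * \<alpha>)"
    using assms by (simp add: power2_eq_square powr_add[symmetric])
  have "F\<^sup>2 \<le> (B * \<sigma> powr (- \<alpha>))\<^sup>2" using assms by (intro power_mono) auto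
  moreover have "1 * 1 \<le> B * \<sigma> powr (- \<alpha>)" using assms 1 by (intro mult_mono) auto
  then have "1 \<le> (B * \<sigma> powr (- \<alpha>))\<^sup>2" by (simp add: one_le_power)
  ultimately show ?thesis by (simp add: power_mult_distrib sq)
qed

text \<open>
  The growth estimate read backwards: the distance \<open>\<sigma>\<close> to the boundary is at most a negative power of the
  size of \<open>f\<close>.  This is how the weight \<open>1 - s\<close> becomes a weight in the image plane.
\<close>
lemma distance_le_growth_powr:
  fixes Q A \<sigma> \<alpha> :: real
  assumes Q: "Q \<le> A * \<sigma> powr (- 2 * \<alpha>)" "0 < Q" and A: "0 < A" and \<sigma>: "0 < \<sigma>" and \<alpha>: "0 < \<alpha>"
  shows "\<sigma> \<le> A powr (1 / (2 * \<alpha>)) * Q powr (- 1 / (2 * \<alpha>))"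
proof -
  have "Q * \<sigma> powr (2 * \<alpha>) \<le> A * \<sigma> powr (- 2 * \<alpha>) * \<sigma> powr (2 * \<alpha>)"
    using Q by (intro mult_right_mono) auto
  also have "\<dots> = A" using \<sigma> by (simp add: powr_add[symmetric])
  finally have "\<sigma> powr (2 * \<alpha>) \<le> A / Q" using Q by (simp add: pos_le_divide_eq mult.commute)
  then have "(\<sigma> powr (2 * \<alpha>)) powr (1 / (2 * \<alpha>)) \<le> (A / Q) powr (1 / (2 * \<alpha>))"
    using \<alpha> by (intro powr_mono2) auto
  also have "\<dots> = A powr (1 / (2 * \<alpha>)) * Q powr (- 1 / (2 * \<alpha>))"
  proof -
    have "Q powr (- 1 / (2 * \<alpha>)) = 1 / Q powr (1 / (2 * \<alpha>))"
      by (metis minus_divide_left powr_minus_divide)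
    then show ?thesis using Q A by (simp add: powr_divide)
  qed
  finally show ?thesis using \<sigma> \<alpha> by (simp add: powr_powr)
qed

lemma weighted_am_gm:
  fixes F L y \<sigma> b p :: real
  assumes "0 \<le> y" "0 < \<sigma>" "0 < b"
  shows "p * y * F * L \<le> b / 2 * (y * (1 + F\<^sup>2)) / \<sigma> + p\<^sup>2 / (2 * b) * (y * L\<^sup>2 * \<sigma>)"
proof -
  have "0 \<le> (b * F - p * \<sigma> * L)\<^sup>2" by simp
  then have "2 * b * \<sigma> * (p * F * L) \<le> b\<^sup>2 * F\<^sup>2 + p\<^sup>2 * \<sigma>\<^sup>2 * L\<^sup>2"
    by (simp add: power2_eq_square algebra_simps)
  also have "\<dots> \<le> b\<^sup>2 * (1 + F\<^sup>2) + p\<^sup>2 * \<sigma>\<^sup>2 * L\<^sup>2" by (simp add: algebra_simps)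
  finally have "p * F * L \<le> (b\<^sup>2 * (1 + F\<^sup>2) + p\<^sup>2 * \<sigma>\<^sup>2 * L\<^sup>2) / (2 * b * \<sigma>)"
    using assms by (simp add: pos_le_divide_eq mult.commute)
  also have "\<dots> = b / 2 * (1 + F\<^sup>2) / \<sigma> + p\<^sup>2 / (2 * b) * (L\<^sup>2 * \<sigma>)"
    using assms by (simp add: add_divide_distrib power2_eq_square)
  finally have "y * (p * F * L) \<le> y * (b / 2 * (1 + F\<^sup>2) / \<sigma> + p\<^sup>2 / (2 * b) * (L\<^sup>2 * \<sigma>))"
    using assms by (intro mult_left_mono)
  then show ?thesis by (simp add: algebra_simps)
qed

text \<open>
  The increment of \<open>Q powr (p/2)\<close> along a radius is bounded by the integral of \<open>D1 + D2\<close>.  The part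
  \<open>D1\<close> reproduces the means \<open>I s\<close> on smaller circles, together with the error coming from \<open>K0\<close>; the
  part \<open>D2\<close> is the Jacobian times a function of \<open>f\<close> and is an area.  The factor \<open>1/2\<close> in front of \<open>X\<close> is
  the point of the estimate: it allows \<open>X\<close> to be absorbed.  The constants are
  written out because they must not depend on \<open>h\<close> and \<open>g\<close>.
\<close>
lemma integral_mean_bootstrap:
  fixes h g :: "complex \<Rightarrow> complex" and \<alpha> B K K0 p :: real
  assumes h: "h holomorphic_on unit_disc" and g: "g holomorphic_on unit_disc"
    and inj: "inj_on (harmonic_map h g) unit_disc"
    and J: "\<And>z. z \<in> unit_disc \<Longrightarrow> 0 < jacobian h g z"
    and qr: "quasiregular K K0 h g" and K: "0 \<le> K" "0 \<le> K0"
    and \<alpha>: "0 < \<alpha>" and p: "0 < p" "1 < \<alpha> * p" and B: "1 \<le> B"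
    and growth: "\<And>z. z \<in> unit_disc \<Longrightarrow> cmod (harmonic_map h g z) \<le> B * (1 - cmod z) powr (- \<alpha>)"
  defines "b \<equiv> \<alpha> * p - 1" and "q \<equiv> p - 1 / \<alpha>" and "A \<equiv> 2 * B\<^sup>2"
  defines "c1 \<equiv> A powr (1 / (2 * \<alpha>))"
  defines "c2 \<equiv> p\<^sup>2 / b * c1 * K" and "c3 \<equiv> p\<^sup>2 / b * c1 * K0 * A powr (q / 2)"
  defines "I \<equiv> \<lambda>s. integral {0..2*pi} (\<lambda>t. (1 + (cmod (harmonic_map h g (of_real s * cis t)))\<^sup>2) powr (p / 2))"
  assumes r: "1 / 2 < r" "r < 1" and X: "\<And>s. 1 / 2 \<le> s \<Longrightarrow> s \<le> r \<Longrightarrow> I s \<le> X * (1 - s) powr (- b)"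
  shows "I r \<le> I (1/2) + (X / 2 + 2 * pi * c3 / b + c2 * (2 * pi / q) * A powr (q / 2)) * (1 - r) powr (- b)"
proof -
  define f where "f = harmonic_map h g"
  define Q where "Q z = 1 + (cmod (f z))\<^sup>2" for z
  define e where "e = (q - 2) / 2"
  have b: "0 < b" using p by (simp add: b_def)
  have q: "0 < q" using p \<alpha> by (simp add: q_def field_simps)
  have \<alpha>q: "\<alpha> * q = b" using \<alpha> by (simp add: q_def b_def algebra_simps)
  have A: "1 \<le> A" "0 < A" using one_le_power[OF B, of 2] unfolding A_def by linarith+
  have c1: "0 \<le> c1" by (simp add: c1_def)
  have c2: "0 \<le> c2" using b c1 K by (simp add: c2_def)
  have c3: "0 \<le> c3" using b c1 K by (simp add: c3_def)
  have Qpos: "0 < Q z" "1 \<le> Q z" for z by (auto simp: Q_def add_pos_nonneg)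
  have Qb: "Q z \<le> A * (1 - cmod z) powr (- 2 * \<alpha>)" if "z \<in> unit_disc" for z
    unfolding Q_def A_def using growth[OF that] that B \<alpha>
    by (intro growth_square_bound) (auto simp: f_def)
  have contf: "continuous_on unit_disc f" unfolding f_def by (rule continuous_on_harmonic_map[OF h g])
  have contQ: "continuous_on unit_disc Q" unfolding Q_def by (intro continuous_intros contf)
  have contQp: "continuous_on unit_disc (\<lambda>z. Q z powr a)" for a
    using Qpos by (intro continuous_on_powr contQ continuous_on_const) (auto simp: less_imp_neq[symmetric])
  have contJ: "continuous_on unit_disc (jacobian h g)"
    unfolding jacobian_def using holomorphic_deriv[OF h] holomorphic_deriv[OF g]
    by (intro continuous_on_diff continuous_on_power continuous_on_norm holomorphic_on_imp_continuous_on) auto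
  have inD: "of_real s * cis t \<in> unit_disc" "cmod (of_real s * cis t) = s" if "0 \<le> s" "s < 1" for s t
    using that by (auto simp: norm_mult)
  define D1 where "D1 s t = b / 2 * Q (of_real s * cis t) powr (p / 2) / (1 - s) + c3 * (1 - s) powr (- b)" for s t
  define D2 where "D2 s t = c2 * (s * (jacobian h g (of_real s * cis t) * Q (of_real s * cis t) powr e))" for s t
  have D1nn: "0 \<le> D1 s t" if "s < 1" for s t using that b c3 by (simp add: D1_def)
  have D2nn: "0 \<le> D2 s t" if "0 \<le> s" "s < 1" for s t
    using that c2 J[OF inD(1)[OF that]] by (simp add: D2_def less_imp_le)
  have contpol: "continuous_on T (\<lambda>x. H (of_real (fst x) * cis (snd x)))"
    if "continuous_on unit_disc H" "T \<subseteq> {0..<1} \<times> UNIV" for H :: "complex \<Rightarrow> real" and T :: "(real \<times> real) set"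
  proof (rule continuous_on_compose2[OF that(1)])
    show "continuous_on T (\<lambda>x. of_real (fst x) * cis (snd x))" by (intro continuous_intros)
  qed (use that(2) inD in auto)
  have contD1: "continuous_on T (\<lambda>x. D1 (fst x) (snd x))" if "T \<subseteq> {0..<1} \<times> UNIV" for T :: "(real \<times> real) set"
    unfolding D1_def
    using that by (intro continuous_on_add continuous_on_mult continuous_on_divide continuous_on_const continuous_on_powr
        continuous_on_diff continuous_on_fst continuous_on_id contpol[OF contQp]) auto
  have contD2: "continuous_on T (\<lambda>x. D2 (fst x) (snd x))" if "T \<subseteq> {0..<1} \<times> UNIV" for T :: "(real \<times> real) set"
    unfolding D2_def
    by (intro continuous_on_mult continuous_on_const continuous_on_fst continuous_on_id
        contpol[OF contQp that] contpol[OF contJ that])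
  \<comment> \<open>the product of \<open>|F|\<close> and the stretch is split by \<open>weighted_am_gm\<close>; its parameter \<open>b\<close> is what produces the factor 1/2\<close>
  have radial: "ennreal (Q (of_real r * cis t) powr (p / 2)) \<le> ennreal (Q (of_real (1/2) * cis t) powr (p / 2))
      + (\<integral>\<^sup>+s. ennreal (indicator {1/2<..<r} s * (D1 s t + D2 s t)) \<partial>lborel)" for t
  proof -
    define F where "F s = f (0 + of_real s * cis t)" for s
    define F' where "F' s = deriv h (0 + of_real s * cis t) * cis t + cnj (deriv g (0 + of_real s * cis t) * cis t)" for s
    define v where "v s = Q (of_real s * cis t) powr (p / 2)" for s
    define v' where "v' s = p / 2 * Q (of_real s * cis t) powr (p / 2 - 1) * (2 * (F s \<bullet> F' s))" for s
    have vv: "(v has_vector_derivative v' s) (at s within S)" if s: "0 \<le> s" "s < 1" for s S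
    proof -
      have "(F has_vector_derivative F' s) (at s within S)"
        unfolding F_def F'_def f_def
        by (rule has_vector_derivative_harmonic_radius[OF open_ball h g]) (use inD[OF s] in simp)
      from DERIV_add[OF DERIV_const[of 1] cmod_square_has_derivative[OF this]]
      have 1: "((\<lambda>s. Q (of_real s * cis t)) has_real_derivative 2 * (F s \<bullet> F' s)) (at s within S)"
        by (simp add: Q_def F_def)
      have 2: "((\<lambda>y. y powr (p / 2)) has_real_derivative p / 2 * Q (of_real s * cis t) powr (p / 2 - 1)) (at (Q (of_real s * cis t)))"
        by (rule has_real_derivative_powr[OF Qpos(1)])
      show ?thesis
        unfolding v_def[abs_def] v'_def has_real_derivative_iff_has_vector_derivative[symmetric]
        by (rule DERIV_chain2[OF 2 1])
    qed
    have bnd: "\<bar>v' s\<bar> \<le> D1 s t + D2 s t" if s: "s \<in> {1/2..r}" for s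
    proof -
      have s': "0 \<le> s" "s < 1" "1 / 2 \<le> s" using s r by auto
      let ?z = "of_real s * cis t"
      define L y \<sigma> where "L = max_stretch h g ?z" and "y = Q ?z powr (p / 2 - 1)" and "\<sigma> = 1 - s"
      note z = inD[OF s'(1,2), of t]
      have Lnn: "0 \<le> L" by (simp add: L_def max_stretch_nonneg)
      have y: "0 \<le> y" by (simp add: y_def)
      have \<sigma>: "0 < \<sigma>" "\<sigma> \<le> 1" using s' by (auto simp: \<sigma>_def)
      have F'L: "cmod (F' s) \<le> L"
      proof -
        have "cmod (F' s) \<le> cmod (deriv h ?z * cis t) + cmod (cnj (deriv g ?z * cis t))"
          unfolding F'_def by (metis add_0 norm_triangle_ineq)
        then show ?thesis by (simp add: L_def max_stretch_def norm_mult)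
      qed
      have "\<bar>F s \<bullet> F' s\<bar> \<le> cmod (F s) * cmod (F' s)" by (rule Cauchy_Schwarz_ineq2)
      also have "\<dots> \<le> cmod (F s) * L" by (intro mult_left_mono F'L) auto
      finally have "p * y * \<bar>F s \<bullet> F' s\<bar> \<le> p * y * (cmod (F s) * L)"
        using p y by (intro mult_left_mono) auto
      then have "\<bar>v' s\<bar> \<le> p * y * cmod (F s) * L"
      proof -
        have "v' s = p * y * (F s \<bullet> F' s)" by (simp add: v'_def y_def)
        then have "\<bar>v' s\<bar> = p * y * \<bar>F s \<bullet> F' s\<bar>" using p y by (simp add: abs_mult)
        with \<open>p * y * \<bar>F s \<bullet> F' s\<bar> \<le> p * y * (cmod (F s) * L)\<close> show ?thesis by (simp add: mult.assoc)
      qed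
      also have "\<dots> \<le> b / 2 * (y * (1 + (cmod (F s))\<^sup>2)) / \<sigma> + p\<^sup>2 / (2 * b) * (y * L\<^sup>2 * \<sigma>)"
        by (rule weighted_am_gm[OF y \<sigma>(1) b])
      also have "y * (1 + (cmod (F s))\<^sup>2) = Q ?z powr (p / 2)"
      proof -
        have FQ: "1 + (cmod (F s))\<^sup>2 = Q ?z" by (simp add: Q_def F_def)
        have "Q ?z powr (p / 2) = Q ?z powr (p / 2 - 1) * Q ?z powr 1"
          unfolding powr_add[symmetric] by simp
        then show ?thesis unfolding FQ y_def using Qpos(1)[of ?z] by simp
      qed
      also have "p\<^sup>2 / (2 * b) * (y * L\<^sup>2 * \<sigma>) \<le> c3 * \<sigma> powr (- b) + D2 s t"
      proof -
        have sig: "\<sigma> \<le> c1 * Q ?z powr (- 1 / (2 * \<alpha>))"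
          unfolding c1_def using Qb[OF z(1)] z(2) Qpos(1) A \<sigma> \<alpha>
          by (intro distance_le_growth_powr) (auto simp: \<sigma>_def)
        have "y * \<sigma> \<le> y * (c1 * Q ?z powr (- 1 / (2 * \<alpha>)))" by (intro mult_left_mono sig y)
        also have "\<dots> = c1 * Q ?z powr e"
        proof -
          have "p / 2 - 1 + (- 1 / (2 * \<alpha>)) = e" by (simp add: e_def q_def diff_divide_distrib)
          then show ?thesis by (simp add: y_def powr_add[symmetric])
        qed
        finally have ys: "y * \<sigma> \<le> c1 * Q ?z powr e" .
        have "L\<^sup>2 \<le> K * jacobian h g ?z + K0"
          using qr z(1) by (simp add: quasiregular_def L_def)
        also have "\<dots> \<le> 2 * s * (K * jacobian h g ?z + K0)"
        proof -
          have "0 \<le> K * jacobian h g ?z + K0" using K J[OF z(1)] by (simp add: less_imp_le)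
          then have "1 * (K * jacobian h g ?z + K0) \<le> 2 * s * (K * jacobian h g ?z + K0)"
            using s' by (intro mult_right_mono) auto
          then show ?thesis by simp
        qed
        finally have L2: "L\<^sup>2 \<le> 2 * s * (K * jacobian h g ?z + K0)" .
        have "y * L\<^sup>2 * \<sigma> = (y * \<sigma>) * L\<^sup>2" by simp
        also have "\<dots> \<le> (c1 * Q ?z powr e) * (2 * s * (K * jacobian h g ?z + K0))"
          using y \<sigma> c1 by (intro mult_mono ys L2) auto
        finally have "p\<^sup>2 / (2 * b) * (y * L\<^sup>2 * \<sigma>)
            \<le> p\<^sup>2 / (2 * b) * ((c1 * Q ?z powr e) * (2 * s * (K * jacobian h g ?z + K0)))"
          using b by (intro mult_left_mono) auto
        also have "\<dots> = D2 s t + p\<^sup>2 / b * c1 * K0 * (s * Q ?z powr e)"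
          using b by (simp add: D2_def c2_def field_simps)
        finally have le: "p\<^sup>2 / (2 * b) * (y * L\<^sup>2 * \<sigma>) \<le> D2 s t + p\<^sup>2 / b * c1 * K0 * (s * Q ?z powr e)" .
        have e2: "- 2 * \<alpha> * (q / 2) = - b" using \<alpha>q by simp
        have "s * Q ?z powr e \<le> 1 * Q ?z powr (q / 2)"
          using s' Qpos(2)[of ?z] by (intro mult_mono powr_mono) (auto simp: e_def)
        also have "\<dots> \<le> (A * \<sigma> powr (- 2 * \<alpha>)) powr (q / 2)"
        proof -
          have "Q ?z \<le> A * \<sigma> powr (- 2 * \<alpha>)" using Qb[OF z(1)] unfolding z(2) \<sigma>_def .
          then show ?thesis using Qpos(1)[of ?z] q by (simp add: powr_mono2)
        qed
        also have "\<dots> = A powr (q / 2) * \<sigma> powr (- b)"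
        proof -
          have "(A * \<sigma> powr (- 2 * \<alpha>)) powr (q / 2) = A powr (q / 2) * (\<sigma> powr (- 2 * \<alpha>)) powr (q / 2)"
            by (rule powr_mult)
          then show ?thesis unfolding powr_powr e2 .
        qed
        finally have "p\<^sup>2 / b * c1 * K0 * (s * Q ?z powr e) \<le> p\<^sup>2 / b * c1 * K0 * (A powr (q / 2) * \<sigma> powr (- b))"
          using b c1 K by (intro mult_left_mono) auto
        with le show ?thesis by (simp add: c3_def mult.assoc)
      qed
      finally show ?thesis by (simp add: D1_def \<sigma>_def)
    qed
    have cB: "continuous_on {1/2..r} (\<lambda>s. D1 s t + D2 s t)"
    proof -
      have "continuous_on {1/2..r} (\<lambda>s. D1 (fst (s, t)) (snd (s, t)))"
        by (rule continuous_on_compose2[OF contD1[of "{1/2..r} \<times> {t}"]])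
           (use r in \<open>auto intro!: continuous_intros\<close>)
      moreover have "continuous_on {1/2..r} (\<lambda>s. D2 (fst (s, t)) (snd (s, t)))"
        by (rule continuous_on_compose2[OF contD2[of "{1/2..r} \<times> {t}"]])
           (use r in \<open>auto intro!: continuous_intros\<close>)
      ultimately show ?thesis by (simp add: continuous_on_add)
    qed
    have "ennreal (v r) \<le> ennreal (v (1/2) + \<bar>v r - v (1/2)\<bar>)" by (intro ennreal_leI) simp
    also have "\<dots> = ennreal (v (1/2)) + ennreal \<bar>v r - v (1/2)\<bar>" by (simp add: v_def ennreal_plus)
    also have "ennreal \<bar>v r - v (1/2)\<bar> \<le> (\<integral>\<^sup>+s. ennreal (indicator {1/2<..<r} s * (D1 s t + D2 s t)) \<partial>lborel)"
      by (rule increment_le_nn_integral[OF _ vv bnd cB]) (use r in auto)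
    finally show ?thesis by (simp add: v_def add_left_mono)
  qed
  have sub: "polar_box (1/2) r \<subseteq> {0..<1} \<times> UNIV" using r by auto
  have m1: "(\<lambda>x. ennreal (indicator (polar_box (1/2) r) x * D1 (fst x) (snd x))) \<in> borel_measurable borel"
    by (rule measurable_polar_box[OF contD1[OF sub]])
  have m2: "(\<lambda>x. ennreal (indicator (polar_box (1/2) r) x * D2 (fst x) (snd x))) \<in> borel_measurable borel"
    by (rule measurable_polar_box[OF contD2[OF sub]])
  have m12: "(\<lambda>x. ennreal (indicator (polar_box (1/2) r) x * (D1 (fst x) (snd x) + D2 (fst x) (snd x)))) \<in> borel_measurable borel"
    by (rule measurable_polar_box[OF continuous_on_add[OF contD1[OF sub] contD2[OF sub]]])
  have contcirc: "continuous_on T (\<lambda>t. Q (of_real s * cis t) powr a)" if "0 \<le> s" "s < 1" for s T a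
  proof (rule continuous_on_compose2[OF contQp])
    show "continuous_on T (\<lambda>t. of_real s * cis t)" by (intro continuous_intros)
  qed (use inD that in auto)
  have Ieq: "I s = integral {0..2*pi} (\<lambda>t. Q (of_real s * cis t) powr (p / 2))" for s
    by (simp add: I_def Q_def f_def)
  have Inn: "(\<integral>\<^sup>+t. ennreal (indicator {0<..<2*pi} t * Q (of_real s * cis t) powr (p / 2)) \<partial>lborel) = ennreal (I s)"
    if "0 \<le> s" "s < 1" for s
    unfolding Ieq by (rule nn_integral_Ioo_continuous[OF contcirc[OF that]]) simp
  have I0: "0 \<le> I s" for s unfolding Ieq by (cases "(\<lambda>t. Q (of_real s * cis t) powr (p / 2)) integrable_on {0..2*pi}") (auto intro: integral_nonneg simp: not_integrable_integral)
  have X0: "0 \<le> X"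
  proof -
    have "0 \<le> X * (1 - r) powr (- b)" using X[of r] I0[of r] r by simp
    then show ?thesis using r by (simp add: zero_le_mult_iff)
  qed
  \<comment> \<open>integrating \<open>(1 - s) powr (- b - 1)\<close> gives back the power \<open>- b\<close> with the factor \<open>1 / b\<close>, which turns \<open>b / 2 * X\<close> into \<open>X / 2\<close>\<close>
  have part1: "(\<integral>\<^sup>+x. ennreal (indicator (polar_box (1/2) r) x * D1 (fst x) (snd x)) \<partial>lborel)
     \<le> ennreal ((X / 2 + 2 * pi * c3 / b) * (1 - r) powr (- b))"
  proof -
    define k where "k = X / 2 + 2 * pi * c3 / b"
    have k: "0 \<le> k" using X0 b c3 by (simp add: k_def)
    have "(\<integral>\<^sup>+x. ennreal (indicator (polar_box (1/2) r) x * D1 (fst x) (snd x)) \<partial>lborel)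
      = (\<integral>\<^sup>+s. \<integral>\<^sup>+t. ennreal (indicator (polar_box (1/2) r) (s, t) * D1 s t) \<partial>lborel \<partial>lborel)"
      by (subst nn_integral_lborel_pair(1)[OF m1]) simp
    also have "\<dots> \<le> (\<integral>\<^sup>+s. ennreal (indicator {1/2<..<r} s * (k * b * (1 - s) powr (- b - 1))) \<partial>lborel)"
    proof (rule nn_integral_mono)
      fix s :: real
      show "(\<integral>\<^sup>+t. ennreal (indicator (polar_box (1/2) r) (s, t) * D1 s t) \<partial>lborel)
         \<le> ennreal (indicator {1/2<..<r} s * (k * b * (1 - s) powr (- b - 1)))"
      proof (cases "s \<in> {1/2<..<r}")
        case True
        then have s: "0 \<le> s" "s < 1" "1 / 2 \<le> s" "s \<le> r" using r by auto
        have "(\<integral>\<^sup>+t. ennreal (indicator (polar_box (1/2) r) (s, t) * D1 s t) \<partial>lborel)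
            = (\<integral>\<^sup>+t. ennreal (indicator {0<..<2*pi} t * D1 s t) \<partial>lborel)"
          using True by (intro nn_integral_cong) (auto simp: indicator_def)
        also have "\<dots> = ennreal (integral {0..2*pi} (D1 s))"
          using D1nn s unfolding D1_def
          by (intro nn_integral_Ioo_continuous continuous_on_add continuous_on_mult continuous_on_divide
              continuous_on_const contcirc) auto
        also have "integral {0..2*pi} (D1 s) = b / 2 * I s / (1 - s) + 2 * pi * (c3 * (1 - s) powr (- b))"
        proof -
          have i: "(\<lambda>t. Q (of_real s * cis t) powr (p / 2)) integrable_on {0..2*pi}"
            using contcirc s by (intro integrable_continuous_real) auto
          have "((\<lambda>t. b / 2 / (1 - s) * Q (of_real s * cis t) powr (p / 2) + c3 * (1 - s) powr (- b)) has_integral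
              (b / 2 / (1 - s) * I s + (2 * pi - 0) *\<^sub>R (c3 * (1 - s) powr (- b)))) {0..2*pi}"
            unfolding Ieq using i
            by (intro has_integral_add has_integral_mult_right integrable_integral)
               (use has_integral_const_real[of "c3 * (1 - s) powr (- b)" 0 "2*pi"] in auto)
          then show ?thesis unfolding D1_def by (intro integral_unique) (simp add: mult_ac)
        qed
        also have "\<dots> \<le> k * b * (1 - s) powr (- b - 1)"
        proof -
          have e1: "(1 - s) powr (- b) / (1 - s) = (1 - s) powr (- b - 1)"
            using s by (simp add: powr_diff)
          have "b / 2 * I s / (1 - s) \<le> b / 2 * (X * (1 - s) powr (- b)) / (1 - s)"
            using X[OF s(3,4)] s b by (intro divide_right_mono mult_left_mono) auto
          also have "\<dots> = b / 2 * X * (1 - s) powr (- b - 1)" by (simp add: e1[symmetric])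
          finally have t1: "b / 2 * I s / (1 - s) \<le> b / 2 * X * (1 - s) powr (- b - 1)" .
          have "(1 - s) powr (- b) \<le> (1 - s) powr (- b - 1)"
            using s by (intro powr_mono') auto
          then have "2 * pi * c3 * (1 - s) powr (- b) \<le> 2 * pi * c3 * (1 - s) powr (- b - 1)"
            using c3 by (intro mult_left_mono) auto
          with t1 have "b / 2 * I s / (1 - s) + 2 * pi * (c3 * (1 - s) powr (- b))
            \<le> (b / 2 * X + 2 * pi * c3) * (1 - s) powr (- b - 1)"
            unfolding distrib_right mult.assoc by linarith
          also have "b / 2 * X + 2 * pi * c3 = k * b" using b by (simp add: k_def field_simps)
          finally show ?thesis .
        qed
        finally show ?thesis using True by (simp add: ennreal_leI)
      next
        case False
        then have "indicator (polar_box (1/2) r) (s, t) = (0::real)" for t by (auto simp: indicator_def)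
        then show ?thesis by simp
      qed
    qed
    also have "\<dots> = ennreal (k * (1 - r) powr (- b) - k * (1 - 1/2) powr (- b))"
    proof (rule nn_integral_Ioo_derivative)
      show "((\<lambda>s. k * (1 - s) powr (- b)) has_real_derivative k * b * (1 - s) powr (- b - 1)) (at s within {1/2..r})"
        if "s \<in> {1/2..r}" for s
        using that r by (auto intro!: derivative_eq_intros)
    qed (use r k b in auto)
    also have "\<dots> \<le> ennreal (k * (1 - r) powr (- b))" using k by (intro ennreal_leI) simp
    finally show ?thesis by (simp add: k_def)
  qed
  \<comment> \<open>on \<open>|z| < r\<close> the values of \<open>f\<close> stay in the disc of radius \<open>B * (1 - r) powr (- \<alpha>)\<close>\<close>
  have part2: "(\<integral>\<^sup>+x. ennreal (indicator (polar_box (1/2) r) x * D2 (fst x) (snd x)) \<partial>lborel)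
     \<le> ennreal (c2 * (2 * pi / q) * A powr (q / 2) * (1 - r) powr (- b))"
  proof -
    \<comment> \<open>the radius is not attained, since \<open>|z| < r\<close> is strict\<close>
    define R where "R = B * (1 - r) powr (- \<alpha>)"
    have R: "0 < R" using B r by (simp add: R_def)
    have ann: "annulus 0 (1/2) r \<subseteq> unit_disc" using r by auto
    have img: "f ` annulus 0 (1/2) r \<subseteq> ball 0 R"
    proof clarify
      fix z assume z: "1 / 2 < cmod (z - 0)" "cmod (z - 0) < r"
      have "cmod (f z) \<le> B * (1 - cmod z) powr (- \<alpha>)" unfolding f_def by (rule growth) (use z r in simp)
      also have "\<dots> < R"
        unfolding R_def using B z r \<alpha> by (intro mult_strict_left_mono powr_less_mono2_neg) auto
      finally show "f z \<in> ball 0 R" by simp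
    qed
    have wa: "(\<integral>\<^sup>+x. ennreal (indicator (polar_box (1/2) r) x * (fst x * \<bar>jacobian h g (polar 0 x)\<bar>
             * (1 + (cmod (harmonic_map h g (polar 0 x)))\<^sup>2) powr e)) \<partial>lborel)
       \<le> ennreal (pi * ((1 + R\<^sup>2) powr (e + 1) - 1) / (e + 1))"
      using h g inj ann R img q
      by (intro harmonic_weighted_area_le) (auto intro: holomorphic_on_subset inj_on_subset simp: f_def e_def)
    have "(\<integral>\<^sup>+x. ennreal (indicator (polar_box (1/2) r) x * D2 (fst x) (snd x)) \<partial>lborel)
      = (\<integral>\<^sup>+x. ennreal c2 * ennreal (indicator (polar_box (1/2) r) x * (fst x * \<bar>jacobian h g (polar 0 x)\<bar>
             * (1 + (cmod (harmonic_map h g (polar 0 x)))\<^sup>2) powr e)) \<partial>lborel)"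
    proof (rule nn_integral_cong)
      fix x :: "real \<times> real"
      have "0 < jacobian h g (polar 0 x)" if "x \<in> polar_box (1/2) r"
        using J[of "polar 0 x"] inD(1)[of "fst x" "snd x"] that r by auto
      then show "ennreal (indicator (polar_box (1/2) r) x * D2 (fst x) (snd x))
        = ennreal c2 * ennreal (indicator (polar_box (1/2) r) x * (fst x * \<bar>jacobian h g (polar 0 x)\<bar>
             * (1 + (cmod (harmonic_map h g (polar 0 x)))\<^sup>2) powr e))"
        using c2 by (cases "x \<in> polar_box (1/2) r")
          (simp_all add: D2_def Q_def f_def ennreal_mult'[symmetric] mult_ac)
    qed
    also have "\<dots> = ennreal c2 * (\<integral>\<^sup>+x. ennreal (indicator (polar_box (1/2) r) x * (fst x * \<bar>jacobian h g (polar 0 x)\<bar>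
             * (1 + (cmod (harmonic_map h g (polar 0 x)))\<^sup>2) powr e)) \<partial>lborel)"
    proof (rule nn_integral_cmult)
      have "(\<lambda>x. ennreal (indicator (polar_box (1/2) r) x * (fst x * \<bar>jacobian h g (of_real (fst x) * cis (snd x))\<bar>
             * Q (of_real (fst x) * cis (snd x)) powr e))) \<in> borel_measurable borel"
        by (intro measurable_polar_box continuous_on_mult continuous_on_fst continuous_on_id
            contpol[OF contQp sub] contpol[OF continuous_on_rabs[OF contJ] sub])
      then show "(\<lambda>x. ennreal (indicator (polar_box (1/2) r) x * (fst x * \<bar>jacobian h g (polar 0 x)\<bar>
             * (1 + (cmod (harmonic_map h g (polar 0 x)))\<^sup>2) powr e))) \<in> borel_measurable lborel"
        by (simp add: Q_def f_def)
    qed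
    also have "\<dots> \<le> ennreal c2 * ennreal (pi * ((1 + R\<^sup>2) powr (e + 1) - 1) / (e + 1))"
      by (intro mult_left_mono wa) simp
    also have "\<dots> = ennreal (c2 * (pi * ((1 + R\<^sup>2) powr (e + 1) - 1) / (e + 1)))"
      using c2 by (rule ennreal_mult'[symmetric])
    also have "\<dots> \<le> ennreal (c2 * (2 * pi / q) * A powr (q / 2) * (1 - r) powr (- b))"
    proof (rule ennreal_leI)
      have e1: "e + 1 = q / 2" by (simp add: e_def field_simps)
      have "1 + R\<^sup>2 \<le> A * (1 - r) powr (- 2 * \<alpha>)"
        unfolding A_def R_def using B r \<alpha> by (intro growth_square_bound) auto
      then have "(1 + R\<^sup>2) powr (q / 2) \<le> (A * (1 - r) powr (- 2 * \<alpha>)) powr (q / 2)"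
        using q by (intro powr_mono2) auto
      also have "\<dots> = A powr (q / 2) * (1 - r) powr (- b)"
      proof -
        have e2: "- 2 * \<alpha> * (q / 2) = - b" using \<alpha>q by simp
        have "(A * (1 - r) powr (- 2 * \<alpha>)) powr (q / 2) = A powr (q / 2) * ((1 - r) powr (- 2 * \<alpha>)) powr (q / 2)"
          by (rule powr_mult)
        then show ?thesis unfolding powr_powr e2 .
      qed
      finally have le: "(1 + R\<^sup>2) powr (q / 2) - 1 \<le> A powr (q / 2) * (1 - r) powr (- b)" by simp
      have "pi * ((1 + R\<^sup>2) powr (e + 1) - 1) / (e + 1) = (2 * pi / q) * ((1 + R\<^sup>2) powr (q / 2) - 1)"
        unfolding e1 by simp
      also have "\<dots> \<le> (2 * pi / q) * (A powr (q / 2) * (1 - r) powr (- b))"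
        using q by (intro mult_left_mono le) auto
      finally show "c2 * (pi * ((1 + R\<^sup>2) powr (e + 1) - 1) / (e + 1)) \<le> c2 * (2 * pi / q) * A powr (q / 2) * (1 - r) powr (- b)"
        using c2 mult_left_mono by (fastforce simp: mult.assoc)
    qed
    finally show ?thesis .
  qed
  have meas1: "(\<lambda>t. ennreal (indicator {0<..<2*pi} t * Q (of_real (1/2) * cis t) powr (p / 2))) \<in> borel_measurable lborel"
  proof -
    have "(\<lambda>t. indicator {0<..<2*pi} t *\<^sub>R Q (of_real (1/2) * cis t) powr (p / 2)) \<in> borel_measurable borel"
      by (intro borel_measurable_continuous_on_indicator contcirc) auto
    then show ?thesis by simp
  qed
  have m12': "(\<lambda>x. ennreal (indicator (polar_box (1/2) r) x * (D1 (fst x) (snd x) + D2 (fst x) (snd x))))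
      \<in> borel_measurable (lborel \<Otimes>\<^sub>M lborel)"
    using m12 by (simp add: lborel_prod)
  have msnd: "(\<lambda>t. \<integral>\<^sup>+s. ennreal (indicator (polar_box (1/2) r) (s, t) * (D1 s t + D2 s t)) \<partial>lborel) \<in> borel_measurable lborel"
  proof -
    have "(\<lambda>(t, s). ennreal (indicator (polar_box (1/2) r) (s, t) * (D1 s t + D2 s t))) \<in> borel_measurable (lborel \<Otimes>\<^sub>M lborel)"
      using measurable_compose[OF measurable_pair_swap' m12']
      by (simp add: split_beta)
    then show ?thesis by (rule lborel.borel_measurable_nn_integral)
  qed
  have "ennreal (I r) = (\<integral>\<^sup>+t. ennreal (indicator {0<..<2*pi} t * Q (of_real r * cis t) powr (p / 2)) \<partial>lborel)"
    using Inn[of r] r by simp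
  also have "\<dots> \<le> (\<integral>\<^sup>+t. ennreal (indicator {0<..<2*pi} t * Q (of_real (1/2) * cis t) powr (p / 2))
      + (\<integral>\<^sup>+s. ennreal (indicator (polar_box (1/2) r) (s, t) * (D1 s t + D2 s t)) \<partial>lborel) \<partial>lborel)"
  proof (rule nn_integral_mono)
    fix t
    show "ennreal (indicator {0<..<2*pi} t * Q (of_real r * cis t) powr (p / 2))
      \<le> ennreal (indicator {0<..<2*pi} t * Q (of_real (1/2) * cis t) powr (p / 2))
      + (\<integral>\<^sup>+s. ennreal (indicator (polar_box (1/2) r) (s, t) * (D1 s t + D2 s t)) \<partial>lborel)"
    proof (cases "t \<in> {0<..<2*pi}")
      case True
      then have "indicator (polar_box (1/2) r) (s, t) = (indicator {1/2<..<r} s :: real)" for s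
        by (auto simp: indicator_def)
      then show ?thesis using True radial[of t] by simp
    qed simp
  qed
  also have "\<dots> = (\<integral>\<^sup>+t. ennreal (indicator {0<..<2*pi} t * Q (of_real (1/2) * cis t) powr (p / 2)) \<partial>lborel)
      + (\<integral>\<^sup>+t. \<integral>\<^sup>+s. ennreal (indicator (polar_box (1/2) r) (s, t) * (D1 s t + D2 s t)) \<partial>lborel \<partial>lborel)"
    by (rule nn_integral_add[OF meas1 msnd])
  also have "(\<integral>\<^sup>+t. ennreal (indicator {0<..<2*pi} t * Q (of_real (1/2) * cis t) powr (p / 2)) \<partial>lborel) = ennreal (I (1/2))"
    using Inn[of "1/2"] by simp
  also have "(\<integral>\<^sup>+t. \<integral>\<^sup>+s. ennreal (indicator (polar_box (1/2) r) (s, t) * (D1 s t + D2 s t)) \<partial>lborel \<partial>lborel)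
     = (\<integral>\<^sup>+x. ennreal (indicator (polar_box (1/2) r) x * (D1 (fst x) (snd x) + D2 (fst x) (snd x))) \<partial>lborel)"
    by (subst nn_integral_lborel_pair(2)[OF m12]) simp
  also have "\<dots> = (\<integral>\<^sup>+x. ennreal (indicator (polar_box (1/2) r) x * D1 (fst x) (snd x))
      + ennreal (indicator (polar_box (1/2) r) x * D2 (fst x) (snd x)) \<partial>lborel)"
  proof (rule nn_integral_cong)
    fix x :: "real \<times> real"
    show "ennreal (indicator (polar_box (1/2) r) x * (D1 (fst x) (snd x) + D2 (fst x) (snd x)))
      = ennreal (indicator (polar_box (1/2) r) x * D1 (fst x) (snd x))
      + ennreal (indicator (polar_box (1/2) r) x * D2 (fst x) (snd x))"
    proof (cases "x \<in> polar_box (1/2) r")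
      case True
      then have "0 \<le> fst x" "fst x < 1" using r by auto
      then show ?thesis using True D1nn[of "fst x" "snd x"] D2nn[of "fst x" "snd x"] by (simp add: ennreal_plus)
    qed simp
  qed
  also have "\<dots> = (\<integral>\<^sup>+x. ennreal (indicator (polar_box (1/2) r) x * D1 (fst x) (snd x)) \<partial>lborel)
      + (\<integral>\<^sup>+x. ennreal (indicator (polar_box (1/2) r) x * D2 (fst x) (snd x)) \<partial>lborel)"
    using m1 m2 by (intro nn_integral_add) simp_all
  also have "ennreal (I (1/2)) + \<dots> \<le> ennreal (I (1/2)) +
      (ennreal ((X / 2 + 2 * pi * c3 / b) * (1 - r) powr (- b)) + ennreal (c2 * (2 * pi / q) * A powr (q / 2) * (1 - r) powr (- b)))"
    by (intro add_left_mono add_mono part1 part2)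
  also have "\<dots> = ennreal (I (1/2) + ((X / 2 + 2 * pi * c3 / b) * (1 - r) powr (- b) + c2 * (2 * pi / q) * A powr (q / 2) * (1 - r) powr (- b)))"
    using I0[of "1/2"] X0 b c2 c3 q by (subst ennreal_plus[symmetric], simp, simp)+ simp
  finally have "I r \<le> I (1/2) + ((X / 2 + 2 * pi * c3 / b) * (1 - r) powr (- b) + c2 * (2 * pi / q) * A powr (q / 2) * (1 - r) powr (- b))"
    using I0[of "1/2"] X0 b c2 c3 q by (subst (asm) ennreal_le_iff) (auto intro!: add_nonneg_nonneg)
  then show ?thesis by (simp add: algebra_simps)
qed

text \<open>
  Let \<open>X\<close> be the supremum of \<open>I s * (1 - s) powr b\<close> over \<open>1/2 \<le> s \<le> r\<close>, which is finite by the
  growth bound.  The preceding estimate gives \<open>X \<le> C5 + X / 2 + C6\<close>, so \<open>X\<close> is at most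
  \<open>2 * (C5 + C6)\<close>, a number independent of \<open>r\<close> and of the map.
\<close>
lemma circle_mean_bound:
  fixes \<alpha> B K K0 p :: real
  assumes K: "0 \<le> K" "0 \<le> K0" and \<alpha>: "0 < \<alpha>" and p: "0 < p" "1 < \<alpha> * p" and B: "1 \<le> B"
  shows "\<exists>C. 0 \<le> C \<and> (\<forall>h g. (h, g) \<in> S_H \<longrightarrow> quasiregular K K0 h g \<longrightarrow>
     (\<forall>z\<in>unit_disc. cmod (harmonic_map h g z) \<le> B * (1 - cmod z) powr (- \<alpha>)) \<longrightarrow>
     (\<forall>r\<in>{1/2..<1}. integral {0..2*pi} (\<lambda>t. cmod (harmonic_map h g (of_real r * cis t)) powr p)
        \<le> C * (1 - r) powr (- (\<alpha> * p - 1))))"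
proof -
  define b q A where "b = \<alpha> * p - 1" and "q = p - 1 / \<alpha>" and "A = 2 * B\<^sup>2"
  define c1 where "c1 = A powr (1 / (2 * \<alpha>))"
  define c2 c3 where "c2 = p\<^sup>2 / b * c1 * K" and "c3 = p\<^sup>2 / b * c1 * K0 * A powr (q / 2)"
  define C5 where "C5 = 2 * pi * (A * (1/2) powr (- 2 * \<alpha>)) powr (p / 2)"
  define C6 where "C6 = 2 * pi * c3 / b + c2 * (2 * pi / q) * A powr (q / 2)"
  define C where "C = 2 * (C5 + C6)"
  have b: "0 < b" using p by (simp add: b_def)
  have q: "0 < q" using p \<alpha> by (simp add: q_def field_simps)
  have A: "1 \<le> A" using one_le_power[OF B, of 2] unfolding A_def by linarith
  have c: "0 \<le> c1" "0 \<le> c2" "0 \<le> c3" using b K by (auto simp: c1_def c2_def c3_def)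
  have C5: "0 \<le> C5" by (simp add: C5_def)
  have C6: "0 \<le> C6" using b q c by (simp add: C6_def)
  have main: "integral {0..2*pi} (\<lambda>t. cmod (harmonic_map h g (of_real r * cis t)) powr p) \<le> C * (1 - r) powr (- b)"
    if S: "(h, g) \<in> S_H" and qr: "quasiregular K K0 h g"
      and growth: "\<And>z. z \<in> unit_disc \<Longrightarrow> cmod (harmonic_map h g z) \<le> B * (1 - cmod z) powr (- \<alpha>)"
      and r: "1 / 2 \<le> r" "r < 1" for h g r
  proof -
    note D = S_H_D[OF S]
    define Q where "Q z = 1 + (cmod (harmonic_map h g z))\<^sup>2" for z
    define I where "I s = integral {0..2*pi} (\<lambda>t. Q (of_real s * cis t) powr (p / 2))" for s
    have Qpos: "0 < Q z" "1 \<le> Q z" for z by (auto simp: Q_def add_pos_nonneg)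
    have contf: "continuous_on T (\<lambda>t. harmonic_map h g (of_real s * cis t))" if "0 \<le> s" "s < 1" for s T
    proof (rule continuous_on_compose2[OF continuous_on_harmonic_map[OF D(1,2)]])
      show "continuous_on T (\<lambda>t. of_real s * cis t)" by (intro continuous_intros)
    qed (use that in \<open>auto simp: norm_mult\<close>)
    have contQ: "continuous_on T (\<lambda>t. Q (of_real s * cis t) powr (p / 2))" if "0 \<le> s" "s < 1" for s T
      using Qpos(1) unfolding Q_def
      by (intro continuous_on_powr continuous_on_add continuous_on_power continuous_on_norm continuous_on_const contf that)
         (simp add: less_imp_neq[symmetric])
    have I0: "0 \<le> I s" if "0 \<le> s" "s < 1" for s
      unfolding I_def using contQ[OF that] by (intro integral_nonneg integrable_continuous_real) auto
    have Ib: "I s \<le> 2 * pi * (A * (1 - s) powr (- 2 * \<alpha>)) powr (p / 2)" if s: "0 \<le> s" "s < 1" for s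
    proof -
      have "I s \<le> integral {0..2*pi} (\<lambda>t. (A * (1 - s) powr (- 2 * \<alpha>)) powr (p / 2))"
        unfolding I_def
      proof (rule integral_le)
        show "(\<lambda>t. Q (of_real s * cis t) powr (p / 2)) integrable_on {0..2*pi}"
          by (intro integrable_continuous_real contQ s)
        show "Q (of_real s * cis t) powr (p / 2) \<le> (A * (1 - s) powr (- 2 * \<alpha>)) powr (p / 2)" for t
        proof -
          have n: "cmod (of_real s * cis t) = s" using s by (simp add: norm_mult)
          have "Q (of_real s * cis t) \<le> A * (1 - s) powr (- 2 * \<alpha>)"
            unfolding Q_def A_def using growth[of "of_real s * cis t"] n s B \<alpha>
            by (intro growth_square_bound) auto
          then show ?thesis using Qpos(1)[of "of_real s * cis t"] p by (intro powr_mono2) auto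
        qed
      qed (intro integrable_continuous_real continuous_on_const)
      then show ?thesis by simp
    qed
    \<comment> \<open>\<open>X\<close> depends on \<open>r\<close> and on the map, but the bound derived for it does not\<close>
    define T where "T = (\<lambda>s. I s * (1 - s) powr b) ` {1/2..r}"
    define X where "X = Sup T"
    have T0: "T \<noteq> {}" using r by (simp add: T_def)
    have "bdd_above T"
    proof (rule bdd_aboveI)
      fix x assume "x \<in> T"
      then obtain s where s: "1 / 2 \<le> s" "s \<le> r" "x = I s * (1 - s) powr b" by (auto simp: T_def)
      have "I s \<le> 2 * pi * (A * (1 - s) powr (- 2 * \<alpha>)) powr (p / 2)" using s r by (intro Ib) auto
      also have "\<dots> \<le> 2 * pi * (A * (1 - r) powr (- 2 * \<alpha>)) powr (p / 2)"
        using s r A \<alpha> p by (intro mult_left_mono powr_mono2 powr_mono2') auto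
      finally have "I s \<le> 2 * pi * (A * (1 - r) powr (- 2 * \<alpha>)) powr (p / 2)" .
      moreover have "(1 - s) powr b \<le> 1" using s r b by (intro powr_le1) auto
      ultimately have "I s * (1 - s) powr b \<le> 2 * pi * (A * (1 - r) powr (- 2 * \<alpha>)) powr (p / 2) * 1"
        using I0[of s] s r by (intro mult_mono) auto
      then show "x \<le> 2 * pi * (A * (1 - r) powr (- 2 * \<alpha>)) powr (p / 2)" using s by simp
    qed
    then have TX: "I s * (1 - s) powr b \<le> X" if "1 / 2 \<le> s" "s \<le> r" for s
      unfolding X_def using that by (intro cSup_upper) (auto simp: T_def)
    have IX: "I s \<le> X * (1 - s) powr (- b)" if "1 / 2 \<le> s" "s \<le> r" for s
      using TX[OF that] that r by (simp add: powr_minus field_simps)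
    have X0: "0 \<le> X" using TX[of "1/2"] I0[of "1/2"] r
      by (meson le_less_trans mult_nonneg_nonneg order_trans powr_ge_zero half_gt_zero_iff less_imp_le order_refl zero_less_one)
    have half: "I (1/2) \<le> C5" using Ib[of "1/2"] by (simp add: C5_def)
    have "X \<le> C5 + X / 2 + C6"
      unfolding X_def
    proof (rule cSup_least[OF T0], fold X_def)
      fix x assume "x \<in> T"
      then obtain s where s: "1 / 2 \<le> s" "s \<le> r" "x = I s * (1 - s) powr b" by (auto simp: T_def)
      have le1: "(1 - s) powr b \<le> 1" using s r b by (intro powr_le1) auto
      show "x \<le> C5 + X / 2 + C6"
      proof (cases "s = 1 / 2")
        case True
        have "I s * (1 - s) powr b \<le> C5 * 1"
          using half le1 I0[of "1/2"] C5 unfolding True by (intro mult_mono) simp_all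
        then show ?thesis using s X0 C6 by simp
      next
        case False
        then have s2: "1 / 2 < s" "s < 1" using s r by auto
        have "I s \<le> I (1/2) + (X / 2 + 2 * pi * c3 / b + c2 * (2 * pi / q) * A powr (q / 2)) * (1 - s) powr (- b)"
          unfolding I_def Q_def c2_def c3_def c1_def A_def b_def q_def
          by (rule integral_mean_bootstrap[OF D(1,2,4,3) qr K \<alpha> p B growth s2])
             (use IX s in \<open>auto simp: I_def Q_def b_def\<close>)
        also have "X / 2 + 2 * pi * c3 / b + c2 * (2 * pi / q) * A powr (q / 2) = X / 2 + C6" by (simp add: C6_def)
        finally have "I s * (1 - s) powr b \<le> (I (1/2) + (X / 2 + C6) * (1 - s) powr (- b)) * (1 - s) powr b"
          by (intro mult_right_mono) auto
        also have "\<dots> = I (1/2) * (1 - s) powr b + (X / 2 + C6)"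
          using s2 by (simp add: distrib_right mult.assoc powr_add[symmetric])
        also have "I (1/2) * (1 - s) powr b \<le> C5 * 1"
          using half le1 I0[of "1/2"] C5 by (intro mult_mono) auto
        finally show ?thesis using s by simp
      qed
    qed
    then have "X \<le> C" by (simp add: C_def)
    have "integral {0..2*pi} (\<lambda>t. cmod (harmonic_map h g (of_real r * cis t)) powr p) \<le> I r"
      unfolding I_def
    proof (rule integral_le)
      show "(\<lambda>t. cmod (harmonic_map h g (of_real r * cis t)) powr p) integrable_on {0..2*pi}"
        using p r by (intro integrable_continuous_real continuous_on_powr' continuous_on_norm continuous_on_const contf) auto
      show "(\<lambda>t. Q (of_real r * cis t) powr (p / 2)) integrable_on {0..2*pi}"
        using r by (intro integrable_continuous_real contQ) auto
      show "cmod (harmonic_map h g (of_real r * cis t)) powr p \<le> Q (of_real r * cis t) powr (p / 2)" for t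
      proof -
        define w where "w = cmod (harmonic_map h g (of_real r * cis t))"
        have "w powr p = (w powr 2) powr (p / 2)" by (simp add: powr_powr)
        also have "\<dots> \<le> (1 + w\<^sup>2) powr (p / 2)"
          using p by (intro powr_mono2) (auto simp: w_def)
        finally show ?thesis by (simp add: w_def Q_def)
      qed
    qed
    also have "\<dots> \<le> X * (1 - r) powr (- b)" using IX r by simp
    also have "\<dots> \<le> C * (1 - r) powr (- b)" using \<open>X \<le> C\<close> by (intro mult_right_mono) auto
    finally show ?thesis .
  qed
  show ?thesis
    using main C5 C6 by (intro exI[of _ C]) (auto simp: C_def b_def)
qed

lemma integral_mean_bigo:
  fixes \<alpha> C p :: real
  assumes p: "0 < p" and C: "0 \<le> C"
    and bound: "\<And>r. r \<in> {1/2..<1} \<Longrightarrow>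
      integral {0..2*pi} (\<lambda>t. cmod (f (of_real r * cis t)) powr p) \<le> C * (1 - r) powr (- (\<alpha> * p - 1))"
    and int: "\<And>r. r \<in> {1/2..<1} \<Longrightarrow> (\<lambda>t. cmod (f (of_real r * cis t)) powr p) integrable_on {0..2*pi}"
  shows "(\<lambda>r. integral_mean p r f) \<in> O[at_left 1](\<lambda>r. 1 / (1 - r) powr (\<alpha> - 1 / p))"
proof (rule bigoI)
  have "\<forall>\<^sub>F r in at_left 1. r \<in> {1/2<..<1::real}" by (rule eventually_at_left_real) simp
  then show "\<forall>\<^sub>F r in at_left 1. norm (integral_mean p r f) \<le> (C / (2 * pi)) powr (1 / p) * norm (1 / (1 - r) powr (\<alpha> - 1 / p))"
  proof eventually_elim
    case (elim r)
    then have r: "r \<in> {1/2..<1}" by simp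
    have "0 \<le> integral {0..2*pi} (\<lambda>t. cmod (f (of_real r * cis t)) powr p)"
      by (rule integral_nonneg[OF int[OF r]]) simp
    then have "integral_mean p r f \<le> (1 / (2 * pi) * (C * (1 - r) powr (- (\<alpha> * p - 1)))) powr (1 / p)"
      unfolding integral_mean_def using p bound[OF r] by (intro powr_mono2 mult_left_mono) auto
    also have "\<dots> = (C / (2 * pi) * (1 - r) powr (- (\<alpha> * p - 1))) powr (1 / p)" by simp
    also have "\<dots> = (C / (2 * pi)) powr (1 / p) * ((1 - r) powr (- (\<alpha> * p - 1))) powr (1 / p)"
      by (rule powr_mult)
    also have "((1 - r) powr (- (\<alpha> * p - 1))) powr (1 / p) = (1 - r) powr (- (\<alpha> - 1 / p))"
    proof -
      have "- (\<alpha> * p - 1) * (1 / p) = - (\<alpha> - 1 / p)" using p by (simp add: field_simps)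
      then show ?thesis unfolding powr_powr by simp
    qed
    also have "\<dots> = 1 / (1 - r) powr (\<alpha> - 1 / p)" by (rule powr_minus_divide)
    finally show ?case by (simp add: integral_mean_def)
  qed
qed

section \<open>Coefficients from means\<close>

lemma power_one_minus_inverse_ge:
  assumes "n \<ge> 2" shows "exp (-2) \<le> (1 - 1 / real n) ^ n"
proof -
  have n: "real n \<ge> 2" using assms by simp
  have "exp (1 / (real n - 1)) \<ge> 1 + 1 / (real n - 1)" by (rule exp_ge_add_one_self)
  then have "exp (- (1 / (real n - 1))) \<le> 1 / (1 + 1 / (real n - 1))"
    using n by (simp add: exp_minus inverse_eq_divide divide_left_mono add_pos_pos)
  also have "\<dots> = 1 - 1 / real n" using n by (simp add: field_simps)
  finally have "exp (- (1 / (real n - 1))) ^ n \<le> (1 - 1 / real n) ^ n" by (rule power_mono) simp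
  moreover have "exp (- (1 / (real n - 1))) ^ n = exp (- (real n / (real n - 1)))"
    by (simp flip: exp_of_nat_mult)
  moreover have "real n / (real n - 1) \<le> 2" using n by (simp add: field_simps)
  ultimately show ?thesis by (smt (verit) exp_le_cancel_iff)
qed

text \<open>
  The radius \<open>1 - 1/n\<close> balances the two factors: its \<open>n\<close>-th power stays away from \<open>0\<close>, and its
  distance to the boundary is \<open>1/n\<close>.
\<close>
lemma coefficient_bound_from_mean:
  fixes \<alpha> C :: real
  assumes h: "h holomorphic_on unit_disc" and g: "g holomorphic_on unit_disc"
    and bound: "\<And>r. r \<in> {1/2..<1} \<Longrightarrow>
      integral {0..2*pi} (\<lambda>t. cmod (harmonic_map h g (of_real r * cis t)) powr 1) \<le> C * (1 - r) powr (- (\<alpha> * 1 - 1))"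
    and C: "0 \<le> C" and n: "n \<ge> 2"
  shows "cmod ((deriv ^^ n) h 0 / fact n) \<le> C * exp 2 * real n powr (\<alpha> - 1)"
proof -
  define r where "r = 1 - 1 / real n"
  have r: "1 / 2 \<le> r" "r < 1" using n by (auto simp: r_def field_simps)
  define c where "c = cmod ((deriv ^^ n) h 0 / fact n)"
  have "exp (-2) * c \<le> r ^ n * c"
    unfolding r_def by (intro mult_right_mono power_one_minus_inverse_ge n) (simp add: c_def)
  also have "\<dots> \<le> 2 * pi * r ^ n * c"
  proof -
    have "1 * (r ^ n * c) \<le> 2 * pi * (r ^ n * c)"
      using r pi_gt3 by (intro mult_right_mono) (auto simp: c_def)
    then show ?thesis by (simp add: mult.assoc)
  qed
  also have "\<dots> \<le> integral {0..2*pi} (\<lambda>t. cmod (harmonic_map h g (0 + of_real r * cis t)))"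
    unfolding c_def by (rule harmonic_coefficient_le_mean[OF h g]) (use r n in auto)
  also have "\<dots> \<le> C * (1 - r) powr (- (\<alpha> - 1))" using bound[of r] r by simp
  also have "(1 - r) powr (- (\<alpha> - 1)) = real n powr (\<alpha> - 1)"
    using n by (simp add: r_def powr_divide powr_minus_divide[of _ "\<alpha> - 1"] del: minus_diff_eq)
  finally have "exp 2 * (exp (-2) * c) \<le> exp 2 * (C * real n powr (\<alpha> - 1))" by (intro mult_left_mono) auto
  moreover have "exp 2 * (exp (-2) * c) = c" by (simp add: exp_minus)
  ultimately have "c \<le> exp 2 * (C * real n powr (\<alpha> - 1))" by linarith
  then show ?thesis by (simp add: c_def mult_ac)
qed

lemma taylor_coefficient_of_sums:
  fixes h :: "complex \<Rightarrow> complex"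
  assumes "\<forall>z\<in>unit_disc. (\<lambda>n. a (n + 2) * z ^ (n + 2)) sums (h z - z)" and n: "n \<ge> 2"
  shows "a n = (deriv ^^ n) h 0 / fact n"
proof -
  define c where "c = (\<lambda>n. if n = 0 then 0 else if n = 1 then 1 else a n)"
  have "(\<lambda>n. fps_nth (Abs_fps c) n * z ^ n) sums h z" if "z \<in> unit_disc" for z
  proof -
    have "(\<lambda>n. c (n + 2) * z ^ (n + 2)) sums (h z - z)"
      using assms(1) that by (simp add: c_def)
    then have "(\<lambda>n. c n * z ^ n) sums (h z - z + (\<Sum>i<2. c i * z ^ i))"
      by (simp only: sums_iff_shift[symmetric])
    then show ?thesis by (simp add: c_def numeral_2_eq_2)
  qed
  moreover have "\<forall>\<^sub>F z in nhds 0. z \<in> unit_disc" by (rule eventually_nhds_in_open) auto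
  ultimately have "\<forall>\<^sub>F z in nhds 0. (\<lambda>n. fps_nth (Abs_fps c) n * z ^ n) sums h z"
    by (auto elim: eventually_mono)
  then have "h has_fps_expansion Abs_fps c" by (rule has_fps_expansionI)
  then have "fps_nth (Abs_fps c) n = (deriv ^^ n) h 0 / fact n" by (rule fps_nth_fps_expansion)
  then show ?thesis using n by (simp add: c_def)
qed

section \<open>Bieberbach's inequality\<close>

text \<open>
  On the circle of radius \<open>s\<close> the functions \<open>1 / z^2\<close>, the constant \<open>c\<close> and \<open>E\<close> have disjoint
  frequencies and are orthogonal; dropping the square of \<open>E\<close> leaves the lower bound.
\<close>
lemma area_circle_lower_bound:
  assumes E: "E holomorphic_on unit_disc" and E0: "E 0 = 0" and s: "0 < s" "s < 1"
  shows "2 * pi * (1 / s ^ 4 + (cmod c)\<^sup>2)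
    \<le> integral {0..2*pi} (\<lambda>t. (cmod (- 1 / (of_real s * cis t)\<^sup>2 + c + E (of_real s * cis t)))\<^sup>2)"
proof -
  define w where "w t = of_real s * cis t" for t
  have wD: "w t \<in> unit_disc" "w t \<noteq> 0" for t using s by (auto simp: w_def norm_mult)
  have contw: "continuous_on T w" for T unfolding w_def by (intro continuous_intros)
  have contE: "continuous_on T (\<lambda>t. E (w t))" for T
    by (rule continuous_on_compose2[OF holomorphic_on_imp_continuous_on[OF E] contw]) (use wD in auto)
  have i1: "((\<lambda>t. cis (2 * t)) has_integral 0) {0..2*pi}"
    using circle_fourier_holomorphic_negative[of "\<lambda>_. 1" 0 1 s 2] s by (simp add: holomorphic_on_const)
  have i2: "((\<lambda>t. E (w t) * cis (2 * t)) has_integral 0) {0..2*pi}"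
    using circle_fourier_holomorphic_negative[OF E s, of 2] by (simp add: w_def)
  have i3: "((\<lambda>t. E (w t)) has_integral 0) {0..2*pi}"
    using circle_fourier_holomorphic[OF E s, of 0] E0 by (simp add: w_def)
  define G where "G t = - (c / of_real (s\<^sup>2)) * cis (2 * t) - (1 / of_real (s\<^sup>2)) * (E (w t) * cis (2 * t)) + cnj c * E (w t)" for t
  have "(G has_integral (- (c / of_real (s\<^sup>2)) * 0 - (1 / of_real (s\<^sup>2)) * 0 + cnj c * 0)) {0..2*pi}"
    unfolding G_def
    by (rule has_integral_add[OF has_integral_diff[OF has_integral_mult_right[OF i1]
          has_integral_mult_right[OF i2]] has_integral_mult_right[OF i3]])
  from has_integral_linear[OF this bounded_linear_Re]
  have "((\<lambda>t. Re (G t)) has_integral 0) {0..2*pi}" by (simp add: o_def)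
  then have "((\<lambda>t. (1 / s ^ 4 + (cmod c)\<^sup>2) + 2 * Re (G t)) has_integral ((2 * pi - 0) *\<^sub>R (1 / s ^ 4 + (cmod c)\<^sup>2) + 2 * 0)) {0..2*pi}"
    by (intro has_integral_add has_integral_mult_right)
       (use has_integral_const_real[of "1 / s ^ 4 + (cmod c)\<^sup>2" 0 "2*pi"] in auto)
  then have low: "((\<lambda>t. (1 / s ^ 4 + (cmod c)\<^sup>2) + 2 * Re (G t)) has_integral (2 * pi * (1 / s ^ 4 + (cmod c)\<^sup>2))) {0..2*pi}"
    by simp
  have "integral {0..2*pi} (\<lambda>t. (1 / s ^ 4 + (cmod c)\<^sup>2) + 2 * Re (G t))
     \<le> integral {0..2*pi} (\<lambda>t. (cmod (- 1 / (w t)\<^sup>2 + c + E (w t)))\<^sup>2)"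
  proof (rule integral_le)
    show "(\<lambda>t. (1 / s ^ 4 + (cmod c)\<^sup>2) + 2 * Re (G t)) integrable_on {0..2*pi}"
      using low by (rule has_integral_integrable)
    show "(\<lambda>t. (cmod (- 1 / (w t)\<^sup>2 + c + E (w t)))\<^sup>2) integrable_on {0..2*pi}"
      using wD by (intro integrable_continuous_real continuous_on_power continuous_on_norm continuous_on_add
          continuous_on_divide continuous_on_const contw contE) auto
    show "(1 / s ^ 4 + (cmod c)\<^sup>2) + 2 * Re (G t) \<le> (cmod (- 1 / (w t)\<^sup>2 + c + E (w t)))\<^sup>2" for t
    proof -
      define a where "a = - 1 / (w t)\<^sup>2"
      define x where "x = E (w t)"
      have w2: "(w t)\<^sup>2 = of_real (s\<^sup>2) * cis (2 * t)"
        by (simp add: w_def power_mult_distrib Complex.DeMoivre)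
      have cj: "cnj (cis (2 * t)) * cis (2 * t) = 1" by (simp add: cis_cnj cis_mult)
      have cja: "cnj a = - (1 / of_real (s\<^sup>2)) * cis (2 * t)"
      proof -
        have "cnj a = - 1 / (of_real (s\<^sup>2) * cnj (cis (2 * t)))" by (simp add: a_def w2)
        also have "\<dots> = - 1 / (of_real (s\<^sup>2) * cnj (cis (2 * t))) * (cnj (cis (2 * t)) * cis (2 * t))"
          by (simp only: cj mult_1_right)
        also have "\<dots> = - (1 / of_real (s\<^sup>2)) * cis (2 * t)" using s by simp
        finally show ?thesis .
      qed
      have na: "(cmod a)\<^sup>2 = 1 / s ^ 4"
        using s by (simp add: a_def w2 norm_divide norm_mult norm_power power_divide)
      have expand: "(cmod (a + c + x))\<^sup>2 = (cmod a)\<^sup>2 + (cmod c)\<^sup>2 + (cmod x)\<^sup>2 + 2 * Re (cnj a * c + cnj a * x + cnj c * x)"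
        unfolding cmod_power2 by (simp add: power2_eq_square algebra_simps)
      have "G t = cnj a * c + cnj a * x + cnj c * x"
        unfolding G_def cja x_def by (simp add: algebra_simps)
      then show ?thesis
        using expand na zero_le_power2[of "cmod x"] unfolding a_def[symmetric] x_def[symmetric] by simp
    qed
  qed
  then show ?thesis using integral_unique[OF low] by (simp add: w_def)
qed

text \<open>
  The map \<open>G z = k (z^2) / z = 1 / z + c z + \<dots>\<close> has a simple pole.  It sends the circle of radius
  \<open>\<epsilon>\<close> to nearly an ellipse, and \<open>P = G - \<kappa> cnj G\<close>, with \<open>\<kappa> = c \<epsilon>^2\<close>, makes this ellipse round: on the
  circle \<open>\<kappa> cnj (1 / z) = c z\<close>, so \<open>|P| = 1 / \<epsilon> + O(\<epsilon>^3)\<close> there.  As \<open>P\<close> is injective, the annulus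
  between \<open>\<epsilon>\<close> and \<open>r\<close> is mapped inside a disc of that radius.  Comparing areas gives the
  inequality, whose left side is the Jacobian factor of the affine map times a lower bound for the
  area covered by \<open>G\<close>, divided by \<open>pi\<close>.
\<close>
lemma area_theorem_approx:
  fixes k m :: "complex \<Rightarrow> complex"
  assumes k: "k holomorphic_on unit_disc" and m: "m holomorphic_on unit_disc"
    and km: "\<And>z. z \<in> unit_disc \<Longrightarrow> k z = 1 + c * z + z\<^sup>2 * m z"
    and nz: "\<And>z. z \<in> unit_disc \<Longrightarrow> k z \<noteq> 0"
    and inj: "inj_on (\<lambda>z. k (z\<^sup>2) / z) (unit_disc - {0})"
    and M: "\<And>z. cmod z \<le> 1 / 4 \<Longrightarrow> cmod (m z) \<le> M"
    and eps: "0 < \<epsilon>" "\<epsilon> < r" "\<epsilon> \<le> 1 / 2" "cmod c * \<epsilon>\<^sup>2 < 1" and r: "r < 1"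
  shows "(1 - (cmod c * \<epsilon>\<^sup>2)\<^sup>2) * (1 / \<epsilon>\<^sup>2 - 1 / r\<^sup>2 + (cmod c)\<^sup>2 * (r\<^sup>2 - \<epsilon>\<^sup>2))
     \<le> (1 / \<epsilon> + (M + (cmod c)\<^sup>2 + cmod c * M + 1) * \<epsilon> ^ 3)\<^sup>2"
proof -
  define U where "U = unit_disc - {0}"
  define G where "G z = k (z\<^sup>2) / z" for z
  define \<kappa> where "\<kappa> = c * of_real (\<epsilon>\<^sup>2)"
  define g where "g z = - cnj \<kappa> * G z" for z
  define P where "P = harmonic_map G g"
  have P: "P z = G z - \<kappa> * cnj (G z)" for z by (simp add: P_def harmonic_map_def g_def)
  have \<kappa>1: "cmod \<kappa> < 1" using eps by (simp add: \<kappa>_def norm_mult norm_power)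
  have \<kappa>c: "cmod \<kappa> = cmod c * \<epsilon>\<^sup>2" by (simp add: \<kappa>_def norm_mult norm_power)
  have oU: "open U" unfolding U_def by (intro open_Diff) auto
  have sq: "z\<^sup>2 \<in> unit_disc" if "z \<in> unit_disc" for z :: complex
    using that by (simp add: norm_power power_less_one_iff abs_square_less_1)
  have k2: "(\<lambda>z. k (z\<^sup>2)) holomorphic_on unit_disc"
    using holomorphic_on_compose_gen[OF _ k, of "\<lambda>z. z\<^sup>2" unit_disc] sq
    by (force simp: o_def intro!: holomorphic_intros)
  have m2: "(\<lambda>z. m (z\<^sup>2)) holomorphic_on unit_disc"
    using holomorphic_on_compose_gen[OF _ m, of "\<lambda>z. z\<^sup>2" unit_disc] sq
    by (force simp: o_def intro!: holomorphic_intros)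
  have Ghol: "G holomorphic_on U"
    unfolding G_def[abs_def] U_def
    by (intro holomorphic_on_divide holomorphic_on_ident holomorphic_on_subset[OF k2]) auto
  have ghol: "g holomorphic_on U" unfolding g_def[abs_def] by (intro holomorphic_intros Ghol)
  have Gnz: "G z \<noteq> 0" if "z \<in> U" for z using that nz[OF sq, of z] by (simp add: G_def U_def)
  have Pinj: "inj_on P U"
  proof (rule inj_onI)
    fix x y assume xy: "x \<in> U" "y \<in> U" "P x = P y"
    define d where "d = G x - G y"
    have "d = \<kappa> * cnj d" using xy(3) by (simp add: P d_def algebra_simps)
    then have "cmod d = cmod \<kappa> * cmod d" by (metis complex_mod_cnj norm_mult)
    then have "d = 0" using \<kappa>1 by auto
    then have "G x = G y" by (simp add: d_def)
    then show "x = y" using inj xy(1,2) by (auto simp: G_def U_def dest: inj_onD)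
  qed
  have Plow: "(1 - cmod \<kappa>) * cmod (G z) \<le> cmod (P z)" for z
    using norm_triangle_ineq2[of "G z" "\<kappa> * cnj (G z)"] by (simp add: P norm_mult algebra_simps)
  have Pnz: "P z \<noteq> 0" if "z \<in> U" for z
  proof -
    have "0 < (1 - cmod \<kappa>) * cmod (G z)" using Gnz[OF that] \<kappa>1 by simp
    then show ?thesis using Plow[of z] by auto
  qed
  have laurent: "(1 + b * z\<^sup>2 + (z\<^sup>2)\<^sup>2 * y) / z = 1 / z + b * z + z ^ 3 * y" if "z \<noteq> 0" for z b y :: complex
    using that by (simp add: field_simps power2_eq_square power3_eq_cube)
  \<comment> \<open>the extra 1 in the coefficient of \<open>\<epsilon> ^ 3\<close> makes the bound on the circle strict, as an open disc is needed\<close>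
  define R where "R = 1 / \<epsilon> + (M + (cmod c)\<^sup>2 + cmod c * M + 1) * \<epsilon> ^ 3"
  have M0: "0 \<le> M" using order_trans[OF norm_ge_zero M[of 0]] by simp
  have R: "0 < R" using eps M0 by (simp add: R_def add_pos_nonneg)
  have sphere: "cmod (P z) < R" if z: "cmod z = \<epsilon>" for z
  proof -
    have z0: "z \<noteq> 0" using z eps by auto
    have zD: "z \<in> unit_disc" using z eps by simp
    have zz: "z * cnj z = of_real (\<epsilon>\<^sup>2)" using z by (simp only: complex_norm_square[symmetric])
    have z2: "cmod (z\<^sup>2) \<le> 1 / 4"
      using power_mono[of \<epsilon> "1/2" 2] eps z by (simp add: norm_power power_divide)
    define x where "x = z ^ 3 * m (z\<^sup>2)"
    have G: "G z = 1 / z + c * z + x"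
      unfolding G_def km[OF sq[OF zD]] x_def by (rule laurent[OF z0])
    have "\<kappa> * cnj (1 / z) = c * z"
      using z0 zz by (simp add: \<kappa>_def field_simps)
    then have "P z = 1 / z + (x - \<kappa> * cnj (c * z + x))"
      by (simp add: P G algebra_simps)
    then have l1: "cmod (P z) \<le> cmod (1 / z) + (cmod x + cmod \<kappa> * (cmod (c * z) + cmod x))"
      by (smt (verit) complex_mod_cnj norm_mult norm_triangle_ineq norm_triangle_ineq4 mult_left_mono norm_ge_zero)
    have l2: "cmod x \<le> \<epsilon> ^ 3 * M"
      using M[OF z2] z eps by (simp add: x_def norm_mult norm_power mult_left_mono)
    have "cmod \<kappa> * (cmod (c * z) + cmod x) \<le> cmod \<kappa> * (cmod c * \<epsilon> + \<epsilon> ^ 3 * M)"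
      using z by (intro mult_left_mono add_mono l2) (simp_all add: norm_mult)
    with l1 l2 have le: "cmod (P z) \<le> 1 / \<epsilon> + (\<epsilon> ^ 3 * M + cmod c * \<epsilon>\<^sup>2 * (cmod c * \<epsilon> + \<epsilon> ^ 3 * M))"
      using z by (simp add: norm_divide \<kappa>c)
    have "cmod c * \<epsilon>\<^sup>2 * (cmod c * \<epsilon> + \<epsilon> ^ 3 * M) = (cmod c)\<^sup>2 * \<epsilon> ^ 3 + (cmod c * M * \<epsilon> ^ 3) * \<epsilon>\<^sup>2"
      by (simp add: power2_eq_square power3_eq_cube algebra_simps)
    also have "\<dots> \<le> (cmod c)\<^sup>2 * \<epsilon> ^ 3 + (cmod c * M * \<epsilon> ^ 3) * 1"
      using eps M0 by (intro add_left_mono mult_left_mono power_le_one) auto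
    finally have "cmod (P z) \<le> 1 / \<epsilon> + (M + (cmod c)\<^sup>2 + cmod c * M) * \<epsilon> ^ 3"
      using le by (simp add: algebra_simps)
    also have "\<dots> < R" using eps by (simp add: R_def algebra_simps)
    finally show ?thesis .
  qed
  \<comment> \<open>the reciprocal of \<open>P\<close> extends to an injective continuous map of the whole disc, so its modulus outside the circle is at least its minimum on the circle\<close>
  define N where "N z = (if z = 0 then 0 else 1 / P z)" for z
  have contP: "continuous_on U P" unfolding P_def by (rule continuous_on_harmonic_map[OF Ghol ghol])
  have contN: "continuous_on unit_disc N"
  proof (rule continuous_at_imp_continuous_on, rule ballI)
    fix z :: complex assume z: "z \<in> unit_disc"
    show "isCont N z"
    proof (cases "z = 0")
      case False
      have "continuous_on U (\<lambda>z. 1 / P z)" using Pnz by (intro continuous_intros contP) auto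
      then have "continuous_on U N"
        by (rule continuous_on_eq) (auto simp: N_def U_def)
      then show ?thesis using oU z False by (simp add: continuous_on_eq_continuous_at U_def)
    next
      case True
      have ck: "isCont (\<lambda>z. k (z\<^sup>2)) 0"
        using holomorphic_on_imp_continuous_on[OF k2] by (simp add: continuous_on_eq_continuous_at)
      have k0: "k 0 = 1" using km[of 0] by simp
      have ev: "\<forall>\<^sub>F z in at 0. z \<in> U"
        using eventually_at_in_open[of unit_disc "0::complex"] by (simp add: U_def)
      have "(N \<longlongrightarrow> 0) (at 0)"
      proof (rule Lim_null_comparison)
        show "\<forall>\<^sub>F z in at 0. norm (N z) \<le> cmod z / ((1 - cmod \<kappa>) * cmod (k (z\<^sup>2)))"
          using ev
        proof eventually_elim
          case (elim z)
          then have z0: "z \<noteq> 0" by (simp add: U_def)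
          have kz: "k (z\<^sup>2) \<noteq> 0" using elim nz sq by (simp add: U_def)
          have pos: "0 < (1 - cmod \<kappa>) * (cmod (k (z\<^sup>2)) / cmod z)" using kz z0 \<kappa>1 by simp
          have "norm (N z) = 1 / cmod (P z)" using z0 by (simp add: N_def norm_divide)
          also have "\<dots> \<le> 1 / ((1 - cmod \<kappa>) * (cmod (k (z\<^sup>2)) / cmod z))"
            using Plow[of z] pos by (intro frac_le) (simp_all add: G_def norm_divide)
          finally show ?case by simp
        qed
        have "((\<lambda>z. cmod z / ((1 - cmod \<kappa>) * cmod (k (z\<^sup>2)))) \<longlongrightarrow> cmod 0 / ((1 - cmod \<kappa>) * cmod (k (0\<^sup>2)))) (at 0)"
          using ck[unfolded isCont_def] k0 \<kappa>1 by (intro tendsto_intros) auto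
        then show "((\<lambda>z. cmod z / ((1 - cmod \<kappa>) * cmod (k (z\<^sup>2)))) \<longlongrightarrow> 0) (at 0)" by simp
      qed
      then show ?thesis by (simp add: isCont_def True N_def)
    qed
  qed
  have Ninj: "inj_on N unit_disc"
  proof (rule inj_onI)
    fix x y assume xy: "x \<in> unit_disc" "y \<in> unit_disc" "N x = N y"
    show "x = y"
    proof (cases "x = 0 \<or> y = 0")
      case True
      then show ?thesis using xy Pnz by (auto simp: N_def U_def split: if_splits)
    next
      case False
      then have U: "x \<in> U" "y \<in> U" using xy by (auto simp: U_def)
      then have "P x = P y" using xy(3) False by (simp add: N_def)
      then show ?thesis using Pinj U by (meson inj_onD)
    qed
  qed
  have ann: "annulus 0 \<epsilon> r \<subseteq> U" using eps r by (auto simp: U_def)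
  have img: "P ` annulus 0 \<epsilon> r \<subseteq> ball 0 R"
  proof clarify
    fix p assume p: "\<epsilon> < cmod (p - 0)" "cmod (p - 0) < r"
    have p0: "p \<noteq> 0" using p eps by auto
    have cb: "cball 0 \<epsilon> \<subseteq> unit_disc" using eps by auto
    have pU: "p \<in> unit_disc" "p \<notin> cball 0 \<epsilon>" using p r by auto
    obtain t where t: "cmod (N (0 + of_real \<epsilon> * cis t) - N 0) \<le> cmod (N p - N 0)"
      using injective_map_small_on_circle[OF contN Ninj cb eps(1) pU] by blast
    let ?z = "of_real \<epsilon> * cis t"
    have nz: "cmod ?z = \<epsilon>" using eps by (simp add: norm_mult)
    then have z0: "?z \<noteq> 0" using eps by auto
    have zU: "?z \<in> U" using nz z0 eps r by (simp add: U_def)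
    have "1 / cmod (P ?z) \<le> 1 / cmod (P p)" using t p0 z0 by (simp add: N_def norm_divide)
    then have "cmod (P p) \<le> cmod (P ?z)"
      using Pnz[OF zU] Pnz[of p] p0 pU by (simp add: U_def field_simps)
    also have "\<dots> < R" by (rule sphere[OF nz])
    finally show "P p \<in> ball 0 R" by simp
  qed
  define D where "D = 1 - (cmod \<kappa>)\<^sup>2"
  have D: "0 < D" using \<kappa>1 by (simp add: D_def abs_square_less_1)
  have dg: "deriv g z = - cnj \<kappa> * deriv G z" if "z \<in> U" for z
    unfolding g_def[abs_def] using holomorphic_derivI[OF Ghol oU that]
    by (intro DERIV_imp_deriv DERIV_cmult)
  have J: "jacobian G g z = D * (cmod (deriv G z))\<^sup>2" if "z \<in> U" for z
    by (simp add: jacobian_def dg[OF that] norm_mult D_def power_mult_distrib algebra_simps)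
  define e1 where "e1 z = z ^ 3 * m (z\<^sup>2)" for z
  have e1: "e1 holomorphic_on unit_disc" unfolding e1_def[abs_def] by (intro holomorphic_intros m2)
  have e1': "deriv e1 holomorphic_on unit_disc" by (rule holomorphic_deriv[OF e1]) simp
  have e10: "deriv e1 0 = 0"
  proof -
    have "((\<lambda>z. z ^ 3) has_field_derivative 0) (at (0::complex))"
      by (auto intro!: derivative_eq_intros)
    moreover have "((\<lambda>z. m (z\<^sup>2)) has_field_derivative deriv (\<lambda>z. m (z\<^sup>2)) 0) (at 0)"
      by (rule holomorphic_derivI[OF m2]) auto
    ultimately have "(e1 has_field_derivative 0 * m (0\<^sup>2) + deriv (\<lambda>z. m (z\<^sup>2)) 0 * 0 ^ 3) (at 0)"
      unfolding e1_def[abs_def] by (rule DERIV_mult)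
    then show ?thesis by (simp add: DERIV_imp_deriv)
  qed
  have dG: "deriv G z = - 1 / z\<^sup>2 + c + deriv e1 z" if z: "z \<in> U" for z
  proof (rule DERIV_imp_deriv)
    have z0: "z \<noteq> 0" and zD: "z \<in> unit_disc" using z by (auto simp: U_def)
    have 1: "((\<lambda>z. 1 / z) has_field_derivative (- 1 / z\<^sup>2)) (at z)"
      using z0 by (auto intro!: derivative_eq_intros simp: power2_eq_square)
    have 2: "((\<lambda>z. c * z) has_field_derivative c) (at z)" by (auto intro!: derivative_eq_intros)
    have "((\<lambda>z. 1 / z + c * z + e1 z) has_field_derivative (- 1 / z\<^sup>2 + c + deriv e1 z)) (at z)"
      by (intro DERIV_add 1 2 holomorphic_derivI[OF e1 open_ball zD])
    moreover have "\<forall>\<^sub>F w in nhds z. w \<in> U" using oU z by (intro eventually_nhds_in_open)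
    then have ev: "\<forall>\<^sub>F w in nhds z. G w = 1 / w + c * w + e1 w"
    proof eventually_elim
      case (elim w)
      then show ?case
        unfolding G_def e1_def using km[OF sq, of w] laurent[of w c "m (w\<^sup>2)"] by (simp add: U_def)
    qed
    ultimately show "(G has_field_derivative (- 1 / z\<^sup>2 + c + deriv e1 z)) (at z)"
      using DERIV_cong_ev[OF refl ev refl] by simp
  qed
  have contdG: "continuous_on U (\<lambda>z. (cmod (deriv G z))\<^sup>2)"
    using holomorphic_on_imp_continuous_on[OF holomorphic_deriv[OF Ghol oU]] by (intro continuous_intros)
  have pin: "of_real s * cis t \<in> U" if "\<epsilon> < s" "s < r" for s t
    using that eps r by (auto simp: U_def norm_mult)
  \<comment> \<open>the Jacobian of \<open>P\<close> is the constant \<open>D\<close> times the one of \<open>G\<close>\<close>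
  define S2 where "S2 x = fst x * (D * (cmod (deriv G (of_real (fst x) * cis (snd x))))\<^sup>2)" for x :: "real \<times> real"
  have mS2: "(\<lambda>x. ennreal (indicator (polar_box \<epsilon> r) x * S2 x)) \<in> borel_measurable borel"
  proof (rule measurable_polar_box)
    have "continuous_on (polar_box \<epsilon> r) (\<lambda>x. (cmod (deriv G (of_real (fst x) * cis (snd x))))\<^sup>2)"
    proof (rule continuous_on_compose2[OF contdG])
      show "continuous_on (polar_box \<epsilon> r) (\<lambda>x. of_real (fst x) * cis (snd x))" by (intro continuous_intros)
    qed (use pin in auto)
    then show "continuous_on (polar_box \<epsilon> r) S2"
      unfolding S2_def by (intro continuous_on_mult continuous_on_fst continuous_on_id continuous_on_const)
  qed
  define L where "L s = D * (2 * pi * (1 / s ^ 3 + (cmod c)\<^sup>2 * s))" for s :: real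
  have "(\<integral>\<^sup>+s. ennreal (indicator {\<epsilon><..<r} s * L s) \<partial>lborel)
     \<le> (\<integral>\<^sup>+s. \<integral>\<^sup>+t. ennreal (indicator (polar_box \<epsilon> r) (s, t) * S2 (s, t)) \<partial>lborel \<partial>lborel)"
  proof (rule nn_integral_mono)
    fix s :: real
    show "ennreal (indicator {\<epsilon><..<r} s * L s) \<le> (\<integral>\<^sup>+t. ennreal (indicator (polar_box \<epsilon> r) (s, t) * S2 (s, t)) \<partial>lborel)"
    proof (cases "s \<in> {\<epsilon><..<r}")
      case True
      then have s: "0 < s" "s < 1" "\<epsilon> < s" "s < r" using eps r by auto
      have cont: "continuous_on T (\<lambda>t. (cmod (deriv G (of_real s * cis t)))\<^sup>2)" for T
      proof (rule continuous_on_compose2[OF contdG])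
        show "continuous_on T (\<lambda>t. of_real s * cis t)" by (intro continuous_intros)
      qed (use pin s in auto)
      have "L s = s * D * (2 * pi * (1 / s ^ 4 + (cmod c)\<^sup>2))"
        using s by (simp add: L_def field_simps power3_eq_cube power4_eq_xxxx)
      also have "\<dots> \<le> s * D * integral {0..2*pi} (\<lambda>t. (cmod (deriv G (of_real s * cis t)))\<^sup>2)"
        using area_circle_lower_bound[OF e1' e10 s(1,2), of c] dG[OF pin[OF s(3,4)]] s D
        by (intro mult_left_mono) auto
      also have "\<dots> = integral {0..2*pi} (\<lambda>t. s * D * (cmod (deriv G (of_real s * cis t)))\<^sup>2)"
        by simp
      finally have "ennreal (L s) \<le> ennreal (integral {0..2*pi} (\<lambda>t. s * D * (cmod (deriv G (of_real s * cis t)))\<^sup>2))"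
        by (rule ennreal_leI)
      also have "\<dots> = (\<integral>\<^sup>+t. ennreal (indicator {0<..<2*pi} t * (s * D * (cmod (deriv G (of_real s * cis t)))\<^sup>2)) \<partial>lborel)"
        using s D by (intro nn_integral_Ioo_continuous[symmetric] continuous_on_mult continuous_on_const cont) auto
      also have "\<dots> = (\<integral>\<^sup>+t. ennreal (indicator (polar_box \<epsilon> r) (s, t) * S2 (s, t)) \<partial>lborel)"
        using True by (intro nn_integral_cong) (auto simp: indicator_def S2_def mult.assoc)
      finally show ?thesis using True by simp
    qed simp
  qed
  also have "\<dots> = (\<integral>\<^sup>+x. ennreal (indicator (polar_box \<epsilon> r) x * S2 x) \<partial>lborel)"
    by (rule nn_integral_lborel_pair(1)[OF mS2, symmetric])
  also have "\<dots> = (\<integral>\<^sup>+x. ennreal (indicator (polar_box \<epsilon> r) x * (fst x * \<bar>jacobian G g (polar 0 x)\<bar>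
             * (1 + (cmod (harmonic_map G g (polar 0 x)))\<^sup>2) powr 0)) \<partial>lborel)"
  proof (rule nn_integral_cong)
    fix x :: "real \<times> real"
    have 1: "1 + (cmod w)\<^sup>2 \<noteq> 0" for w :: complex
      by (metis add_pos_nonneg less_irrefl zero_le_power2 zero_less_one)
    show "ennreal (indicator (polar_box \<epsilon> r) x * S2 x) = ennreal (indicator (polar_box \<epsilon> r) x * (fst x * \<bar>jacobian G g (polar 0 x)\<bar>
             * (1 + (cmod (harmonic_map G g (polar 0 x)))\<^sup>2) powr 0))"
      using pin[of "fst x" "snd x"] D 1
      by (cases "x \<in> polar_box \<epsilon> r") (auto simp: S2_def J abs_mult)
  qed
  also have "\<dots> \<le> ennreal (pi * ((1 + R\<^sup>2) powr (0 + 1) - 1) / (0 + 1))"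
    using Ghol ghol Pinj ann R img eps
    by (intro harmonic_weighted_area_le) (auto intro: holomorphic_on_subset inj_on_subset simp: P_def)
  also have "pi * ((1 + R\<^sup>2) powr (0 + 1) - 1) / (0 + 1) = pi * R\<^sup>2" by (simp add: add_pos_nonneg)
  finally have le: "(\<integral>\<^sup>+s. ennreal (indicator {\<epsilon><..<r} s * L s) \<partial>lborel) \<le> ennreal (pi * R\<^sup>2)" .
  define A where "A s = D * (pi * ((cmod c)\<^sup>2 * s\<^sup>2 - 1 / s\<^sup>2))" for s :: real
  have "(\<integral>\<^sup>+s. ennreal (indicator {\<epsilon><..<r} s * L s) \<partial>lborel) = ennreal (A r - A \<epsilon>)"
  proof (rule nn_integral_Ioo_derivative)
    show "(A has_real_derivative L s) (at s within {\<epsilon>..r})" if "s \<in> {\<epsilon>..r}" for s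
    proof -
      have "s \<noteq> 0" using that eps by auto
      then show ?thesis unfolding A_def[abs_def] L_def
        by (auto intro!: derivative_eq_intros simp: field_simps power2_eq_square power3_eq_cube)
    qed
    show "0 \<le> L s" if "s \<in> {\<epsilon>..r}" for s using that eps D by (simp add: L_def)
  qed (use eps in auto)
  with le have "A r - A \<epsilon> \<le> pi * R\<^sup>2" using R by (simp add: ennreal_le_iff)
  moreover have "A r - A \<epsilon> = pi * (D * (1 / \<epsilon>\<^sup>2 - 1 / r\<^sup>2 + (cmod c)\<^sup>2 * (r\<^sup>2 - \<epsilon>\<^sup>2)))"
    by (simp add: A_def algebra_simps)
  ultimately have "D * (1 / \<epsilon>\<^sup>2 - 1 / r\<^sup>2 + (cmod c)\<^sup>2 * (r\<^sup>2 - \<epsilon>\<^sup>2)) \<le> R\<^sup>2" by simp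
  then show ?thesis by (simp add: D_def R_def \<kappa>c)
qed

text \<open>
  The terms \<open>1 / \<epsilon>^2\<close> cancel in the limit \<open>\<epsilon> \<rightarrow> 0\<close>, leaving \<open>a^2 r^2 \<le> 1 / r^2\<close>; then \<open>r\<close> tends to \<open>1\<close>.
\<close>
lemma area_theorem_limit:
  fixes a B :: real
  assumes ev: "\<And>r. 1 / 2 < r \<Longrightarrow> r < 1 \<Longrightarrow> \<forall>\<^sub>F \<epsilon> in at_right 0.
      (1 - (a * \<epsilon>\<^sup>2)\<^sup>2) * (1 / \<epsilon>\<^sup>2 - 1 / r\<^sup>2 + a\<^sup>2 * (r\<^sup>2 - \<epsilon>\<^sup>2)) \<le> (1 / \<epsilon> + B * \<epsilon> ^ 3)\<^sup>2"
    and a: "0 \<le> a"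
  shows "a \<le> 1"
proof -
  have r: "a * r\<^sup>2 \<le> 1" if r: "1 / 2 < r" "r < 1" for r
  proof -
    have "\<forall>\<^sub>F \<epsilon> in at_right 0. a\<^sup>2 * r\<^sup>2 - 1 / r\<^sup>2
        \<le> 2 * B * \<epsilon>\<^sup>2 + B\<^sup>2 * \<epsilon> ^ 6 + a\<^sup>2 * \<epsilon>\<^sup>2 + a\<^sup>2 * \<epsilon>\<^sup>2 + a\<^sup>2 * \<epsilon> ^ 4 * (a\<^sup>2 * (r\<^sup>2 - \<epsilon>\<^sup>2) - 1 / r\<^sup>2)"
      using ev[OF r] eventually_at_right_less[of 0]
    proof eventually_elim
      case (elim \<epsilon>)
      have "(1 / \<epsilon> + B * \<epsilon> ^ 3)\<^sup>2 = 1 / \<epsilon>\<^sup>2 + 2 * B * \<epsilon>\<^sup>2 + B\<^sup>2 * \<epsilon> ^ 6"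
        using elim(2) by (simp add: power2_eq_square power3_eq_cube eval_nat_numeral field_simps)
      moreover have "(1 - (a * \<epsilon>\<^sup>2)\<^sup>2) * (1 / \<epsilon>\<^sup>2 - 1 / r\<^sup>2 + a\<^sup>2 * (r\<^sup>2 - \<epsilon>\<^sup>2))
          = 1 / \<epsilon>\<^sup>2 - 1 / r\<^sup>2 + a\<^sup>2 * r\<^sup>2 - a\<^sup>2 * \<epsilon>\<^sup>2 - a\<^sup>2 * \<epsilon>\<^sup>2 - a\<^sup>2 * \<epsilon> ^ 4 * (a\<^sup>2 * (r\<^sup>2 - \<epsilon>\<^sup>2) - 1 / r\<^sup>2)"
      proof -
        define u where "u = a\<^sup>2 * (r\<^sup>2 - \<epsilon>\<^sup>2) - 1 / r\<^sup>2"
        have e4: "(a * \<epsilon>\<^sup>2)\<^sup>2 = a\<^sup>2 * \<epsilon> ^ 4" by (simp add: power_mult_distrib)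
        have "a\<^sup>2 * \<epsilon> ^ 4 * (1 / \<epsilon>\<^sup>2) = a\<^sup>2 * \<epsilon>\<^sup>2"
          using elim(2) by (simp add: power2_eq_square eval_nat_numeral)
        moreover have "(1 - x) * (y + u) = y + u - x * y - x * u" for x y :: real by (simp add: algebra_simps)
        ultimately have "(1 - a\<^sup>2 * \<epsilon> ^ 4) * (1 / \<epsilon>\<^sup>2 + u) = 1 / \<epsilon>\<^sup>2 + u - a\<^sup>2 * \<epsilon>\<^sup>2 - a\<^sup>2 * \<epsilon> ^ 4 * u"
          by metis
        moreover have e5: "1 / \<epsilon>\<^sup>2 - 1 / r\<^sup>2 + a\<^sup>2 * (r\<^sup>2 - \<epsilon>\<^sup>2) = 1 / \<epsilon>\<^sup>2 + u" by (simp add: u_def)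
        moreover have "u = a\<^sup>2 * r\<^sup>2 - a\<^sup>2 * \<epsilon>\<^sup>2 - 1 / r\<^sup>2" by (simp add: u_def right_diff_distrib)
        ultimately show ?thesis unfolding e4 e5 u_def[symmetric] by linarith
      qed
      ultimately show ?case using elim(1) by linarith
    qed
    moreover have "((\<lambda>\<epsilon>. 2 * B * \<epsilon>\<^sup>2 + B\<^sup>2 * \<epsilon> ^ 6 + a\<^sup>2 * \<epsilon>\<^sup>2 + a\<^sup>2 * \<epsilon>\<^sup>2 + a\<^sup>2 * \<epsilon> ^ 4 * (a\<^sup>2 * (r\<^sup>2 - \<epsilon>\<^sup>2) - 1 / r\<^sup>2))
        \<longlongrightarrow> 2 * B * 0\<^sup>2 + B\<^sup>2 * 0 ^ 6 + a\<^sup>2 * 0\<^sup>2 + a\<^sup>2 * 0\<^sup>2 + a\<^sup>2 * 0 ^ 4 * (a\<^sup>2 * (r\<^sup>2 - 0\<^sup>2) - 1 / r\<^sup>2)) (at_right 0)"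
      by (intro tendsto_intros)
    then have "((\<lambda>\<epsilon>. 2 * B * \<epsilon>\<^sup>2 + B\<^sup>2 * \<epsilon> ^ 6 + a\<^sup>2 * \<epsilon>\<^sup>2 + a\<^sup>2 * \<epsilon>\<^sup>2 + a\<^sup>2 * \<epsilon> ^ 4 * (a\<^sup>2 * (r\<^sup>2 - \<epsilon>\<^sup>2) - 1 / r\<^sup>2))
        \<longlongrightarrow> 0) (at_right 0)" by simp
    ultimately have "a\<^sup>2 * r\<^sup>2 - 1 / r\<^sup>2 \<le> 0"
      by (intro tendsto_lowerbound[of _ 0 "at_right (0::real)"]) auto
    then have "(a * r\<^sup>2)\<^sup>2 \<le> 1\<^sup>2" using r by (simp add: power_mult_distrib field_simps power2_eq_square)
    then show ?thesis by (rule power2_le_imp_le) simp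
  qed
  have "\<forall>\<^sub>F r in at_left 1. r \<in> {1/2<..<1::real}" by (rule eventually_at_left_real) simp
  then have "\<forall>\<^sub>F r in at_left 1. a * r\<^sup>2 \<le> 1" by eventually_elim (use r in auto)
  moreover have "((\<lambda>r. a * r\<^sup>2) \<longlongrightarrow> a * 1\<^sup>2) (at_left 1)" by (intro tendsto_intros)
  ultimately have "a * 1\<^sup>2 \<le> 1" by (intro tendsto_upperbound[of _ "a * 1\<^sup>2" "at_left (1::real)"]) auto
  then show ?thesis by simp
qed

text \<open>
  The square root transform \<open>sqrt (f (z^2))\<close> is odd and injective, so its reciprocal has the form
  \<open>k (z^2) / z\<close> with \<open>k\<close> a branch of the square root of \<open>z / f z\<close>.  There is no constant term, and the
  area theorem applies to the coefficient \<open>c = k' 0 = - f'' 0 / 4\<close>.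
\<close>
theorem bieberbach_second_coefficient:
  assumes f: "f holomorphic_on unit_disc" and inj: "inj_on f unit_disc" and f0: "f 0 = 0" and f1: "deriv f 0 = 1"
  shows "cmod (deriv (deriv f) 0) \<le> 4"
proof -
  obtain \<phi> where \<phi>: "\<phi> holomorphic_on unit_disc" "\<And>z. cmod z < 1 \<Longrightarrow> f z = z * \<phi> z" "deriv f 0 = \<phi> 0"
    using Schwarz3[OF f f0] by blast
  have \<phi>0: "\<phi> 0 = 1" using \<phi>(3) f1 by simp
  have \<phi>nz: "\<phi> z \<noteq> 0" if z: "z \<in> unit_disc" for z
  proof (cases "z = 0")
    case False
    then have "f z \<noteq> f 0" using inj z by (auto dest: inj_onD)
    then show ?thesis using \<phi>(2)[of z] z f0 by auto
  qed (simp add: \<phi>0)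
  obtain L where L: "L holomorphic_on unit_disc" "\<And>z. z \<in> unit_disc \<Longrightarrow> exp (L z) = \<phi> z"
    using holomorphic_logarithm_exists[OF convex_ball open_ball \<phi>(1) \<phi>nz, of 0] by auto
  \<comment> \<open>the normalization by \<open>L 0\<close> selects the branch with \<open>k 0 = 1\<close>\<close>
  define k where "k z = exp ((L 0 - L z) / 2)" for z
  have k: "k holomorphic_on unit_disc" unfolding k_def[abs_def] by (intro holomorphic_intros L) auto
  have k2: "(k z)\<^sup>2 * \<phi> z = 1" if z: "z \<in> unit_disc" for z
  proof -
    have half: "(exp (w / 2))\<^sup>2 = exp w" for w :: complex by (simp flip: exp_double)
    have "(k z)\<^sup>2 = exp (L 0 - L z)" unfolding k_def by (rule half)
    also have "\<dots> = \<phi> 0 / \<phi> z" using L(2)[of 0] L(2)[OF z] by (simp add: exp_diff)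
    finally show ?thesis using \<phi>nz[OF z] \<phi>0 by simp
  qed
  have knz: "k z \<noteq> 0" for z by (simp add: k_def)
  have k0: "k 0 = 1" by (simp add: k_def)
  define c where "c = deriv k 0"
  have d\<phi>: "deriv \<phi> 0 = - 2 * c"
  proof -
    have "(k has_field_derivative c) (at 0)" unfolding c_def by (rule holomorphic_derivI[OF k open_ball]) simp
    moreover have "(\<phi> has_field_derivative deriv \<phi> 0) (at 0)" by (rule holomorphic_derivI[OF \<phi>(1) open_ball]) simp
    ultimately have "((\<lambda>z. k z * k z * \<phi> z) has_field_derivative (c * k 0 + c * k 0) * \<phi> 0 + deriv \<phi> 0 * (k 0 * k 0)) (at 0)"
      by (intro DERIV_mult)
    moreover have "\<forall>\<^sub>F z in nhds 0. z \<in> unit_disc" by (rule eventually_nhds_in_open) auto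
    then have ev: "\<forall>\<^sub>F z in nhds 0. k z * k z * \<phi> z = 1"
      by eventually_elim (use k2 in \<open>simp add: power2_eq_square\<close>)
    ultimately have "((\<lambda>z. 1) has_field_derivative (c * k 0 + c * k 0) * \<phi> 0 + deriv \<phi> 0 * (k 0 * k 0)) (at 0)"
      using DERIV_cong_ev[OF refl ev refl] by simp
    then have "(c * k 0 + c * k 0) * \<phi> 0 + deriv \<phi> 0 * (k 0 * k 0) = 0"
      using DERIV_const DERIV_unique by blast
    then have "2 * c + deriv \<phi> 0 = 0" by (simp add: k0 \<phi>0)
    then show ?thesis by (simp add: eq_neg_iff_add_eq_0 add.commute)
  qed
  have ddf: "deriv (deriv f) 0 = 2 * deriv \<phi> 0"
  proof -
    have op: "\<forall>\<^sub>F z in nhds 0. z \<in> unit_disc" by (rule eventually_nhds_in_open) auto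
    have df: "deriv f z = \<phi> z + deriv \<phi> z * z" if z: "z \<in> unit_disc" for z
    proof -
      have "\<forall>\<^sub>F w in nhds z. w \<in> unit_disc" using z by (intro eventually_nhds_in_open) auto
      then have "\<forall>\<^sub>F w in nhds z. f w = w * \<phi> w" by eventually_elim (use \<phi>(2) in simp)
      then have "deriv f z = deriv (\<lambda>w. w * \<phi> w) z" by (intro deriv_cong_ev) auto
      also have "\<dots> = 1 * \<phi> z + deriv \<phi> z * z"
        by (intro DERIV_imp_deriv DERIV_mult DERIV_ident holomorphic_derivI[OF \<phi>(1) open_ball z])
      finally show ?thesis by simp
    qed
    from op have "\<forall>\<^sub>F z in nhds 0. deriv f z = \<phi> z + deriv \<phi> z * z" by eventually_elim (rule df)
    then have "deriv (deriv f) 0 = deriv (\<lambda>z. \<phi> z + deriv \<phi> z * z) 0" by (intro deriv_cong_ev) auto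
    also have "\<dots> = deriv \<phi> 0 + (deriv (deriv \<phi>) 0 * 0 + 1 * deriv \<phi> 0)"
      by (intro DERIV_imp_deriv DERIV_add DERIV_mult DERIV_ident
          holomorphic_derivI[OF \<phi>(1) open_ball] holomorphic_derivI[OF holomorphic_deriv[OF \<phi>(1) open_ball] open_ball]) auto
    finally show ?thesis by simp
  qed
  have hol1: "(\<lambda>z. k z - 1) holomorphic_on unit_disc" by (intro holomorphic_intros k)
  have k01: "k 0 - 1 = 0" by (simp add: k0)
  obtain k1 where k1: "k1 holomorphic_on unit_disc" "\<And>z. cmod z < 1 \<Longrightarrow> k z - 1 = z * k1 z"
      "deriv (\<lambda>z. k z - 1) 0 = k1 0"
    using Schwarz3[OF hol1 k01] by blast
  have "deriv (\<lambda>z. k z - 1) 0 = c - 0"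
    unfolding c_def by (intro DERIV_imp_deriv DERIV_diff DERIV_const holomorphic_derivI[OF k open_ball]) simp
  then have k10: "k1 0 = c" using k1(3) by simp
  have hol2: "(\<lambda>z. k1 z - c) holomorphic_on unit_disc" by (intro holomorphic_intros k1)
  have k1c: "k1 0 - c = 0" by (simp add: k10)
  obtain m where m: "m holomorphic_on unit_disc" "\<And>z. cmod z < 1 \<Longrightarrow> k1 z - c = z * m z"
    using Schwarz3[OF hol2 k1c] by blast
  have km: "k z = 1 + c * z + z\<^sup>2 * m z" if "z \<in> unit_disc" for z
  proof -
    have "k z = 1 + z * k1 z" using k1(2)[of z] that by (simp add: algebra_simps)
    also have "k1 z = c + z * m z" using m(2)[of z] that by (simp add: algebra_simps)
    finally show ?thesis by (simp add: algebra_simps power2_eq_square)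
  qed
  have sq: "z\<^sup>2 \<in> unit_disc" if "z \<in> unit_disc" for z :: complex
    using that by (simp add: norm_power abs_square_less_1)
  have kinj: "inj_on (\<lambda>z. k (z\<^sup>2) / z) (unit_disc - {0})"
  proof (rule inj_onI)
    fix x y assume xy: "x \<in> unit_disc - {0}" "y \<in> unit_disc - {0}" "k (x\<^sup>2) / x = k (y\<^sup>2) / y"
    have G2: "(k (z\<^sup>2) / z)\<^sup>2 * f (z\<^sup>2) = 1" if z: "z \<in> unit_disc - {0}" for z
      using k2[OF sq, of z] \<phi>(2)[of "z\<^sup>2"] sq[of z] z by (simp add: power_divide)
    have "(k (x\<^sup>2) / x)\<^sup>2 * f (x\<^sup>2) = (k (x\<^sup>2) / x)\<^sup>2 * f (y\<^sup>2)"
      using G2[OF xy(1)] G2[OF xy(2)] xy(3) by simp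
    moreover have "(k (x\<^sup>2) / x)\<^sup>2 \<noteq> 0" using knz xy(1) by simp
    ultimately have "f (x\<^sup>2) = f (y\<^sup>2)" by simp
    then have e: "x\<^sup>2 = y\<^sup>2" using inj sq xy by (auto dest: inj_onD)
    then have "k (x\<^sup>2) / x = k (x\<^sup>2) / y" using xy(3) by simp
    then show "x = y" using knz xy by (simp add: field_simps)
  qed
  have "compact (m ` cball 0 (1/4))"
    by (intro compact_continuous_image holomorphic_on_imp_continuous_on holomorphic_on_subset[OF m(1)]) auto
  then obtain M where M: "\<And>w. w \<in> m ` cball 0 (1/4) \<Longrightarrow> cmod w \<le> M"
    using compact_imp_bounded bounded_iff by metis
  have "cmod c \<le> 1"
  proof (rule area_theorem_limit[where B = "M + (cmod c)\<^sup>2 + cmod c * M + 1"])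
    fix r :: real assume r: "1 / 2 < r" "r < 1"
    have "\<forall>\<^sub>F \<epsilon> in at_right 0. \<epsilon> \<in> {0<..<1/2::real}" by (rule eventually_at_right_real) simp
    moreover have "((\<lambda>\<epsilon>. cmod c * \<epsilon>\<^sup>2) \<longlongrightarrow> cmod c * 0\<^sup>2) (at_right 0)" by (intro tendsto_intros)
    then have "\<forall>\<^sub>F \<epsilon> in at_right 0. cmod c * \<epsilon>\<^sup>2 < 1" by (rule order_tendstoD) simp
    ultimately show "\<forall>\<^sub>F \<epsilon> in at_right 0.
      (1 - (cmod c * \<epsilon>\<^sup>2)\<^sup>2) * (1 / \<epsilon>\<^sup>2 - 1 / r\<^sup>2 + (cmod c)\<^sup>2 * (r\<^sup>2 - \<epsilon>\<^sup>2)) \<le> (1 / \<epsilon> + (M + (cmod c)\<^sup>2 + cmod c * M + 1) * \<epsilon> ^ 3)\<^sup>2"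
    proof eventually_elim
      case (elim \<epsilon>)
      show ?case
        by (rule area_theorem_approx[OF k m(1) km knz kinj]) (use elim r M in auto)
    qed
  qed simp
  then show ?thesis by (simp add: ddf d\<phi> norm_mult)
qed

section \<open>The coefficient and mean estimates\<close>

text \<open>
  The Koebe transform of a conformal map is conformal, so Bieberbach's bound replaces \<open>gamma_H\<close>.
\<close>
lemma conformal_pre_schwarzian_bound:
  assumes S: "(h, g) \<in> S_H" and g: "\<And>z. z \<in> unit_disc \<Longrightarrow> g z = 0" and a: "cmod a < 1"
  shows "cmod (of_real (1 - (cmod a)\<^sup>2) * (deriv (deriv h) a / deriv h a) - 2 * cnj a) \<le> 2 * 2"
proof -
  define l where "l = of_real (1 - (cmod a)\<^sup>2) * deriv h a"
  define H where "H = (\<lambda>z. (h ((z + a) / (1 + cnj a * z)) - h a) / l)"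
  define G where "G = (\<lambda>z. (g ((z + a) / (1 + cnj a * z)) - g a) / cnj l)"
  note D = S_H_D[OF S]
  have HG: "(H, G) \<in> S_H" unfolding H_def G_def by (rule S_H_koebe_transform[OF S a l_def])
  note DH = S_H_D[OF HG]
  have G0: "G z = 0" if "z \<in> unit_disc" for z
    using g[of a] g[of "(z + a) / (1 + cnj a * z)"] disc_automorphism_norm[OF a, of z] that a by (simp add: G_def)
  have "inj_on (harmonic_map H G) unit_disc \<longleftrightarrow> inj_on H unit_disc"
    by (rule inj_on_cong) (simp add: harmonic_map_def G0)
  then have "cmod (deriv (deriv H) 0) \<le> 4"
    using DH by (intro bieberbach_second_coefficient) auto
  have nz: "deriv h a \<noteq> 0"
    using jacobian_pos_holomorphic_nonzero[OF D(3)] a by simp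
  have a2: "(cmod a)\<^sup>2 < 1" using a by (simp add: abs_square_less_1)
  then have q0: "(of_real (1 - (cmod a)\<^sup>2) :: complex) \<noteq> 0" by (simp only: of_real_eq_0_iff)
  have l0: "l \<noteq> 0" using nz q0 by (simp add: l_def del: of_real_diff)
  have "deriv (deriv H) 0
      = of_real (1 - (cmod a)\<^sup>2) * (of_real (1 - (cmod a)\<^sup>2) * deriv (deriv h) a - 2 * cnj a * deriv h a) / l"
    by (rule koebe_transform_derivatives(3)[OF D(1) a H_def l0])
  also have "\<dots> = of_real (1 - (cmod a)\<^sup>2) * (deriv (deriv h) a / deriv h a) - 2 * cnj a"
    using nz q0 by (simp add: l_def field_simps del: of_real_diff)
  finally show ?thesis using \<open>cmod (deriv (deriv H) 0) \<le> 4\<close> by simp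
qed

text \<open>
  With these constants the condition reads \<open>(|h'| + |g'|)^2 \<le> |h'|^2 - |g'|^2\<close>, which forces
  \<open>g' = 0\<close>.
\<close>
lemma one_zero_quasiregular_conformal:
  assumes S: "(h, g) \<in> S_H" and qr: "quasiregular 1 0 h g" and z: "z \<in> unit_disc"
  shows "g z = 0"
proof -
  note D = S_H_D[OF S]
  have "deriv g w = 0" if w: "w \<in> unit_disc" for w
  proof -
    define x y where "x = cmod (deriv h w)" and "y = cmod (deriv g w)"
    have "(x + y)\<^sup>2 \<le> x\<^sup>2 - y\<^sup>2" using qr w by (simp add: quasiregular_def max_stretch_def jacobian_def x_def y_def)
    then have "2 * y\<^sup>2 + 2 * (x * y) \<le> 0" by (simp add: power2_eq_square algebra_simps)
    moreover have "0 \<le> x * y" by (simp add: x_def y_def)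
    ultimately have "y\<^sup>2 \<le> 0" by linarith
    then show ?thesis by (simp add: y_def)
  qed
  then have "g z = g 0"
  proof -
    have "\<exists>c. \<forall>w\<in>unit_disc. g w = c"
    proof (rule has_field_derivative_zero_constant[OF convex_ball])
      show "(g has_field_derivative 0) (at w within unit_disc)" if "w \<in> unit_disc" for w
        using holomorphic_derivI[OF D(2) open_ball that] \<open>\<And>w. w \<in> unit_disc \<Longrightarrow> deriv g w = 0\<close>[OF that]
        by (simp add: has_field_derivative_at_within)
    qed
    then show ?thesis using z by force
  qed
  then show ?thesis by (simp add: D)
qed

theorem theorem2p8:
  fixes K K0 :: real
  assumes "K \<ge> 1" and "K0 \<ge> 0"
  shows "\<exists>C::real. \<forall>(h :: complex \<Rightarrow> complex) (g :: complex \<Rightarrow> complex)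
           (a :: nat \<Rightarrow> complex) (b :: nat \<Rightarrow> complex).
     (h, g) \<in> S_H0_qr K K0 \<longrightarrow>
     (\<forall>z\<in>unit_disc. (\<lambda>n. a (n + 2) * z ^ (n + 2)) sums (h z - z)) \<longrightarrow>
     (\<forall>z\<in>unit_disc. (\<lambda>n. b (n + 2) * z ^ (n + 2)) sums g z) \<longrightarrow>
       (\<forall>p::real. p > 1 / gamma_H \<longrightarrow>
          (\<lambda>r. integral_mean p r (harmonic_map h g))
            \<in> O[at_left 1](\<lambda>r. 1 / (1 - r) powr (gamma_H - 1 / p))) \<and>
       (\<forall>n\<ge>2. cmod (a n) \<le> C * real n powr (gamma_H - 1)) \<and>
       (K - 1 = 0 \<and> K0 = 0 \<longrightarrow> (\<forall>n\<ge>2. cmod (a n) \<le> C * real n powr 1))"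
proof -
  have \<gamma>: "0 < gamma_H" "1 < gamma_H" using gamma_H_ge_2 by auto
  \<comment> \<open>the maximum with 1 gives \<open>Q \<le> 2 * B^2 * (1 - s) powr (- 2 * \<alpha>)\<close> without an additive constant\<close>
  define B where "B \<alpha> = max 1 (2 * 2 powr \<alpha> / \<alpha>)" for \<alpha> :: real
  have B1: "1 \<le> B \<alpha>" for \<alpha> by (simp add: B_def)
  have K: "0 \<le> K" "0 \<le> K0" using assms by auto
  have growth: "cmod (harmonic_map h g z) \<le> B \<alpha> * (1 - cmod z) powr (- \<alpha>)"
    if "(h, g) \<in> S_H" "0 < \<alpha>" "z \<in> unit_disc"
      "\<And>a. cmod a < 1 \<Longrightarrow> cmod (of_real (1 - (cmod a)\<^sup>2) * (deriv (deriv h) a / deriv h a) - 2 * cnj a) \<le> 2 * \<alpha>"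
    for h g \<alpha> z
  proof -
    have "cmod (harmonic_map h g z) \<le> 2 * 2 powr \<alpha> / \<alpha> * (1 - cmod z) powr (- \<alpha>)"
      by (rule harmonic_growth[OF that(1,2,4)]) (use that(3) in auto)
    also have "\<dots> \<le> B \<alpha> * (1 - cmod z) powr (- \<alpha>)" by (intro mult_right_mono) (auto simp: B_def)
    finally show ?thesis .
  qed
  define mean_bound where "mean_bound \<alpha> p C \<longleftrightarrow> 0 \<le> C \<and> (\<forall>h g. (h, g) \<in> S_H \<longrightarrow> quasiregular K K0 h g \<longrightarrow>
     (\<forall>z\<in>unit_disc. cmod (harmonic_map h g z) \<le> B \<alpha> * (1 - cmod z) powr (- \<alpha>)) \<longrightarrow>
     (\<forall>r\<in>{1/2..<1}. integral {0..2*pi} (\<lambda>t. cmod (harmonic_map h g (of_real r * cis t)) powr p)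
        \<le> C * (1 - r) powr (- (\<alpha> * p - 1))))" for \<alpha> p C :: real
  have mean: "\<exists>C. mean_bound \<alpha> p C" if "0 < \<alpha>" "0 < p" "1 < \<alpha> * p" for \<alpha> p
    unfolding mean_bound_def by (rule circle_mean_bound[OF K that B1])
  obtain C1 where C1: "mean_bound gamma_H 1 C1" using mean[of gamma_H 1] \<gamma> by auto
  obtain C2 where C2: "mean_bound 2 1 C2" using mean[of 2 1] by auto
  \<comment> \<open>the first constant serves the exponent \<open>gamma_H\<close>, the second the conformal case with exponent 2\<close>
  define C where "C = max C1 C2 * exp 2"
  have CC: "C1 * exp 2 \<le> C" "C2 * exp 2 \<le> C" by (auto simp: C_def)
  have main: "(\<forall>p::real. p > 1 / gamma_H \<longrightarrow>
          (\<lambda>r. integral_mean p r (harmonic_map h g))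
            \<in> O[at_left 1](\<lambda>r. 1 / (1 - r) powr (gamma_H - 1 / p))) \<and>
       (\<forall>n\<ge>2. cmod (a n) \<le> C * real n powr (gamma_H - 1)) \<and>
       (K - 1 = 0 \<and> K0 = 0 \<longrightarrow> (\<forall>n\<ge>2. cmod (a n) \<le> C * real n powr 1))"
    if qr: "(h, g) \<in> S_H0_qr K K0"
      and a: "\<forall>z\<in>unit_disc. (\<lambda>n. a (n + 2) * z ^ (n + 2)) sums (h z - z)" for h g a
  proof (intro conjI allI impI)
    have S: "(h, g) \<in> S_H" and q: "quasiregular K K0 h g"
      using qr by (auto simp: S_H0_qr_def S_H0_def)
    note D = S_H_D[OF S]
    have gr: "\<forall>z\<in>unit_disc. cmod (harmonic_map h g z) \<le> B gamma_H * (1 - cmod z) powr (- gamma_H)"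
      using growth[OF S \<gamma>(1)] S_H_pre_schwarzian_bound[OF S] by blast
    {
      fix p :: real assume p: "p > 1 / gamma_H"
      then have p0: "0 < p" using \<gamma> by (meson divide_pos_pos less_trans zero_less_one)
      have p1: "1 < gamma_H * p" using p \<gamma> by (simp add: field_simps)
      obtain Cp where Cp: "mean_bound gamma_H p Cp" using mean[OF \<gamma>(1) p0 p1] by blast
      show "(\<lambda>r. integral_mean p r (harmonic_map h g)) \<in> O[at_left 1](\<lambda>r. 1 / (1 - r) powr (gamma_H - 1 / p))"
      proof (rule integral_mean_bigo[OF p0])
        show "0 \<le> Cp" using Cp by (simp add: mean_bound_def)
        show "integral {0..2*pi} (\<lambda>t. cmod (harmonic_map h g (of_real r * cis t)) powr p) \<le> Cp * (1 - r) powr (- (gamma_H * p - 1))"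
          if "r \<in> {1/2..<1}" for r
          using Cp S q gr that unfolding mean_bound_def by blast
        show "(\<lambda>t. cmod (harmonic_map h g (of_real r * cis t)) powr p) integrable_on {0..2*pi}"
          if r: "r \<in> {1/2..<1}" for r
        proof -
          have "continuous_on {0..2*pi} (\<lambda>t. harmonic_map h g (of_real r * cis t))"
          proof (rule continuous_on_compose2[OF continuous_on_harmonic_map[OF D(1,2)]])
            show "continuous_on {0..2*pi} (\<lambda>t. of_real r * cis t)" by (intro continuous_intros)
          qed (use r in \<open>auto simp: norm_mult\<close>)
          then show ?thesis
            using p0 by (intro integrable_continuous_real continuous_on_powr' continuous_on_norm continuous_on_const) auto
        qed
      qed
    }
    have coeff: "cmod (a n) \<le> C * real n powr (\<alpha> - 1)"
      if n: "n \<ge> 2" and mb: "mean_bound \<alpha> 1 C'" and C': "C' * exp 2 \<le> C"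
        and gr: "\<forall>z\<in>unit_disc. cmod (harmonic_map h g z) \<le> B \<alpha> * (1 - cmod z) powr (- \<alpha>)" for n \<alpha> C'
    proof -
      have "cmod ((deriv ^^ n) h 0 / fact n) \<le> C' * exp 2 * real n powr (\<alpha> - 1)"
        by (rule coefficient_bound_from_mean[OF D(1,2) _ _ n]) (use mb S q gr in \<open>auto simp: mean_bound_def\<close>)
      also have "\<dots> \<le> C * real n powr (\<alpha> - 1)" by (intro mult_right_mono C') auto
      finally show ?thesis using taylor_coefficient_of_sums[OF a n] by simp
    qed
    {
      fix n :: nat assume "2 \<le> n"
      then show "cmod (a n) \<le> C * real n powr (gamma_H - 1)" by (rule coeff[OF _ C1 CC(1) gr])
    }
    {
      fix n :: nat assume KK: "K - 1 = 0 \<and> K0 = 0" and n: "2 \<le> n"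
      then have "quasiregular 1 0 h g" using q by simp
      then have g0: "g z = 0" if "z \<in> unit_disc" for z
        using one_zero_quasiregular_conformal[OF S _ that] by blast
      have "\<forall>z\<in>unit_disc. cmod (harmonic_map h g z) \<le> B 2 * (1 - cmod z) powr (- 2)"
        using growth[OF S, of 2] conformal_pre_schwarzian_bound[OF S g0] by simp
      from coeff[OF n C2 CC(2) this] show "cmod (a n) \<le> C * real n powr 1" by simp
    }
  qed
  show ?thesis by (intro exI[of _ C] allI impI) (rule main)
qed

end
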